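(* Let $\{P_{Y_iX_i}\}_{i\in[1:m]}$ and $\{Q_{Y_j^n}\}_{j\in[1:k]}$, $\{Q_{X_t^n}\}_{t\in[1:r]}$ satisfy the standing assumption (A) or (B) of the context. Let $\nu_i>0$, $\sum_{i=1}^m\nu_i=1$, and $\tau_{jt}\ge 0$, $\sum_{j,t}\tau_{jt}=1$, with $\tau_{j_i^\star t_s^\star}>0$ for every $s$ and every $i\in\mathfrak F_s$, and put $$P_{Y^nX^n}=\sum_{i=1}^m\nu_iP_{Y_iX_i}^{\otimes n},\qquad Q_{Y^nX^n}=\sum_{j,t}\tau_{jt}\,Q_{Y_j^n}\times Q_{X_t^n}.$$ Let $E^\star_{\mathrm{mix},\epsilon}(R_c)$ be the maximum $\epsilon$-achievable error exponent at rate $R_c$ for testing $P_{Y^nX^n}$ against $Q_{Y^nX^n}$ with one-sided compression. Assume that at a given $R_c\ge0$ the separability condition of the context holds and that $(\xi_i(R_c))_{i=1}^m$ is increasing, i.e. $\xi_1(R_c)\le\dots\le\xi_m(R_c)$. Then for every $\epsilon\in[0,1)$, $$E^\star_{\mathrm{mix},\epsilon}(R_c)=\sum_{i=1}^m\xi_i(R_c)\,\mathbf 1_{[\sum_{j=1}^{i-1}\nu_j,\ \sum_{j=1}^{i}\nu_j)}(\epsilon).$$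
   Context: Conventions: all alphabets are finite, $\log$ is natural, $[a:b]=\{a,\dots,b\}$, $P^{\otimes n}$ is the $n$-fold product, $P\ll Q$ is absolute continuity, $D(\cdot\Vert\cdot)$ is relative entropy ($+\infty$ if $P\not\ll Q$), $I$ is mutual information. Data: $P_{Y_iX_i}$, $i\in[1:m]$, are distributions on $\mathcal Y\times\mathcal X$ with marginals $P_{Y_i},P_{X_i}$; for each $n$, $Q_{Y_j^n}$ ($j\in[1:k]$) are distributions on $\mathcal Y^n$ and $Q_{X_t^n}$ ($t\in[1:r]$) distributions on $\mathcal X^n$. $\mathcal P_{\mathcal X}=\{P_{\mathcal X,1},\dots,P_{\mathcal X,|\mathcal P_{\mathcal X}|}\}$ is the set of distinct distributions among the $P_{X_i}$, and $\mathfrak F_s=\{i: P_{X_i}=P_{\mathcal X,s}\}$. Standing assumption: one of the following holds. (A) $Q_{X_t^n}=Q_{X_t}^{\otimes n}$ and $Q_{Y_j^n}=Q_{Y_j}^{\otimes n}$ for all $t,j$; $\min_jD(P_{Y_i}\Vert Q_{Y_j})<\infty$ for all $i$; $\min_tD(P_{\mathcal X,s}\Vert Q_{X_t})<\infty$ for all $s$. Define $j_i^\star=\arg\min_jD(P_{Y_i}\Vert Q_{Y_j})$, $d_i^{\mathrm y}=D(P_{Y_i}\Vert Q_{Y_{j_i^\star}})$, $t_s^\star=\arg\min_tD(P_{\mathcal X,s}\Vert Q_{X_t})$, $d_s^{\mathrm x}=D(P_{\mathcal X,s}\Vert Q_{X_{t_s^\star}})$. (B) For all $t,j$, $(Q_{X_t^n})_n$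 and $(Q_{Y_j^n})_n$ are the $n$-dimensional marginals of Markov processes of finite order with stationary (time-invariant) transition probabilities; for all $n$, $P_{\mathcal X,s}^{\otimes n}\ll Q_{X_t^n}$ for all $(s,t)$ and $P_{Y_i}^{\otimes n}\ll Q_{Y_j^n}$ for all $(i,j)$. Let $A_X^{(st)}=\lim_n[D(P_{\mathcal X,s}^{\otimes(n+1)}\Vert Q_{X_t^{n+1}})-D(P_{\mathcal X,s}^{\otimes n}\Vert Q_{X_t^n})]$ and $A_Y^{(ij)}=\lim_n[D(P_{Y_i}^{\otimes(n+1)}\Vert Q_{Y_j^{n+1}})-D(P_{Y_i}^{\otimes n}\Vert Q_{Y_j^n})]$ (these limits exist); assume $\min_jA_Y^{(ij)}<\infty$ for all $i$ and $\min_tA_X^{(st)}<\infty$ for all $s$. Define $j_i^\star=\arg\min_jA_Y^{(ij)}$, $d_i^{\mathrm y}=A_Y^{(ij_i^\star)}$, $t_s^\star=\arg\min_tA_X^{(st)}$, $d_s^{\mathrm x}=A_X^{(st_s^\star)}$. In both cases $\arg\min$ returns the first minimizer. Put $d_{is}^{\mathrm{yx}}=d_i^{\mathrm y}+d_s^{\mathrm x}$ for $i\in\mathfrak F_s$. Rate functions: for $i\in\mathfrak F_s$ let $(\bar Y_i,\bar X_s)\sim P_{Y_i|X_i}\times P_{\mathcal X,s}$ (i.e. $P_{Y_iX_i}$); a kernel $P_{U|\bar X_s}$ (with $U$ in a finite alphabet) defines $U$ with $\bar Y_i-\bar X_s-U$ Markov. For $i\in\mathfrak F_s$, $$\xi_i(R_c)=\max_{P_{U|\bar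 X_s}:\,I(\bar X_s;U)\le R_c}I(\bar Y_i;U)+d_{is}^{\mathrm{yx}}.$$ Separability condition at $R_c$: let $\mathcal W_s(R_c)=\{P_{U|\bar X_s}: I(\bar X_s;U)=R_c\}$ and, for $i\in\mathfrak F_s$, let $\mathcal W_s^{(i)}(R_c)$ be the set of kernels in $\mathcal W_s(R_c)$ attaining the maximum in $\xi_i(R_c)$. Let $\mathcal O_s(R_c)=\bigcap_{i\in\mathfrak F_s}\mathcal W_s^{(i)}(R_c)$ if this intersection is nonempty, and $\mathcal O_s(R_c)=\bigcup_{i\in\mathfrak F_s}\mathcal W_s^{(i)}(R_c)$ otherwise. The condition requires that for every $s$ the ordering of the numbers $I(\bar Y_i;U)+d_i^{\mathrm y}$, $i\in\mathfrak F_s$, does not depend on the kernel in $\mathcal O_s(R_c)$: there is an enumeration $i_1,\dots,i_{|\mathfrak F_s|}$ of $\mathfrak F_s$ such that for all $P_{U|\bar X_s}\in\mathcal O_s(R_c)$, $$I(\bar Y_{i_1};U)+d_{i_1}^{\mathrm y}\le I(\bar Y_{i_2};U)+d_{i_2}^{\mathrm y}\le\dots\le I(\bar Y_{i_{|\mathfrak F_s|}};U)+d_{i_{|\mathfrak F_s|}}^{\mathrm y}.$$ Testing schemes: a testing scheme is a pair $(\phi_n,\psi_n)$ with $\phi_n:\mathcal X^n\to\mathcal M$ ($\mathcal M=\mathcal M_n$ a finite set, $|\phi_n|:=|\mathcal M|$) and a possibly randomized decision map $\psi_n:\mathcal Y^n\times\mathcal M\to\{0,1\}$ (output $0$ means deciding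 the null hypothesis). For a distribution $P$ on $\mathcal Y^n\times\mathcal M$, $P(\psi_n)$ is the probability that $\psi_n$ outputs $0$ and $P(1-\psi_n)=1-P(\psi_n)$. $P_{Y^n\phi_n(X^n)}$, $Q_{Y^n\phi_n(X^n)}$ denote the laws of $(Y^n,\phi_n(X^n))$ under $P_{Y^nX^n}$, $Q_{Y^nX^n}$. Put $\alpha_n=P_{Y^n\phi_n(X^n)}(1-\psi_n)$, $\beta_n=Q_{Y^n\phi_n(X^n)}(\psi_n)$. $E$ is $\epsilon$-achievable at rate $R_c$ if there is a sequence of testing schemes with $\limsup_n\alpha_n\le\epsilon$, $\liminf_n\frac1n\log\frac1{\beta_n}\ge E$, $\limsup_n\frac1n\log|\phi_n|\le R_c$; $E^\star_{\mathrm{mix},\epsilon}(R_c)$ is the supremum of $\epsilon$-achievable $E$. *)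

theory Defs
  imports "HOL-Probability.Probability"
begin

section \<open>Information measures (natural logarithm)\<close>

definition abs_cont :: "'a pmf \<Rightarrow> 'a pmf \<Rightarrow> bool" where
  "abs_cont P Q \<longleftrightarrow> absolutely_continuous (measure_pmf Q) (measure_pmf P)"

text \<open>The library's \<^const>\<open>KL_divergence\<close> takes the reference measure first, and is a real number
  without meaning if absolute continuity fails.\<close>

definition rel_entropy :: "'a pmf \<Rightarrow> 'a pmf \<Rightarrow> ereal" where
  "rel_entropy P Q =
     (if abs_cont P Q then ereal (KL_divergence (exp 1) (measure_pmf Q) (measure_pmf P)) else \<infinity>)"

definition mutual_info :: "('a \<times> 'b) pmf \<Rightarrow> real" where
  "mutual_info J =
     prob_space.mutual_information (measure_pmf J) (exp 1) (count_space UNIV) (count_space UNIV) fst snd"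

lemma abs_cont_iff: "abs_cont P Q \<longleftrightarrow> set_pmf P \<subseteq> set_pmf Q"
proof -
  have *: "null_sets (measure_pmf R) = {A. A \<inter> set_pmf R = {}}" for R :: "'a pmf"
    by (auto simp: null_sets_def measure_pmf.emeasure_eq_measure measure_pmf_zero_iff)
  show ?thesis
    unfolding abs_cont_def absolutely_continuous_def * by blast
qed

lemma rel_entropy_eq_sum:
  assumes "finite (set_pmf P)" and "abs_cont P Q"
  shows "rel_entropy P Q = ereal (\<Sum>x\<in>set_pmf P. pmf P x * ln (pmf P x / pmf Q x))"
proof -
  have eqQ: "measure_pmf Q = density (count_space UNIV) (\<lambda>x. ennreal (pmf Q x))"
    by (rule measure_pmf_eq_density)
  have sub: "set_pmf P \<subseteq> set_pmf Q" using assms(2) by (simp add: abs_cont_iff)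
  have "measure_pmf P = density (measure_pmf Q) (\<lambda>x. ennreal (pmf P x / pmf Q x))"
  proof -
    have "ennreal (pmf Q x) * ennreal (pmf P x / pmf Q x) = ennreal (pmf P x)" for x
      using sub by (cases "x \<in> set_pmf Q") (auto simp: ennreal_mult[symmetric] set_pmf_iff)
    then show ?thesis
      unfolding eqQ by (subst density_density_eq) (auto simp: measure_pmf_eq_density)
  qed
  then have "KL_divergence (exp 1) (measure_pmf Q) (measure_pmf P)
     = KL_divergence (exp 1) (measure_pmf Q) (density (measure_pmf Q) (\<lambda>x. pmf P x / pmf Q x))"
    by simp
  also have "\<dots> = (\<integral>x. pmf P x / pmf Q x * log (exp 1) (pmf P x / pmf Q x) \<partial>measure_pmf Q)"
    by (rule sigma_finite_measure.KL_density) (auto intro: measure_pmf.sigma_finite_measure_axioms)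
  also have "\<dots> = (\<Sum>x\<in>set_pmf P. (pmf P x / pmf Q x * log (exp 1) (pmf P x / pmf Q x)) * pmf Q x)"
    by (rule integral_measure_pmf_real[OF assms(1)]) (auto simp: set_pmf_iff)
  also have "\<dots> = (\<Sum>x\<in>set_pmf P. pmf P x * ln (pmf P x / pmf Q x))"
    using sub by (intro sum.cong) (auto simp: set_pmf_iff log_def)
  finally show ?thesis using assms(2) by (simp add: rel_entropy_def)
qed

lemma mutual_info_eq_KL:
  fixes J :: "('a::countable \<times> 'b::countable) pmf"
  shows "mutual_info J =
    KL_divergence (exp 1) (measure_pmf (pair_pmf (map_pmf fst J) (map_pmf snd J))) (measure_pmf J)"
proof -
  have m: "distr (measure_pmf J) (count_space UNIV) f = measure_pmf (map_pmf f J)"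
    for f :: "_ \<Rightarrow> 'c" by (simp add: map_pmf_rep_eq)
  have q: "count_space UNIV \<Otimes>\<^sub>M count_space UNIV = (count_space UNIV :: ('a \<times> 'b) measure)"
    by (simp add: pair_measure_countable[OF countableI_type countableI_type])
  have p: "measure_pmf A \<Otimes>\<^sub>M measure_pmf B = measure_pmf (pair_pmf A B)"
    for A :: "'a pmf" and B :: "'b pmf"
  proof (rule pair_measure_eqI)
    show "sigma_finite_measure (measure_pmf A)" "sigma_finite_measure (measure_pmf B)"
      by unfold_locales
    have "sets (measure_pmf A \<Otimes>\<^sub>M measure_pmf B)
        = sets (count_space UNIV \<Otimes>\<^sub>M count_space UNIV :: ('a \<times> 'b) measure)"
      by (rule sets_pair_measure_cong) simp_all
    then show "sets (measure_pmf A \<Otimes>\<^sub>M measure_pmf B) = sets (measure_pmf (pair_pmf A B))"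
      unfolding q by simp
    show "emeasure (measure_pmf A) X * emeasure (measure_pmf B) Y =
        emeasure (measure_pmf (pair_pmf A B)) (X \<times> Y)" for X Y
      by (simp add: measure_pmf.emeasure_eq_measure measure_pmf_prob_product
          ennreal_mult[symmetric])
  qed
  show ?thesis
    unfolding mutual_info_def prob_space.mutual_information_def[OF prob_space_measure_pmf]
    by (simp add: q map_pmf_rep_eq[symmetric] p)
qed

section \<open>Sources\<close>

definition mixture_pmf :: "'i set \<Rightarrow> ('i \<Rightarrow> real) \<Rightarrow> ('i \<Rightarrow> 'a pmf) \<Rightarrow> 'a pmf" where
  "mixture_pmf A w p = embed_pmf (\<lambda>z. \<Sum>a\<in>A. w a * pmf (p a) z)"

lemma pmf_mixture_pmf:
  assumes "finite A" "\<And>a. a \<in> A \<Longrightarrow> w a \<ge> 0" "sum w A = 1"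
  shows "pmf (mixture_pmf A w p) z = (\<Sum>a\<in>A. w a * pmf (p a) z)"
  unfolding mixture_pmf_def
proof (rule pmf_embed_pmf)
  show "0 \<le> (\<Sum>a\<in>A. w a * pmf (p a) x)" for x
    using assms(2) by (intro sum_nonneg) auto
  have "(\<integral>\<^sup>+x. ennreal (\<Sum>a\<in>A. w a * pmf (p a) x) \<partial>count_space UNIV)
      = (\<integral>\<^sup>+x. (\<Sum>a\<in>A. ennreal (w a) * ennreal (pmf (p a) x)) \<partial>count_space UNIV)"
    using assms(2)
    by (intro nn_integral_cong) (subst sum_ennreal[symmetric], auto simp: ennreal_mult)
  also have "\<dots> = (\<Sum>a\<in>A. ennreal (w a) * (\<integral>\<^sup>+x. ennreal (pmf (p a) x) \<partial>count_space UNIV))"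
    by (subst nn_integral_sum) (auto simp: nn_integral_cmult)
  also have "\<dots> = (\<Sum>a\<in>A. ennreal (w a))"
    by (simp add: nn_integral_pmf_eq_1)
  also have "\<dots> = 1"
    using assms by (simp add: sum_ennreal)
  finally show "(\<integral>\<^sup>+x. ennreal (\<Sum>a\<in>A. w a * pmf (p a) x) \<partial>count_space UNIV) = 1" .
qed

text \<open>An element of a product alphabet \<open>\<Y>\<^sup>n\<close> is a list of length \<open>n\<close>; correspondingly
  \<^term>\<open>replicate_pmf n P\<close> is the product distribution of \<open>P\<close>. An element of \<open>(\<Y> \<times> \<X>)\<^sup>n\<close> is
  regarded as an element of \<open>\<Y>\<^sup>n \<times> \<X>\<^sup>n\<close>.\<close>

definition iid_pair :: "nat \<Rightarrow> ('y \<times> 'x) pmf \<Rightarrow> ('y list \<times> 'x list) pmf" where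
  "iid_pair n P = map_pmf (\<lambda>zs. (map fst zs, map snd zs)) (replicate_pmf n P)"

definition P_mix :: "nat \<Rightarrow> (nat \<Rightarrow> real) \<Rightarrow> (nat \<Rightarrow> ('y \<times> 'x) pmf) \<Rightarrow> nat \<Rightarrow> ('y list \<times> 'x list) pmf"
  where "P_mix m \<nu> PYX n = mixture_pmf {1..m} \<nu> (\<lambda>i. iid_pair n (PYX i))"

definition Q_mix :: "nat \<Rightarrow> nat \<Rightarrow> (nat \<Rightarrow> nat \<Rightarrow> real) \<Rightarrow> (nat \<Rightarrow> nat \<Rightarrow> 'y list pmf)
    \<Rightarrow> (nat \<Rightarrow> nat \<Rightarrow> 'x list pmf) \<Rightarrow> nat \<Rightarrow> ('y list \<times> 'x list) pmf"
  where "Q_mix k r \<tau> QY QX n =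
    mixture_pmf ({1..k} \<times> {1..r}) (\<lambda>(j, t). \<tau> j t) (\<lambda>(j, t). pair_pmf (QY j n) (QX t n))"

text \<open>The law \<open>M\<close> of a process \<open>Z\<^sub>0, Z\<^sub>1, \<dots>\<close> (the coordinates) which is Markov of order \<open>l\<close>, with
  transition probabilities \<open>W\<close> that do not depend on time. The initial law is arbitrary.\<close>

definition markov_process :: "nat \<Rightarrow> ('a list \<Rightarrow> 'a pmf) \<Rightarrow> (nat \<Rightarrow> 'a) measure \<Rightarrow> bool" where
  "markov_process l W M \<longleftrightarrow>
     prob_space M \<and> sets M = sets (PiM UNIV (\<lambda>_. count_space UNIV)) \<and>
     (\<forall>n\<ge>l. \<forall>zs z. length zs = n \<longrightarrow> measure M {\<omega> \<in> space M. map \<omega> [0..<n] = zs} > 0 \<longrightarrow>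
        cond_prob M (\<lambda>\<omega>. \<omega> n = z) (\<lambda>\<omega>. map \<omega> [0..<n] = zs) = pmf (W (drop (n - l) zs)) z)"

definition markov_marginals :: "(nat \<Rightarrow> 'a list pmf) \<Rightarrow> bool" where
  "markov_marginals Q \<longleftrightarrow>
     (\<exists>l W M. markov_process l W M \<and>
        (\<forall>n zs. pmf (Q n) zs = measure M {\<omega> \<in> space M. map \<omega> [0..<n] = zs}))"

definition divergence_rate :: "'a pmf \<Rightarrow> (nat \<Rightarrow> 'a list pmf) \<Rightarrow> ereal" where
  "divergence_rate P Q = lim (\<lambda>n. rel_entropy (replicate_pmf (Suc n) P) (Q (Suc n))
                                - rel_entropy (replicate_pmf n P) (Q n))"

section \<open>Standing assumptions\<close>

text \<open>The distinct distributions \<open>P\<^bsub>\<X>,s\<^esub>\<close> are not numbered: such a distribution \<open>S\<close> itself plays the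
  role of the index \<open>s\<close>.\<close>

definition PY :: "(nat \<Rightarrow> ('y \<times> 'x) pmf) \<Rightarrow> nat \<Rightarrow> 'y pmf" where
  "PY PYX i = map_pmf fst (PYX i)"

definition PX :: "(nat \<Rightarrow> ('y \<times> 'x) pmf) \<Rightarrow> nat \<Rightarrow> 'x pmf" where
  "PX PYX i = map_pmf snd (PYX i)"

definition X_laws :: "nat \<Rightarrow> (nat \<Rightarrow> ('y \<times> 'x) pmf) \<Rightarrow> 'x pmf set" where
  "X_laws m PYX = PX PYX ` {1..m}"

definition F_class :: "nat \<Rightarrow> (nat \<Rightarrow> ('y \<times> 'x) pmf) \<Rightarrow> 'x pmf \<Rightarrow> nat set" where
  "F_class m PYX S = {i \<in> {1..m}. PX PYX i = S}"

text \<open>In either case \<open>cY i j\<close> and \<open>cX S t\<close> are the quantities that \<open>j\<^sub>i\<^sup>\<star>\<close> and \<open>t\<^sub>s\<^sup>\<star>\<close> minimize: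
  relative entropies of single letters in case A, \<open>A\<^sub>Y\<^sup>(\<^sup>i\<^sup>j\<^sup>)\<close> and \<open>A\<^sub>X\<^sup>(\<^sup>s\<^sup>t\<^sup>)\<close> in case B.\<close>

definition min_costs_finite :: "nat \<Rightarrow> nat \<Rightarrow> nat \<Rightarrow> (nat \<Rightarrow> ('y \<times> 'x) pmf)
    \<Rightarrow> (nat \<Rightarrow> nat \<Rightarrow> ereal) \<Rightarrow> ('x pmf \<Rightarrow> nat \<Rightarrow> ereal) \<Rightarrow> bool" where
  "min_costs_finite m k r PYX cY cX \<longleftrightarrow>
     (\<forall>i\<in>{1..m}. (MIN j\<in>{1..k}. cY i j) < \<infinity>) \<and> (\<forall>S\<in>X_laws m PYX. (MIN t\<in>{1..r}. cX S t) < \<infinity>)"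

definition standing_A :: "nat \<Rightarrow> nat \<Rightarrow> nat \<Rightarrow> (nat \<Rightarrow> ('y \<times> 'x) pmf)
    \<Rightarrow> (nat \<Rightarrow> nat \<Rightarrow> 'y list pmf) \<Rightarrow> (nat \<Rightarrow> nat \<Rightarrow> 'x list pmf)
    \<Rightarrow> (nat \<Rightarrow> nat \<Rightarrow> ereal) \<Rightarrow> ('x pmf \<Rightarrow> nat \<Rightarrow> ereal) \<Rightarrow> bool" where
  "standing_A m k r PYX QY QX cY cX \<longleftrightarrow>
     (\<exists>qY qX.
        (\<forall>j\<in>{1..k}. \<forall>n. QY j n = replicate_pmf n (qY j)) \<and>
        (\<forall>t\<in>{1..r}. \<forall>n. QX t n = replicate_pmf n (qX t)) \<and>
        (\<forall>i\<in>{1..m}. \<forall>j\<in>{1..k}. cY i j = rel_entropy (PY PYX i) (qY j)) \<and>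
        (\<forall>S\<in>X_laws m PYX. \<forall>t\<in>{1..r}. cX S t = rel_entropy S (qX t))) \<and>
     min_costs_finite m k r PYX cY cX"

definition standing_B :: "nat \<Rightarrow> nat \<Rightarrow> nat \<Rightarrow> (nat \<Rightarrow> ('y \<times> 'x) pmf)
    \<Rightarrow> (nat \<Rightarrow> nat \<Rightarrow> 'y list pmf) \<Rightarrow> (nat \<Rightarrow> nat \<Rightarrow> 'x list pmf)
    \<Rightarrow> (nat \<Rightarrow> nat \<Rightarrow> ereal) \<Rightarrow> ('x pmf \<Rightarrow> nat \<Rightarrow> ereal) \<Rightarrow> bool" where
  "standing_B m k r PYX QY QX cY cX \<longleftrightarrow>
     (\<forall>j\<in>{1..k}. markov_marginals (QY j)) \<and>
     (\<forall>t\<in>{1..r}. markov_marginals (QX t)) \<and>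
     (\<forall>n. \<forall>i\<in>{1..m}. \<forall>j\<in>{1..k}. abs_cont (replicate_pmf n (PY PYX i)) (QY j n)) \<and>
     (\<forall>n. \<forall>S\<in>X_laws m PYX. \<forall>t\<in>{1..r}. abs_cont (replicate_pmf n S) (QX t n)) \<and>
     (\<forall>i\<in>{1..m}. \<forall>j\<in>{1..k}. cY i j = divergence_rate (PY PYX i) (QY j)) \<and>
     (\<forall>S\<in>X_laws m PYX. \<forall>t\<in>{1..r}. cX S t = divergence_rate S (QX t)) \<and>
     min_costs_finite m k r PYX cY cX"

definition first_arg_min :: "nat \<Rightarrow> (nat \<Rightarrow> ereal) \<Rightarrow> nat" where
  "first_arg_min k c = (LEAST j. is_arg_min c (\<lambda>j. j \<in> {1..k}) j)"

definition min_cost :: "nat \<Rightarrow> (nat \<Rightarrow> ereal) \<Rightarrow> real" where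
  "min_cost k c = real_of_ereal (c (first_arg_min k c))"

section \<open>Rate functions and the separability condition\<close>

text \<open>The finite alphabet of \<open>U\<close> is, up to renaming, a finite set of natural numbers.\<close>

definition kernels :: "('x::finite \<Rightarrow> nat pmf) set" where
  "kernels = {K. \<forall>x. finite (set_pmf (K x))}"

definition I_XU :: "'x::finite pmf \<Rightarrow> ('x \<Rightarrow> nat pmf) \<Rightarrow> real" where
  "I_XU S K = mutual_info (bind_pmf S (\<lambda>x. map_pmf (\<lambda>u. (x, u)) (K x)))"

definition I_YU :: "('y::finite \<times> 'x::finite) pmf \<Rightarrow> ('x \<Rightarrow> nat pmf) \<Rightarrow> real" where
  "I_YU P K = mutual_info (bind_pmf P (\<lambda>(y, x). map_pmf (\<lambda>u. (y, u)) (K x)))"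

text \<open>The set is nonempty and bounded, and its supremum is attained.\<close>

definition max_I_YU :: "('y::finite \<times> 'x::finite) pmf \<Rightarrow> real \<Rightarrow> real" where
  "max_I_YU P R = Sup {I_YU P K |K. K \<in> kernels \<and> I_XU (map_pmf snd P) K \<le> R}"

definition \<xi> :: "(nat \<Rightarrow> ('y::finite \<times> 'x::finite) pmf) \<Rightarrow> nat \<Rightarrow> nat \<Rightarrow> (nat \<Rightarrow> nat \<Rightarrow> ereal)
    \<Rightarrow> ('x pmf \<Rightarrow> nat \<Rightarrow> ereal) \<Rightarrow> real \<Rightarrow> nat \<Rightarrow> real" where
  "\<xi> PYX k r cY cX R i =
     max_I_YU (PYX i) R + (min_cost k (cY i) + min_cost r (cX (PX PYX i)))"

definition W_set :: "'x::finite pmf \<Rightarrow> real \<Rightarrow> ('x \<Rightarrow> nat pmf) set" where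
  "W_set S R = {K \<in> kernels. I_XU S K = R}"

definition W_opt :: "(nat \<Rightarrow> ('y::finite \<times> 'x::finite) pmf) \<Rightarrow> 'x pmf \<Rightarrow> real \<Rightarrow> nat
    \<Rightarrow> ('x \<Rightarrow> nat pmf) set" where
  "W_opt PYX S R i = {K \<in> W_set S R. I_YU (PYX i) K = max_I_YU (PYX i) R}"

definition O_set :: "nat \<Rightarrow> (nat \<Rightarrow> ('y::finite \<times> 'x::finite) pmf) \<Rightarrow> 'x pmf \<Rightarrow> real
    \<Rightarrow> ('x \<Rightarrow> nat pmf) set" where
  "O_set m PYX S R =
     (if (\<Inter>i\<in>F_class m PYX S. W_opt PYX S R i) \<noteq> {}
      then (\<Inter>i\<in>F_class m PYX S. W_opt PYX S R i)
      else (\<Union>i\<in>F_class m PYX S. W_opt PYX S R i))"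

definition separable_at :: "nat \<Rightarrow> (nat \<Rightarrow> ('y::finite \<times> 'x::finite) pmf) \<Rightarrow> nat
    \<Rightarrow> (nat \<Rightarrow> nat \<Rightarrow> ereal) \<Rightarrow> real \<Rightarrow> bool" where
  "separable_at m PYX k cY R \<longleftrightarrow>
     (\<forall>S\<in>X_laws m PYX. \<exists>is. distinct is \<and> set is = F_class m PYX S \<and>
        (\<forall>K\<in>O_set m PYX S R. sorted (map (\<lambda>i. I_YU (PYX i) K + min_cost k (cY i)) is)))"

section \<open>Testing with one-sided compression\<close>

datatype hypothesis = H0 | H1

text \<open>The message set is, up to renaming, a finite set of natural numbers. The decision map
  outputs \<^const>\<open>H0\<close> (the output 0) to decide the null hypothesis.\<close>

definition encoder :: "nat \<Rightarrow> nat set \<Rightarrow> ('x list \<Rightarrow> nat) \<Rightarrow> bool" where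
  "encoder n M \<phi> \<longleftrightarrow> finite M \<and> \<phi> \<in> {xs. length xs = n} \<rightarrow> M"

definition compressed :: "('x list \<Rightarrow> nat) \<Rightarrow> ('y list \<times> 'x list) pmf \<Rightarrow> ('y list \<times> nat) pmf" where
  "compressed \<phi> P = map_pmf (\<lambda>(y, x). (y, \<phi> x)) P"

definition prob_H0 :: "('y list \<times> nat) pmf \<Rightarrow> ('y list \<times> nat \<Rightarrow> hypothesis pmf) \<Rightarrow> real" where
  "prob_H0 P \<psi> = pmf (bind_pmf P \<psi>) H0"

text \<open>\<open>log (1 / b)\<close> for \<open>b \<ge> 0\<close>, with the value \<open>\<infinity>\<close> at \<open>b = 0\<close> (where \<^const>\<open>ln\<close> is 0).\<close>

definition log_inv :: "real \<Rightarrow> ereal" where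
  "log_inv b = (if b = 0 then \<infinity> else ereal (ln (1 / b)))"

definition achievable :: "(nat \<Rightarrow> ('y list \<times> 'x list) pmf) \<Rightarrow> (nat \<Rightarrow> ('y list \<times> 'x list) pmf)
    \<Rightarrow> real \<Rightarrow> real \<Rightarrow> real \<Rightarrow> bool" where
  "achievable P Q \<epsilon> R E \<longleftrightarrow>
     (\<exists>M \<phi> \<psi>.
        (\<forall>n. encoder n (M n) (\<phi> n)) \<and>
        limsup (\<lambda>n. ereal (1 - prob_H0 (compressed (\<phi> n) (P n)) (\<psi> n))) \<le> ereal \<epsilon> \<and>
        liminf (\<lambda>n. ereal (1 / real n) * log_inv (prob_H0 (compressed (\<phi> n) (Q n)) (\<psi> n))) \<ge> ereal E \<and>
        limsup (\<lambda>n. ereal (1 / real n * ln (real (card (M n))))) \<le> ereal R)"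

definition E_star :: "(nat \<Rightarrow> ('y list \<times> 'x list) pmf) \<Rightarrow> (nat \<Rightarrow> ('y list \<times> 'x list) pmf)
    \<Rightarrow> real \<Rightarrow> real \<Rightarrow> ereal" where
  "E_star P Q \<epsilon> R = Sup {ereal E |E. achievable P Q \<epsilon> R E}"

end

theory Submission
  imports Defs "HOL-Real_Asymp.Real_Asymp"
begin

text \<open>
  In cases A and B alike, \<open>Q\<^sup>n / P\<^sup>n\<close> equals \<open>exp (- n c)\<close> up to
  a subexponential factor with \<open>P\<^sup>n\<close>-probability tending to 1, where \<open>c\<close> is the quantity that is minimized:
  the log-likelihood ratio is a sum over windows of an i.i.d. sequence, and such a sum is reduced to
  windows that are shorter by one letter, up to a martingale with bounded increments. So the reference laws may
  be replaced by the product laws of the null hypothesis.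

  Converse: if \<open>\<epsilon> < \<nu>\<^sub>1 + \<dots> + \<nu>\<^sub>i\<close>, some component \<open>j \<le> i\<close> is accepted with probability bounded away
  from 0, and a strong converse for that component gives \<open>E \<le> \<xi>\<^sub>j \<le> \<xi>\<^sub>i\<close>. The strong converse comes from
  duality. Strictly separating the compact convex region of the pairs \<open>(I(X;U), I(Y;U))\<close> from the points
  beyond the rate function yields an entropy inequality, whose functional form tensorizes by
  log-convexity. It is applied to \<open>\<kappa>\<close> to the power of the Hamming distance from the acceptance region,
  which is subexponentially close to the indicator because a Lipschitz function of \<open>n\<close> independent letters
  has variance at most \<open>n\<close>.

  Achievability: if \<open>\<nu>\<^sub>1 + \<dots> + \<nu>\<^sub>i\<^sub>-\<^sub>1 \<le> \<epsilon>\<close>, only the components \<open>j \<ge> i\<close> must be accepted. The encoder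
  reads off the class of the marginal of \<open>X\<close> and uses one codebook, chosen greedily, per class. By separability
  a single kernel serves all \<open>j \<ge> i\<close> in a class: an optimal kernel of the component that comes first
  in the prescribed ordering.
\<close>

section \<open>Expectations, the law of large numbers for windows\<close>

text \<open>Under each product in the alternative, \<open>Y^n\<close> and the message are
  independent, so the probability of false acceptance is a sum over messages of products of an
  X-probability and a Y-probability. Passing to the null marginals costs an exponent for each factor
  separately, hence the sum of two costs in \<open>\<xi>\<close>. What remains is an image size
  problem: how improbable can a set of Y-words be that is reached with non-vanishing probability
  from every word of a set of X-probability about \<open>exp (- n R)\<close>? A weak converse of
  Fano type would not suffice, since a small positive acceptance probability is all that the mixture
  guarantees for some component. In the other direction the obstacle is the boundary
  \<open>I(X;U) = R\<close>: the codebook estimate needs strict inequality, while optimal kernels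
  may use up the whole rate. Erasing U with small probability restores a gap and scales
  \<open>I(Y;U)\<close> by the same factor for every component of a class, so one modified kernel
  still serves them all. At \<open>R = 0\<close> no gap is possible; the admissible kernels then
  have \<open>I(Y;U) = 0\<close>, and a constant U, whose density is exactly 1, takes over.\<close>

definition expect :: "'a pmf \<Rightarrow> ('a \<Rightarrow> real) \<Rightarrow> real" where
  "expect p f = (\<Sum>x\<in>set_pmf p. pmf p x * f x)"

lemma expect_eq_expectation:
  "finite (set_pmf p) \<Longrightarrow> expect p f = measure_pmf.expectation p f"
  unfolding expect_def by (subst integral_measure_pmf_real) (auto simp: mult.commute)

lemma expect_superset:
  "finite A \<Longrightarrow> set_pmf p \<subseteq> A \<Longrightarrow> expect p f = (\<Sum>x\<in>A. pmf p x * f x)"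
  unfolding expect_def by (rule sum.mono_neutral_left) (auto simp: set_pmf_iff)

lemma expect_cong: "(\<And>x. x \<in> set_pmf p \<Longrightarrow> f x = g x) \<Longrightarrow> expect p f = expect p g"
  unfolding expect_def by (rule sum.cong) auto

lemma expect_mono: "(\<And>x. x \<in> set_pmf p \<Longrightarrow> f x \<le> g x) \<Longrightarrow> expect p f \<le> expect p g"
  unfolding expect_def by (rule sum_mono) (auto intro: mult_left_mono)

lemma expect_nonneg: "(\<And>x. x \<in> set_pmf p \<Longrightarrow> 0 \<le> f x) \<Longrightarrow> 0 \<le> expect p f"
  unfolding expect_def by (rule sum_nonneg) auto

text \<open>Since \<open>expect\<close> is a plain sum over the support, linearity and the
  interchange of two expectations carry no integrability hypotheses.\<close>

lemma expect_add: "expect p (\<lambda>x. f x + g x) = expect p f + expect p g"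
  by (simp add: expect_def distrib_left sum.distrib)

lemma expect_diff: "expect p (\<lambda>x. f x - g x) = expect p f - expect p g"
  by (simp add: expect_def right_diff_distrib sum_subtractf)

lemma expect_cmult: "expect p (\<lambda>x. c * f x) = c * expect p f"
  by (simp add: expect_def sum_distrib_left mult_ac)

lemma expect_sum: "expect p (\<lambda>x. \<Sum>i\<in>I. f i x) = (\<Sum>i\<in>I. expect p (f i))"
  unfolding expect_def by (subst sum.swap) (simp add: sum_distrib_left)

lemma expect_const [simp]: "finite (set_pmf p) \<Longrightarrow> expect p (\<lambda>_. c) = c"
  by (simp add: expect_def sum_pmf_eq_1 flip: sum_distrib_right)

lemma expect_return [simp]: "expect (return_pmf x) f = f x"
  by (simp add: expect_def)

lemma expect_bind:
  assumes "finite (set_pmf p)" "\<And>x. x \<in> set_pmf p \<Longrightarrow> finite (set_pmf (k x))"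
  shows "expect (bind_pmf p k) f = expect p (\<lambda>x. expect (k x) f)"
proof -
  have "expect (bind_pmf p k) f = measure_pmf.expectation (bind_pmf p k) f"
    using assms by (intro expect_eq_expectation) auto
  also have "\<dots> = (\<Sum>a\<in>set_pmf p. pmf p a * measure_pmf.expectation (k a) f)"
    using pmf_expectation_bind[of "set_pmf p" k p f] assms by simp
  finally show ?thesis using assms(2) by (simp add: expect_def[of p] expect_eq_expectation)
qed

lemma expect_map:
  assumes "finite (set_pmf p)" shows "expect (map_pmf h p) f = expect p (\<lambda>x. f (h x))"
  using assms by (simp add: expect_eq_expectation)

lemma expect_swap:
  "expect p (\<lambda>x. expect q (f x)) = expect q (\<lambda>y. expect p (\<lambda>x. f x y))"
  unfolding expect_def sum_distrib_left by (subst sum.swap) (simp add: mult_ac)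

lemma expect_indicator:
  assumes "finite (set_pmf p)"
  shows "expect p (indicator A) = measure_pmf.prob p A"
  using assms by (simp add: expect_eq_expectation)

lemma pmf_bind_expect:
  "finite (set_pmf p) \<Longrightarrow> pmf (bind_pmf p k) y = expect p (\<lambda>x. pmf (k x) y)"
  by (simp add: pmf_bind expect_eq_expectation)

lemma finite_set_replicate_pmf: "finite (set_pmf p) \<Longrightarrow> finite (set_pmf (replicate_pmf n p))"
proof -
  assume "finite (set_pmf p)"
  then have "finite {xs. set xs \<subseteq> set_pmf p \<and> length xs = n}" by (rule finite_lists_length_eq)
  then show ?thesis by (rule finite_subset[rotated]) (auto simp: set_replicate_pmf)
qed

lemma in_set_replicate_pmf:
  "xs \<in> set_pmf (replicate_pmf n p) \<longleftrightarrow> length xs = n \<and> set xs \<subseteq> set_pmf p"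
  by (auto simp: set_replicate_pmf)

lemma expect_replicate_Suc:
  assumes "finite (set_pmf p)"
  shows "expect (replicate_pmf (Suc n) p) f = expect p (\<lambda>x. expect (replicate_pmf n p) (\<lambda>xs. f (x # xs)))"
  using assms by (simp add: expect_bind finite_set_replicate_pmf)

text \<open>\<open>replicate_pmf\<close> grows at the front, but processes and windows grow at the
  end; this form exposes the last letter.\<close>

lemma replicate_pmf_snoc:
  "replicate_pmf (Suc n) p = bind_pmf (replicate_pmf n p) (\<lambda>xs. map_pmf (\<lambda>x. xs @ [x]) p)"
  using replicate_pmf_distrib[of n 1 p] unfolding replicate_pmf_1
  by (simp add: map_pmf_def bind_assoc_pmf bind_return_pmf del: replicate_pmf.simps(2))

lemma expect_replicate_snoc:
  assumes "finite (set_pmf p)"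
  shows "expect (replicate_pmf (Suc n) p) f = expect (replicate_pmf n p) (\<lambda>xs. expect p (\<lambda>x. f (xs @ [x])))"
  using assms unfolding replicate_pmf_snoc
  by (simp add: expect_bind finite_set_replicate_pmf expect_map)

lemma pmf_replicate_Cons:
  assumes "finite (set_pmf p)"
  shows "pmf (replicate_pmf (Suc n) p) (x # xs) = pmf p x * pmf (replicate_pmf n p) xs"
proof -
  have "replicate_pmf (Suc n) p = map_pmf (\<lambda>(x, xs). x # xs) (pair_pmf p (replicate_pmf n p))"
    by (simp add: pair_pmf_def map_pmf_def bind_assoc_pmf bind_return_pmf)
  also have "pmf \<dots> (x # xs) = pmf (pair_pmf p (replicate_pmf n p)) (x, xs)"
    using pmf_map_inj'[of "\<lambda>(x, xs). x # xs" "pair_pmf p (replicate_pmf n p)" "(x, xs)"] by (simp add: inj_on_def)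
  finally show ?thesis by (simp add: pmf_pair)
qed

lemma pmf_replicate_snoc:
  "pmf (replicate_pmf (Suc n) p) (xs @ [x]) = pmf (replicate_pmf n p) xs * pmf p x"
proof -
  have "replicate_pmf (Suc n) p = map_pmf (\<lambda>(xs, x). xs @ [x]) (pair_pmf (replicate_pmf n p) p)"
    unfolding replicate_pmf_snoc by (simp add: pair_pmf_def map_pmf_def bind_assoc_pmf bind_return_pmf)
  also have "pmf \<dots> (xs @ [x]) = pmf (pair_pmf (replicate_pmf n p) p) (xs, x)"
    using pmf_map_inj'[of "\<lambda>(xs, x). xs @ [x]" "pair_pmf (replicate_pmf n p) p" "(xs, x)"] by (simp add: inj_on_def)
  finally show ?thesis by (simp add: pmf_pair)
qed

lemma map_drop_replicate_pmf:
  assumes "l \<le> n"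
  shows "map_pmf (drop (n - l)) (replicate_pmf n p) = replicate_pmf l p"
proof -
  have "replicate_pmf n p = replicate_pmf ((n - l) + l) p" using assms by simp
  also have "map_pmf (drop (n - l)) \<dots> =
      bind_pmf (replicate_pmf (n - l) p) (\<lambda>xs. bind_pmf (replicate_pmf l p) (\<lambda>ys. return_pmf (drop (n - l) (xs @ ys))))"
    unfolding replicate_pmf_distrib by (simp add: map_bind_pmf)
  also have "\<dots> = bind_pmf (replicate_pmf (n - l) p) (\<lambda>xs. bind_pmf (replicate_pmf l p) return_pmf)"
    by (intro bind_pmf_cong refl) (auto simp: in_set_replicate_pmf)
  finally show ?thesis by (simp add: bind_return_pmf')
qed

section \<open>Events of probability tending to 1\<close>

definition whp :: "(nat \<Rightarrow> 'a pmf) \<Rightarrow> (nat \<Rightarrow> 'a \<Rightarrow> bool) \<Rightarrow> bool" where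
  "whp p A \<longleftrightarrow> (\<lambda>n. measure_pmf.prob (p n) {x. A n x}) \<longlonglongrightarrow> 1"

lemma whpD:
  assumes "whp p A" "\<zeta> > 0"
  shows "eventually (\<lambda>n. measure_pmf.prob (p n) {x. \<not> A n x} \<le> \<zeta>) sequentially"
proof -
  have "eventually (\<lambda>n. measure_pmf.prob (p n) {x. A n x} > 1 - \<zeta>) sequentially"
    using assms by (intro order_tendstoD(1)) (auto simp: whp_def)
  then show ?thesis
  proof eventually_elim
    case (elim n)
    have "measure_pmf.prob (p n) {x. \<not> A n x} = 1 - measure_pmf.prob (p n) {x. A n x}"
      by (subst measure_pmf.prob_compl[symmetric]) (auto intro!: arg_cong2[where f = measure])
    with elim show ?case by simp
  qed
qed

lemma whpI:
  assumes "\<And>\<zeta>. \<zeta> > 0 \<Longrightarrow> eventually (\<lambda>n. measure_pmf.prob (p n) {x. \<not> A n x} \<le> \<zeta>) sequentially"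
  shows "whp p A"
  unfolding whp_def
proof (rule LIMSEQ_I)
  fix r :: real assume "r > 0"
  then have "eventually (\<lambda>n. measure_pmf.prob (p n) {x. \<not> A n x} \<le> r / 2) sequentially"
    using assms[of "r / 2"] by simp
  then have "eventually (\<lambda>n. norm (measure_pmf.prob (p n) {x. A n x} - 1) < r) sequentially"
  proof eventually_elim
    case (elim n)
    have "measure_pmf.prob (p n) {x. \<not> A n x} = 1 - measure_pmf.prob (p n) {x. A n x}"
      by (subst measure_pmf.prob_compl[symmetric]) (auto intro!: arg_cong2[where f = measure])
    with elim \<open>r > 0\<close> show ?case by simp
  qed
  then show "\<exists>N. \<forall>n\<ge>N. norm (measure_pmf.prob (p n) {x. A n x} - 1) < r"
    by (simp add: eventually_sequentially)
qed

lemma whp_mono: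
  assumes "whp p A" "eventually (\<lambda>n. \<forall>x\<in>set_pmf (p n). A n x \<longrightarrow> B n x) sequentially"
  shows "whp p B"
proof (rule whpI)
  fix \<zeta> :: real assume "\<zeta> > 0"
  from whpD[OF assms(1) this] assms(2)
  show "eventually (\<lambda>n. measure_pmf.prob (p n) {x. \<not> B n x} \<le> \<zeta>) sequentially"
  proof eventually_elim
    case (elim n)
    have "measure_pmf.prob (p n) {x. \<not> B n x} \<le> measure_pmf.prob (p n) {x. \<not> A n x}"
      using elim(2) by (intro measure_pmf.finite_measure_mono_AE) (auto simp: AE_measure_pmf_iff)
    with elim show ?case by simp
  qed
qed

lemma whp_True: "(\<And>n x. x \<in> set_pmf (p n) \<Longrightarrow> A n x) \<Longrightarrow> whp p A"
  by (rule whp_mono[of p "\<lambda>_ _. True"]) (auto simp: whp_def)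

lemma whp_conj:
  assumes "whp p A" "whp p B" shows "whp p (\<lambda>n x. A n x \<and> B n x)"
proof (rule whpI)
  fix \<zeta> :: real assume "\<zeta> > 0"
  then have "\<zeta> / 2 > 0" by simp
  from whpD[OF assms(1) this] whpD[OF assms(2) this]
  show "eventually (\<lambda>n. measure_pmf.prob (p n) {x. \<not> (A n x \<and> B n x)} \<le> \<zeta>) sequentially"
  proof eventually_elim
    case (elim n)
    have "measure_pmf.prob (p n) {x. \<not> (A n x \<and> B n x)} =
        measure_pmf.prob (p n) ({x. \<not> A n x} \<union> {x. \<not> B n x})"
      by (rule arg_cong2[where f = measure]) auto
    also have "\<dots> \<le> measure_pmf.prob (p n) {x. \<not> A n x} + measure_pmf.prob (p n) {x. \<not> B n x}"
      by (rule measure_Un_le) auto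
    finally show ?case using elim by linarith
  qed
qed

lemma whp_ball:
  assumes "finite I" "\<And>i. i \<in> I \<Longrightarrow> whp p (A i)"
  shows "whp p (\<lambda>n x. \<forall>i\<in>I. A i n x)"
  using assms by (induction I) (auto simp: whp_conj intro: whp_True)

lemma whp_map: "whp (\<lambda>n. map_pmf (h n) (p n)) A \<longleftrightarrow> whp p (\<lambda>n x. A n (h n x))"
  by (simp add: whp_def vimage_def)

text \<open>Chebyshev: a second moment of order n against a squared threshold of order
  \<open>n^2\<close>. The function is not centred here; callers subtract the mean.\<close>

lemma whp_chebyshev:
  assumes fin: "\<And>n. finite (set_pmf (p n))"
    and var: "\<And>n. expect (p n) (\<lambda>x. (f n x)\<^sup>2) \<le> real n * C"
    and "\<eta> > 0"
  shows "whp p (\<lambda>n x. \<bar>f n x\<bar> \<le> real n * \<eta>)"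
proof (rule whpI)
  fix \<zeta> :: real assume "\<zeta> > 0"
  have "(\<lambda>n. C / (real n * \<eta>\<^sup>2)) \<longlonglongrightarrow> 0"
    using \<open>\<eta> > 0\<close> by real_asymp
  then have "eventually (\<lambda>n. C / (real n * \<eta>\<^sup>2) < \<zeta>) sequentially"
    using \<open>\<zeta> > 0\<close> by (rule order_tendstoD(2))
  then show "eventually (\<lambda>n. measure_pmf.prob (p n) {x. \<not> \<bar>f n x\<bar> \<le> real n * \<eta>} \<le> \<zeta>) sequentially"
    using eventually_gt_at_top[of 0]
  proof eventually_elim
    case (elim n)
    let ?A = "{x. \<not> \<bar>f n x\<bar> \<le> real n * \<eta>}"
    have "(real n * \<eta>)\<^sup>2 * measure_pmf.prob (p n) ?A = expect (p n) (\<lambda>x. (real n * \<eta>)\<^sup>2 * indicator ?A x)"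
      by (simp add: expect_cmult expect_indicator fin)
    also have "\<dots> \<le> expect (p n) (\<lambda>x. (f n x)\<^sup>2)"
    proof (rule expect_mono)
      fix x
      show "(real n * \<eta>)\<^sup>2 * indicator ?A x \<le> (f n x)\<^sup>2"
        using \<open>\<eta> > 0\<close> power_mono[of "real n * \<eta>" "\<bar>f n x\<bar>" 2] by (auto simp: indicator_def)
    qed
    also note var[of n]
    finally have "measure_pmf.prob (p n) ?A \<le> real n * C / (real n * \<eta>)\<^sup>2"
      using elim \<open>\<eta> > 0\<close> by (simp add: field_simps)
    also have "\<dots> = C / (real n * \<eta>\<^sup>2)"
      using elim \<open>\<eta> > 0\<close> by (simp add: field_simps power2_eq_square)
    finally show ?case using elim by linarith
  qed
qed

lemma eventually_le_linear:
  fixes c K :: real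
  assumes "c > 0" shows "eventually (\<lambda>n. K \<le> real n * c) sequentially"
  using eventually_ge_at_top[of "nat \<lceil>K / c\<rceil>"]
proof eventually_elim
  case (elim n)
  then have "K / c \<le> real n" by linarith
  then show ?case using assms by (simp add: field_simps)
qed

section \<open>Sums over sliding windows of an i.i.d. word\<close>

definition windows_sum :: "nat \<Rightarrow> ('a list \<Rightarrow> 'a \<Rightarrow> real) \<Rightarrow> 'a list \<Rightarrow> real" where
  "windows_sum l F zs = (\<Sum>k<length zs. F (drop (k - l) (take k zs)) (zs ! k))"

lemma windows_sum_Nil [simp]: "windows_sum l F [] = 0"
  by (simp add: windows_sum_def)

lemma windows_sum_snoc:
  "windows_sum l F (zs @ [z]) = windows_sum l F zs + F (drop (length zs - l) zs) z"
  by (simp add: windows_sum_def nth_append)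

lemma finite_bounded:
  fixes f :: "'a \<Rightarrow> real"
  assumes "finite A" shows "\<exists>C\<ge>0. \<forall>x\<in>A. \<bar>f x\<bar> \<le> C"
proof -
  have "\<forall>x\<in>A. \<bar>f x\<bar> \<le> (\<Sum>x\<in>A. \<bar>f x\<bar>)"
    using assms by (auto intro!: member_le_sum)
  then show ?thesis by (intro exI[of _ "\<Sum>x\<in>A. \<bar>f x\<bar>"]) (auto intro: sum_nonneg)
qed

text \<open>The truncated subtraction in \<open>windows_sum\<close> makes the first windows shorter
  than \<open>l\<close>, so the bound covers all lengths up to \<open>l\<close>; there are finitely
  many such windows over the support.\<close>

lemma windows_bounded:
  fixes F :: "'a list \<Rightarrow> 'a \<Rightarrow> real"
  assumes "finite (set_pmf p)"
  shows "\<exists>C\<ge>0. \<forall>w z. length w \<le> l \<longrightarrow> set w \<subseteq> set_pmf p \<longrightarrow> z \<in> set_pmf p \<longrightarrow> \<bar>F w z\<bar> \<le> C"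
proof -
  have "finite ({w. set w \<subseteq> set_pmf p \<and> length w \<le> l} \<times> set_pmf p)"
    using assms by (intro finite_cartesian_product finite_lists_length_le)
  from finite_bounded[OF this, of "\<lambda>(w, z). F w z"] show ?thesis by fastforce
qed

text \<open>The summands are martingale differences: given the past, the next one has mean 0. Cross
  terms vanish, and each letter adds at most the squared bound to the second moment.\<close>

lemma windows_martingale_variance:
  fixes F :: "'a list \<Rightarrow> 'a \<Rightarrow> real"
  assumes fin: "finite (set_pmf p)" and mean: "\<And>w. expect p (F w) = 0"
  shows "\<exists>C. \<forall>n. expect (replicate_pmf n p) (\<lambda>zs. (windows_sum l F zs)\<^sup>2) \<le> real n * C"
proof -
  obtain C where C: "C \<ge> 0"
    "\<And>w z. length w \<le> l \<Longrightarrow> set w \<subseteq> set_pmf p \<Longrightarrow> z \<in> set_pmf p \<Longrightarrow> \<bar>F w z\<bar> \<le> C"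
    using windows_bounded[OF fin, of l F] by blast
  have "expect (replicate_pmf n p) (\<lambda>zs. (windows_sum l F zs)\<^sup>2) \<le> real n * C\<^sup>2" for n
  proof (induction n)
    case (Suc n)
    have "expect (replicate_pmf (Suc n) p) (\<lambda>zs. (windows_sum l F zs)\<^sup>2) =
        expect (replicate_pmf n p) (\<lambda>zs. expect p (\<lambda>z. (windows_sum l F zs + F (drop (length zs - l) zs) z)\<^sup>2))"
      unfolding expect_replicate_snoc[OF fin] windows_sum_snoc ..
    also have "\<dots> \<le> expect (replicate_pmf n p) (\<lambda>zs. (windows_sum l F zs)\<^sup>2 + C\<^sup>2)"
    proof (rule expect_mono)
      fix zs assume zs: "zs \<in> set_pmf (replicate_pmf n p)"
      let ?w = "drop (length zs - l) zs" let ?s = "windows_sum l F zs"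
      have "expect p (\<lambda>z. (?s + F ?w z)\<^sup>2) = expect p (\<lambda>z. ?s\<^sup>2 + (2 * ?s) * F ?w z + (F ?w z)\<^sup>2)"
        by (simp add: power2_sum algebra_simps)
      also have "\<dots> = ?s\<^sup>2 + expect p (\<lambda>z. (F ?w z)\<^sup>2)"
        unfolding expect_add expect_cmult mean by (simp add: fin)
      also have "expect p (\<lambda>z. (F ?w z)\<^sup>2) \<le> expect p (\<lambda>z. C\<^sup>2)"
      proof (rule expect_mono)
        fix z assume "z \<in> set_pmf p"
        have "length ?w \<le> l" "set ?w \<subseteq> set_pmf p"
          using zs set_drop_subset[of "length zs - l" zs] by (auto simp: in_set_replicate_pmf)
        then have "\<bar>F ?w z\<bar> \<le> C" using C(2) \<open>z \<in> set_pmf p\<close> by blast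
        then show "(F ?w z)\<^sup>2 \<le> C\<^sup>2" using C(1) by (metis abs_le_square_iff abs_of_nonneg)
      qed
      finally show "expect p (\<lambda>z. (?s + F ?w z)\<^sup>2) \<le> ?s\<^sup>2 + C\<^sup>2" using fin by simp
    qed
    also have "\<dots> \<le> real (Suc n) * C\<^sup>2"
      unfolding expect_add using Suc.IH by (simp add: fin finite_set_replicate_pmf algebra_simps)
    finally show ?case .
  qed simp
  then show ?thesis by blast
qed

lemma windows_sum_diff:
  "windows_sum l (\<lambda>w z. F w z - G w z) zs = windows_sum l F zs - windows_sum l G zs"
  by (simp add: windows_sum_def sum_subtractf)

text \<open>A function of the past \<open>l + 1\<close> letters alone is, read one position earlier,
  a function of \<open>l\<close> past letters and the current one. Position 0 contributes
  \<open>G []\<close>, and the last letter \<open>z\<close> is never looked at.\<close>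

lemma windows_sum_shift:
  "windows_sum (Suc l) (\<lambda>w _. G w) (zs @ [z]) = G [] + windows_sum l (\<lambda>w z. G (w @ [z])) zs"
proof (induction zs arbitrary: z rule: rev_induct)
  case Nil
  then show ?case by (simp add: windows_sum_def)
next
  case (snoc y zs)
  have "windows_sum (Suc l) (\<lambda>w _. G w) ((zs @ [y]) @ [z]) =
      windows_sum (Suc l) (\<lambda>w _. G w) (zs @ [y]) + G (drop (length zs - l) zs @ [y])"
    unfolding windows_sum_snoc[of _ _ "zs @ [y]"] by simp
  also have "\<dots> = G [] + windows_sum l (\<lambda>w z. G (w @ [z])) zs + G (drop (length zs - l) zs @ [y])"
    by (simp only: snoc.IH)
  finally show ?case by (simp add: windows_sum_snoc)
qed

lemma windows_lln:
  fixes F :: "'a list \<Rightarrow> 'a \<Rightarrow> real"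
  assumes fin: "finite (set_pmf p)" and "\<eta> > 0"
  shows "whp (\<lambda>n. replicate_pmf n p) (\<lambda>n zs. \<bar>windows_sum l F zs -
           real n * expect (replicate_pmf l p) (\<lambda>w. expect p (F w))\<bar> \<le> real n * \<eta>)"
  using \<open>\<eta> > 0\<close>
proof (induction l arbitrary: F \<eta>)
  case 0
  let ?D = "\<lambda>w z. F w z - expect p (F w)"
  have "expect p (?D w) = 0" for w by (simp add: expect_diff fin)
  from windows_martingale_variance[of p ?D 0, OF fin this] obtain C
    where C: "\<And>n. expect (replicate_pmf n p) (\<lambda>zs. (windows_sum 0 ?D zs)\<^sup>2) \<le> real n * C" by blast
  have "whp (\<lambda>n. replicate_pmf n p) (\<lambda>n zs. \<bar>windows_sum 0 ?D zs\<bar> \<le> real n * \<eta>)"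
    by (rule whp_chebyshev) (use C 0 fin finite_set_replicate_pmf in auto)
  then show ?case
    by (rule whp_mono)
      (auto simp: windows_sum_diff in_set_replicate_pmf windows_sum_def sum_subtractf)
next
  case (Suc l)
  let ?G = "\<lambda>w. expect p (F w)"
  let ?D = "\<lambda>w z. F w z - ?G w"
  let ?F' = "\<lambda>w z. ?G (w @ [z])"
  let ?c = "expect (replicate_pmf (Suc l) p) ?G"
  have "expect p (?D w) = 0" for w by (simp add: expect_diff fin)
  from windows_martingale_variance[of p ?D "Suc l", OF fin this] obtain C
    where C: "\<And>n. expect (replicate_pmf n p) (\<lambda>zs. (windows_sum (Suc l) ?D zs)\<^sup>2) \<le> real n * C" by blast
  have 1: "whp (\<lambda>n. replicate_pmf n p) (\<lambda>n zs. \<bar>windows_sum (Suc l) ?D zs\<bar> \<le> real n * (\<eta> / 3))"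
    by (rule whp_chebyshev) (use C Suc.prems fin finite_set_replicate_pmf in auto)
  have 2: "whp (\<lambda>n. replicate_pmf n p) (\<lambda>n zs. \<bar>windows_sum l ?F' zs - real n * ?c\<bar> \<le> real n * (\<eta> / 3))"
    using Suc.IH[of "\<eta> / 3" ?F'] Suc.prems unfolding expect_replicate_snoc[OF fin] by simp
  obtain B where B: "B \<ge> 0"
    "\<And>w z. length w \<le> l \<Longrightarrow> set w \<subseteq> set_pmf p \<Longrightarrow> z \<in> set_pmf p \<Longrightarrow> \<bar>?F' w z\<bar> \<le> B"
    using windows_bounded[OF fin, of l ?F'] by blast
  \<comment> \<open>The last third of \<open>\<eta>\<close> pays for the two boundary terms of the
    shift: the term at position 0 and the term that the shifted sum has in excess at the
    end.\<close>
  have "eventually (\<lambda>n. B + \<bar>?G []\<bar> \<le> real n * (\<eta> / 3)) sequentially"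
    using Suc.prems by (intro eventually_le_linear) simp
  then have ev: "eventually (\<lambda>n. B + \<bar>?G []\<bar> \<le> real n * (\<eta> / 3) \<and> n > 0) sequentially"
    using eventually_gt_at_top[of 0] by (rule eventually_conj)
  show ?case
  proof (rule whp_mono[OF whp_conj[OF 1 2]], use ev in eventually_elim, safe)
    fix n :: nat and zs assume n: "B + \<bar>?G []\<bar> \<le> real n * (\<eta> / 3)" "0 < n"
      and zs: "zs \<in> set_pmf (replicate_pmf n p)"
      and a: "\<bar>windows_sum (Suc l) ?D zs\<bar> \<le> real n * (\<eta> / 3)"
      and b: "\<bar>windows_sum l ?F' zs - real n * ?c\<bar> \<le> real n * (\<eta> / 3)"
    obtain ys y where y: "zs = ys @ [y]"
      using zs n by (cases zs rule: rev_cases) (auto simp: in_set_replicate_pmf)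
    have s: "windows_sum (Suc l) (\<lambda>w _. ?G w) zs = ?G [] + windows_sum l ?F' zs - ?F' (drop (length ys - l) ys) y"
      unfolding y windows_sum_shift[of l ?G ys y] windows_sum_snoc[of l ?F' ys y] by simp
    have "set (drop (length ys - l) ys) \<subseteq> set_pmf p"
      using zs set_drop_subset[of "length ys - l" ys] by (auto simp: in_set_replicate_pmf y)
    then have "\<bar>?F' (drop (length ys - l) ys) y\<bar> \<le> B"
      using zs by (intro B(2)) (auto simp: in_set_replicate_pmf y)
    moreover have "windows_sum (Suc l) ?D zs = windows_sum (Suc l) F zs - windows_sum (Suc l) (\<lambda>w _. ?G w) zs"
      by (rule windows_sum_diff)
    ultimately show "\<bar>windows_sum (Suc l) F zs - real n * ?c\<bar> \<le> real n * \<eta>"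
      using a b n(1) s by linarith
  qed
qed

lemma windows_sum_0: "windows_sum 0 (\<lambda>_. f) zs = sum_list (map f zs)"
  by (induction zs rule: rev_induct) (simp_all add: windows_sum_snoc)

lemma iid_lln:
  assumes "finite (set_pmf p)" "\<eta> > 0"
  shows "whp (\<lambda>n. replicate_pmf n p) (\<lambda>n zs. \<bar>sum_list (map f zs) - real n * expect p f\<bar> \<le> real n * \<eta>)"
  using windows_lln[OF assms, of 0 "\<lambda>_. f"] assms by (simp add: windows_sum_0)

text \<open>Change of measure. It is used from null to reference laws in the converse, from
  reference to null laws in the construction, and from kernel to output law in the covering
  argument.\<close>

lemma prob_le_cmult:
  assumes "finite (set_pmf q)" "c \<ge> 0" "\<And>x. x \<in> A \<Longrightarrow> x \<in> set_pmf q \<Longrightarrow> pmf q x \<le> c * pmf p x"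
  shows "measure_pmf.prob q A \<le> c * measure_pmf.prob p A"
proof -
  have f: "finite (A \<inter> set_pmf q)" using assms(1) by simp
  have "measure_pmf.prob q A = sum (pmf q) (A \<inter> set_pmf q)"
    by (metis f measure_Int_set_pmf measure_measure_pmf_finite)
  also have "\<dots> \<le> (\<Sum>x\<in>A \<inter> set_pmf q. c * pmf p x)"
    using assms(3) by (intro sum_mono) auto
  also have "\<dots> = c * measure_pmf.prob p (A \<inter> set_pmf q)"
    by (simp add: measure_measure_pmf_finite f sum_distrib_left)
  also have "\<dots> \<le> c * measure_pmf.prob p A"
    using assms(2) by (intro mult_left_mono measure_pmf.finite_measure_mono) auto
  finally show ?thesis .
qed

section \<open>Likelihood ratios under the standing assumption\<close>

text \<open>Lower and upper refer to the exponent of \<open>P / Q\<close>: \<open>lr_lower\<close>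
  therefore bounds \<open>Q\<close> from above. The exponent is extended real because in case A it
  may be \<open>\<infinity>\<close>; then \<open>lr_upper\<close> is vacuous.\<close>

definition lr_lower :: "'a pmf \<Rightarrow> (nat \<Rightarrow> 'a list pmf) \<Rightarrow> ereal \<Rightarrow> bool" where
  "lr_lower P Q c \<longleftrightarrow> (\<forall>d. ereal d < c \<longrightarrow>
     whp (\<lambda>n. replicate_pmf n P) (\<lambda>n zs. pmf (Q n) zs \<le> exp (- (real n * d)) * pmf (replicate_pmf n P) zs))"

definition lr_upper :: "'a pmf \<Rightarrow> (nat \<Rightarrow> 'a list pmf) \<Rightarrow> ereal \<Rightarrow> bool" where
  "lr_upper P Q c \<longleftrightarrow> (\<forall>d. c < ereal d \<longrightarrow>
     whp (\<lambda>n. replicate_pmf n P) (\<lambda>n zs. pmf (Q n) zs \<ge> exp (- (real n * d)) * pmf (replicate_pmf n P) zs))"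

definition llr :: "'a pmf \<Rightarrow> (nat \<Rightarrow> 'a list pmf) \<Rightarrow> nat \<Rightarrow> 'a list \<Rightarrow> real" where
  "llr P Q n zs = ln (pmf (replicate_pmf n P) zs / pmf (Q n) zs)"

text \<open>Common ground of both cases: a product law is a Markov law of order 0. The transition
  rule is demanded only after words of positive probability, where the conditional probability has a
  meaning.\<close>

locale markov_reference =
  fixes P :: "'a pmf" and Q :: "nat \<Rightarrow> 'a list pmf" and W :: "'a list \<Rightarrow> 'a pmf" and l :: nat
  assumes fin: "finite (set_pmf P)"
    and step: "\<And>n zs z. l \<le> n \<Longrightarrow> length zs = n \<Longrightarrow> pmf (Q n) zs > 0 \<Longrightarrow>
        pmf (Q (Suc n)) (zs @ [z]) = pmf (Q n) zs * pmf (W (drop (n - l) zs)) z"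
    and ac: "\<And>n. set_pmf (replicate_pmf n P) \<subseteq> set_pmf (Q n)"
begin

definition F :: "'a list \<Rightarrow> 'a \<Rightarrow> real" where
  "F w z = ln (pmf P z / pmf (W w) z)"

definition rate :: real where
  "rate = expect (replicate_pmf l P) (\<lambda>w. expect P (F w))"

lemma llr_snoc:
  assumes "l \<le> n" "zs \<in> set_pmf (replicate_pmf n P)" "z \<in> set_pmf P"
  shows "llr P Q (Suc n) (zs @ [z]) = llr P Q n zs + F (drop (n - l) zs) z"
proof -
  have len: "length zs = n" using assms by (simp add: in_set_replicate_pmf)
  have q: "pmf (Q n) zs > 0" using ac[of n] assms(2) by (auto simp: pmf_positive)
  have "zs @ [z] \<in> set_pmf (replicate_pmf (Suc n) P)"
    using assms by (simp add: in_set_replicate_pmf del: replicate_pmf.simps)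
  then have "pmf (Q (Suc n)) (zs @ [z]) > 0" using ac[of "Suc n"] by (meson pmf_positive subsetD)
  then have w: "pmf (W (drop (n - l) zs)) z > 0"
    unfolding step[OF assms(1) len q] using q by (simp add: zero_less_mult_iff)
  have p: "pmf (replicate_pmf n P) zs > 0" "pmf P z > 0"
    using assms by (auto simp: pmf_positive)
  have "llr P Q (Suc n) (zs @ [z]) =
     ln ((pmf (replicate_pmf n P) zs / pmf (Q n) zs) * (pmf P z / pmf (W (drop (n - l) zs)) z))"
    unfolding llr_def step[OF assms(1) len q] pmf_replicate_snoc by simp
  also have "\<dots> = llr P Q n zs + F (drop (n - l) zs) z"
    unfolding llr_def F_def using p q w by (intro ln_mult_pos) auto
  finally show ?thesis .
qed

lemma expect_llr_Suc:
  assumes "l \<le> n"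
  shows "expect (replicate_pmf (Suc n) P) (llr P Q (Suc n)) = expect (replicate_pmf n P) (llr P Q n) + rate"
proof -
  have "expect (replicate_pmf (Suc n) P) (llr P Q (Suc n)) =
      expect (replicate_pmf n P) (\<lambda>zs. expect P (\<lambda>z. llr P Q (Suc n) (zs @ [z])))"
    by (rule expect_replicate_snoc[OF fin])
  also have "\<dots> = expect (replicate_pmf n P) (\<lambda>zs. llr P Q n zs + expect P (F (drop (n - l) zs)))"
  proof (rule expect_cong)
    fix zs assume "zs \<in> set_pmf (replicate_pmf n P)"
    then have "expect P (\<lambda>z. llr P Q (Suc n) (zs @ [z])) = expect P (\<lambda>z. llr P Q n zs + F (drop (n - l) zs) z)"
      by (intro expect_cong llr_snoc assms)
    then show "expect P (\<lambda>z. llr P Q (Suc n) (zs @ [z])) = llr P Q n zs + expect P (F (drop (n - l) zs))"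
      by (simp add: expect_add fin)
  qed
  also have "\<dots> = expect (replicate_pmf n P) (llr P Q n) +
      expect (map_pmf (drop (n - l)) (replicate_pmf n P)) (\<lambda>w. expect P (F w))"
    by (simp add: expect_add expect_map fin finite_set_replicate_pmf)
  finally show ?thesis using assms by (simp add: map_drop_replicate_pmf rate_def)
qed

text \<open>From length \<open>l\<close> on both quantities grow by the same increment, so their
  difference is frozen at its value on the first \<open>l\<close> letters, of which there are
  finitely many choices in the support.\<close>

lemma llr_windows_sum:
  "\<exists>C. \<forall>n\<ge>l. \<forall>zs\<in>set_pmf (replicate_pmf n P). \<bar>llr P Q n zs - windows_sum l F zs\<bar> \<le> C"
proof -
  obtain C where C: "\<And>zs. zs \<in> set_pmf (replicate_pmf l P) \<Longrightarrow> \<bar>llr P Q l zs - windows_sum l F zs\<bar> \<le> C"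
    using finite_bounded[OF finite_set_replicate_pmf[OF fin, of l], of "\<lambda>zs. llr P Q l zs - windows_sum l F zs"]
    by blast
  have "\<bar>llr P Q n zs - windows_sum l F zs\<bar> \<le> C" if "l \<le> n" "zs \<in> set_pmf (replicate_pmf n P)" for n zs
    using that
  proof (induction n arbitrary: zs rule: dec_induct)
    case (step n)
    obtain ys y where y: "zs = ys @ [y]"
      using step.prems by (cases zs rule: rev_cases) (auto simp: in_set_replicate_pmf simp del: replicate_pmf.simps)
    have ys: "ys \<in> set_pmf (replicate_pmf n P)" "y \<in> set_pmf P" "length ys = n"
      using step.prems by (auto simp: y in_set_replicate_pmf simp del: replicate_pmf.simps)
    show ?case
      unfolding y windows_sum_snoc llr_snoc[OF step.hyps(1) ys(1,2)] using step.IH[OF ys(1)] ys(3) by simp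
  qed (rule C)
  then show ?thesis by blast
qed

lemma whp_llr:
  assumes "\<eta> > 0"
  shows "whp (\<lambda>n. replicate_pmf n P) (\<lambda>n zs. \<bar>llr P Q n zs - real n * rate\<bar> \<le> real n * \<eta>)"
proof -
  obtain C where C: "\<And>n zs. l \<le> n \<Longrightarrow> zs \<in> set_pmf (replicate_pmf n P) \<Longrightarrow>
      \<bar>llr P Q n zs - windows_sum l F zs\<bar> \<le> C"
    using llr_windows_sum by blast
  have "\<eta> / 2 > 0" using assms by simp
  note lln = windows_lln[OF fin this, of l F, folded rate_def]
  show ?thesis
  proof (rule whp_mono[OF lln])
    show "eventually (\<lambda>n. \<forall>zs\<in>set_pmf (replicate_pmf n P).
        \<bar>windows_sum l F zs - real n * rate\<bar> \<le> real n * (\<eta> / 2) \<longrightarrow>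
        \<bar>llr P Q n zs - real n * rate\<bar> \<le> real n * \<eta>) sequentially"
      using eventually_le_linear[OF \<open>\<eta> / 2 > 0\<close>, of C] eventually_ge_at_top[of l]
    proof eventually_elim
      case (elim n)
      show ?case
      proof safe
        fix zs assume "zs \<in> set_pmf (replicate_pmf n P)"
          "\<bar>windows_sum l F zs - real n * rate\<bar> \<le> real n * (\<eta> / 2)"
        with C[OF elim(2), of zs] elim(1) show "\<bar>llr P Q n zs - real n * rate\<bar> \<le> real n * \<eta>"
          by linarith
      qed
    qed
  qed
qed

lemma lr_bounds: "lr_lower P Q (ereal rate)" "lr_upper P Q (ereal rate)"
proof -
  have q: "pmf (replicate_pmf n P) zs > 0" "pmf (Q n) zs > 0" if "zs \<in> set_pmf (replicate_pmf n P)" for n zs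
    using ac[of n] that by (auto simp: pmf_positive)
  have *: "pmf (Q n) zs = exp (- llr P Q n zs) * pmf (replicate_pmf n P) zs"
    if "zs \<in> set_pmf (replicate_pmf n P)" for n zs
    using q[OF that] by (simp add: llr_def exp_minus)
  show "lr_lower P Q (ereal rate)"
    unfolding lr_lower_def
  proof safe
    fix d assume "ereal d < ereal rate"
    then have "rate - d > 0" by simp
    from whp_llr[OF this]
    show "whp (\<lambda>n. replicate_pmf n P)
       (\<lambda>n zs. pmf (Q n) zs \<le> exp (- (real n * d)) * pmf (replicate_pmf n P) zs)"
      by (rule whp_mono) (auto simp: * q abs_le_iff algebra_simps intro!: always_eventually mult_right_mono)
  qed
  show "lr_upper P Q (ereal rate)"
    unfolding lr_upper_def
  proof safe
    fix d assume "ereal rate < ereal d"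
    then have "d - rate > 0" by simp
    from whp_llr[OF this]
    show "whp (\<lambda>n. replicate_pmf n P)
       (\<lambda>n zs. pmf (Q n) zs \<ge> exp (- (real n * d)) * pmf (replicate_pmf n P) zs)"
      by (rule whp_mono) (auto simp: * q abs_le_iff algebra_simps intro!: always_eventually mult_right_mono)
  qed
qed

lemma rel_entropy_eq_expect_llr:
  "rel_entropy (replicate_pmf n P) (Q n) = ereal (expect (replicate_pmf n P) (llr P Q n))"
  using rel_entropy_eq_sum[of "replicate_pmf n P" "Q n"] ac[of n] finite_set_replicate_pmf[OF fin, of n]
  by (simp add: abs_cont_iff expect_def llr_def)

text \<open>The last \<open>l\<close> letters of an i.i.d. word have the same law at every length,
  so the difference of divergences does not just converge: it equals \<open>rate\<close> from
  \<open>n = l\<close> on.\<close>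

lemma divergence_rate_eq: "divergence_rate P Q = ereal rate"
  unfolding divergence_rate_def
proof (rule limI, rule tendsto_eventually)
  show "eventually (\<lambda>n. rel_entropy (replicate_pmf (Suc n) P) (Q (Suc n)) - rel_entropy (replicate_pmf n P) (Q n)
      = ereal rate) sequentially"
    using eventually_ge_at_top[of l]
  proof eventually_elim
    case (elim n)
    show ?case unfolding rel_entropy_eq_expect_llr expect_llr_Suc[OF elim] by simp
  qed
qed

end

lemma lr_iid:
  fixes P q :: "'a pmf"
  assumes fin: "finite (set_pmf P)"
  shows "lr_lower P (\<lambda>n. replicate_pmf n q) (rel_entropy P q)"
    and "lr_upper P (\<lambda>n. replicate_pmf n q) (rel_entropy P q)"
proof -
  have "lr_lower P (\<lambda>n. replicate_pmf n q) (rel_entropy P q) \<and> lr_upper P (\<lambda>n. replicate_pmf n q) (rel_entropy P q)"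
  proof (cases "abs_cont P q")
    case True
    interpret markov_reference P "\<lambda>n. replicate_pmf n q" "\<lambda>_. q" 0
    proof
      show "set_pmf (replicate_pmf n P) \<subseteq> set_pmf (replicate_pmf n q)" for n
        using True by (auto simp: abs_cont_iff in_set_replicate_pmf subset_iff)
    qed (simp_all add: fin pmf_replicate_snoc del: replicate_pmf.simps)
    have "rel_entropy P q = ereal rate"
      by (simp add: rel_entropy_eq_sum[OF fin True] rate_def F_def expect_def)
    then show ?thesis using lr_bounds by simp
  next
    \<comment> \<open>The exponent is infinite: a letter charged by \<open>P\<close> but not by
      \<open>q\<close> occurs with probability tending to 1, and then the product of
      \<open>q\<close> vanishes on the word.\<close>
    case False
    then obtain a where a: "a \<in> set_pmf P" "a \<notin> set_pmf q"
      by (auto simp: abs_cont_iff)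
    have ex: "expect P (indicator {a}) = pmf P a" by (simp add: expect_indicator fin measure_pmf_single)
    have pos: "pmf P a / 2 > 0" using a(1) by (simp add: pmf_positive)
    have "whp (\<lambda>n. replicate_pmf n P) (\<lambda>n zs. a \<in> set zs)"
    proof (rule whp_mono[OF iid_lln[OF fin pos, of "indicator {a}"]])
      show "eventually (\<lambda>n. \<forall>zs\<in>set_pmf (replicate_pmf n P).
          \<bar>sum_list (map (indicator {a}) zs) - real n * expect P (indicator {a})\<bar> \<le> real n * (pmf P a / 2)
            \<longrightarrow> a \<in> set zs) sequentially"
        using eventually_gt_at_top[of 0]
      proof (eventually_elim, safe)
        fix n :: nat and zs
        assume n: "0 < n"
          and b: "\<bar>sum_list (map (indicator {a}) zs) - real n * expect P (indicator {a})\<bar> \<le> real n * (pmf P a / 2)"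
        show "a \<in> set zs"
        proof (rule ccontr)
          assume "a \<notin> set zs"
          then have "sum_list (map (indicator {a} :: 'a \<Rightarrow> real) zs) = 0"
            by (induction zs) auto
          with b have "real n * pmf P a \<le> real n * (pmf P a / 2)" by (simp add: ex)
          then show False using n pos by simp
        qed
      qed
    qed
    moreover have "pmf (replicate_pmf n q) zs = 0" if "a \<in> set zs" for n zs
      using that a(2) by (auto simp: pmf_eq_0_set_pmf in_set_replicate_pmf)
    ultimately have "whp (\<lambda>n. replicate_pmf n P)
        (\<lambda>n zs. pmf (replicate_pmf n q) zs \<le> exp (- (real n * d)) * pmf (replicate_pmf n P) zs)" for d
      by (elim whp_mono) (auto intro!: always_eventually)
    then show ?thesis using False by (simp add: lr_lower_def lr_upper_def rel_entropy_def)
  qed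
  then show "lr_lower P (\<lambda>n. replicate_pmf n q) (rel_entropy P q)"
    "lr_upper P (\<lambda>n. replicate_pmf n q) (rel_entropy P q)" by auto
qed

lemma lr_markov:
  fixes P :: "'a pmf"
  assumes fin: "finite (set_pmf P)" and Q: "markov_marginals Q"
    and ac: "\<And>n. abs_cont (replicate_pmf n P) (Q n)"
  shows "lr_lower P Q (divergence_rate P Q)" "lr_upper P Q (divergence_rate P Q)"
    and "\<exists>c. divergence_rate P Q = ereal c"
proof -
  obtain l W M where M: "markov_process l W M"
    and pmf: "\<And>n zs. pmf (Q n) zs = measure M {\<omega> \<in> space M. map \<omega> [0..<n] = zs}"
    using Q unfolding markov_marginals_def by blast
  interpret markov_reference P Q W l
  proof
    fix n zs z assume n: "l \<le> n" "length zs = n" "pmf (Q n) zs > 0"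
    then have "cond_prob M (\<lambda>\<omega>. \<omega> n = z) (\<lambda>\<omega>. map \<omega> [0..<n] = zs) = pmf (W (drop (n - l) zs)) z"
      using M unfolding markov_process_def pmf by blast
    moreover have "{\<omega> \<in> space M. \<omega> n = z \<and> map \<omega> [0..<n] = zs} = {\<omega> \<in> space M. map \<omega> [0..<Suc n] = zs @ [z]}"
      by auto
    ultimately show "pmf (Q (Suc n)) (zs @ [z]) = pmf (Q n) zs * pmf (W (drop (n - l) zs)) z"
      using n(3) unfolding cond_prob_def pmf by (simp add: field_simps)
  qed (use fin ac in \<open>auto simp: abs_cont_iff\<close>)
  show "lr_lower P Q (divergence_rate P Q)" "lr_upper P Q (divergence_rate P Q)"
    "\<exists>c. divergence_rate P Q = ereal c"
    using lr_bounds divergence_rate_eq by auto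
qed

lemma first_arg_min:
  fixes c :: "nat \<Rightarrow> ereal"
  assumes "1 \<le> k"
  shows "first_arg_min k c \<in> {1..k}" and "j \<in> {1..k} \<Longrightarrow> c (first_arg_min k c) \<le> c j"
    and "(MIN j\<in>{1..k}. c j) = c (first_arg_min k c)"
proof -
  have ne: "finite {1..k}" "{1..k} \<noteq> {}" using assms by auto
  obtain j0 where "j0 \<in> {1..k}" "\<And>j. j \<in> {1..k} \<Longrightarrow> c j0 \<le> c j"
    using arg_min_if_finite[OF ne, of c] by (metis not_le_imp_less)
  then have "is_arg_min c (\<lambda>j. j \<in> {1..k}) j0"
    by (auto simp: is_arg_min_def not_less)
  then have *: "is_arg_min c (\<lambda>j. j \<in> {1..k}) (first_arg_min k c)"
    unfolding first_arg_min_def by (rule LeastI)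
  then show 1: "first_arg_min k c \<in> {1..k}" by (auto simp: is_arg_min_def)
  show 2: "c (first_arg_min k c) \<le> c j" if "j \<in> {1..k}" for j
    using * that by (auto simp: is_arg_min_def not_less)
  show "(MIN j\<in>{1..k}. c j) = c (first_arg_min k c)"
    using 1 2 by (intro Min_eqI) auto
qed

text \<open>A finite minimum together with the exclusion of \<open>-\<infinity>\<close> makes the
  conversion by \<open>real_of_ereal\<close> lossless.\<close>

lemma min_cost:
  assumes "1 \<le> k" "(MIN j\<in>{1..k}. c j) < \<infinity>" "\<And>j. j \<in> {1..k} \<Longrightarrow> c j \<noteq> -\<infinity>"
  shows "ereal (min_cost k c) = c (first_arg_min k c)" "j \<in> {1..k} \<Longrightarrow> ereal (min_cost k c) \<le> c j"
proof -
  show "ereal (min_cost k c) = c (first_arg_min k c)"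
    unfolding min_cost_def using assms(2,3) first_arg_min[OF assms(1), where c = c]
    by (intro ereal_real') auto
  then show "j \<in> {1..k} \<Longrightarrow> ereal (min_cost k c) \<le> c j"
    using first_arg_min(2)[OF assms(1)] by metis
qed

text \<open>Here cases A and B merge: apart from finiteness of supports, these three facts are all
  that the rest takes from the standing assumption.\<close>

lemma standing_lr:
  fixes PYX :: "nat \<Rightarrow> ('y::finite \<times> 'x::finite) pmf"
  assumes "standing_A m k r PYX QY QX cY cX \<or> standing_B m k r PYX QY QX cY cX"
  shows "i \<in> {1..m} \<Longrightarrow> j \<in> {1..k} \<Longrightarrow>
      lr_lower (PY PYX i) (QY j) (cY i j) \<and> lr_upper (PY PYX i) (QY j) (cY i j) \<and> cY i j \<noteq> -\<infinity>"
    and "S \<in> X_laws m PYX \<Longrightarrow> t \<in> {1..r} \<Longrightarrow>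
      lr_lower S (QX t) (cX S t) \<and> lr_upper S (QX t) (cX S t) \<and> cX S t \<noteq> -\<infinity>"
    and "min_costs_finite m k r PYX cY cX"
proof -
  have re: "rel_entropy P q \<noteq> -\<infinity>" for P q :: "'c pmf" by (simp add: rel_entropy_def)
  have A: "lr_lower P Q c \<and> lr_upper P Q c \<and> c \<noteq> -\<infinity>"
    if "\<And>n. Q n = replicate_pmf n q" "c = rel_entropy P q" for P q :: "'c::finite pmf" and Q c
  proof -
    have "Q = (\<lambda>n. replicate_pmf n q)" using that by auto
    then show ?thesis using lr_iid[of P q] that(2) re by simp
  qed
  have B: "lr_lower P Q c \<and> lr_upper P Q c \<and> c \<noteq> -\<infinity>"
    if "markov_marginals Q" "\<And>n. abs_cont (replicate_pmf n P) (Q n)" "c = divergence_rate P Q"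
    for P :: "'c::finite pmf" and Q c
    using lr_markov[of P Q] that by auto
  show "lr_lower (PY PYX i) (QY j) (cY i j) \<and> lr_upper (PY PYX i) (QY j) (cY i j) \<and> cY i j \<noteq> -\<infinity>"
    if "i \<in> {1..m}" "j \<in> {1..k}"
    using assms
  proof
    assume "standing_A m k r PYX QY QX cY cX"
    then obtain qY where "\<forall>j\<in>{1..k}. \<forall>n. QY j n = replicate_pmf n (qY j)"
      "\<forall>i\<in>{1..m}. \<forall>j\<in>{1..k}. cY i j = rel_entropy (PY PYX i) (qY j)"
      unfolding standing_A_def by blast
    then show ?thesis using that by (intro A[of "QY j" "qY j"]) auto
  next
    assume "standing_B m k r PYX QY QX cY cX"
    then show ?thesis using that unfolding standing_B_def by (intro B) auto
  qed
  show "lr_lower S (QX t) (cX S t) \<and> lr_upper S (QX t) (cX S t) \<and> cX S t \<noteq> -\<infinity>"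
    if "S \<in> X_laws m PYX" "t \<in> {1..r}"
    using assms
  proof
    assume "standing_A m k r PYX QY QX cY cX"
    then obtain qX where "\<forall>t\<in>{1..r}. \<forall>n. QX t n = replicate_pmf n (qX t)"
      "\<forall>S\<in>X_laws m PYX. \<forall>t\<in>{1..r}. cX S t = rel_entropy S (qX t)"
      unfolding standing_A_def by blast
    then show ?thesis using that by (intro A[of "QX t" "qX t"]) auto
  next
    assume "standing_B m k r PYX QY QX cY cX"
    then show ?thesis using that unfolding standing_B_def by (intro B) auto
  qed
  show "min_costs_finite m k r PYX cY cX"
    using assms by (auto simp: standing_A_def standing_B_def)
qed

section \<open>The region of information pairs\<close>

lemma mutual_info_eq_sum:
  fixes J :: "('a::countable \<times> 'b::countable) pmf"
  assumes A: "finite A" "set_pmf J \<subseteq> A"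
  shows "mutual_info J = (\<Sum>(a, b)\<in>A. pmf J (a, b) * ln (pmf J (a, b) / (pmf (map_pmf fst J) a * pmf (map_pmf snd J) b)))"
proof -
  let ?Q = "pair_pmf (map_pmf fst J) (map_pmf snd J)"
  have fin: "finite (set_pmf J)" using A by (rule rev_finite_subset)
  have ac: "abs_cont J ?Q" by (force simp: abs_cont_iff)
  have "ereal (mutual_info J) = rel_entropy J ?Q"
    using ac by (simp add: mutual_info_eq_KL rel_entropy_def)
  then have "mutual_info J = (\<Sum>z\<in>set_pmf J. pmf J z * ln (pmf J z / pmf ?Q z))"
    by (simp add: rel_entropy_eq_sum[OF fin ac])
  also have "\<dots> = (\<Sum>z\<in>A. pmf J z * ln (pmf J z / pmf ?Q z))"
    using A by (intro sum.mono_neutral_left) (auto simp: set_pmf_iff)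
  also have "\<dots> = (\<Sum>(a, b)\<in>A. pmf J (a, b) * ln (pmf J (a, b) / (pmf (map_pmf fst J) a * pmf (map_pmf snd J) b)))"
    by (intro sum.cong refl) (auto simp: pmf_pair split: prod.split)
  finally show ?thesis .
qed

section \<open>Joint laws given by an input law and a channel\<close>

definition joint :: "'x pmf \<Rightarrow> ('x \<Rightarrow> 'y pmf) \<Rightarrow> ('y \<times> 'x) pmf" where
  "joint S W = bind_pmf S (\<lambda>x. map_pmf (\<lambda>y. (y, x)) (W x))"

lemma map_snd_joint [simp]: "map_pmf snd (joint S W) = S"
  by (simp add: joint_def map_bind_pmf pmf.map_comp o_def map_pmf_const bind_return_pmf')

lemma map_fst_joint [simp]: "map_pmf fst (joint S W) = bind_pmf S W"
  by (simp add: joint_def map_bind_pmf pmf.map_comp o_def)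

lemma pmf_joint:
  fixes S :: "'x::finite pmf"
  shows "pmf (joint S W) (y, x) = pmf S x * pmf (W x) y"
proof -
  have "pmf (map_pmf (\<lambda>y. (y, x')) (W x')) (y, x) = (if x' = x then pmf (W x) y else 0)" for x'
  proof (cases "x' = x")
    case True
    then show ?thesis using pmf_map_inj'[of "\<lambda>y. (y, x)" "W x" y] by (simp add: inj_on_def)
  qed (auto simp: pmf_eq_0_set_pmf)
  then have "pmf (joint S W) (y, x) = (\<Sum>x'\<in>UNIV. pmf S x' * (if x' = x then pmf (W x) y else 0))"
    unfolding joint_def by (simp add: pmf_bind_expect expect_superset[of UNIV])
  then show ?thesis by (simp add: if_distrib cong: if_cong)
qed

text \<open>The channel is the conditional law of the first component. Inputs of probability 0 are
  never sampled, so the value of the channel there is immaterial.\<close>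

lemma joint_disintegration:
  fixes P :: "('y::finite \<times> 'x::finite) pmf"
  obtains W where "P = joint (map_pmf snd P) W"
proof
  let ?S = "map_pmf snd P"
  let ?C = "\<lambda>x. cond_pmf P {z. x = snd z}"
  have ne: "set_pmf P \<inter> {z. x = snd z} \<noteq> {}" if "x \<in> set_pmf ?S" for x
    using that by auto
  have "P = bind_pmf ?S ?C"
  proof (rule bind_cond_pmf_cancel[symmetric])
    fix x z assume "x \<in> set_pmf ?S" "z \<in> set_pmf P" "x = snd z"
    show "measure P {z. x = snd z} = measure ?S {x. x = snd z}"
      using \<open>x = snd z\<close> by (auto simp: vimage_def intro!: arg_cong2[where f = measure])
  qed (use ne in auto)
  also have "\<dots> = bind_pmf ?S (\<lambda>x. map_pmf (\<lambda>y. (y, x)) (map_pmf fst (?C x)))"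
  proof (rule bind_pmf_cong[OF refl])
    fix x assume "x \<in> set_pmf ?S"
    then have "set_pmf (?C x) = set_pmf P \<inter> {z. x = snd z}" by (intro set_cond_pmf ne)
    then have "map_pmf (\<lambda>z. (fst z, x)) (?C x) = map_pmf (\<lambda>z. z) (?C x)"
      by (intro map_pmf_cong refl) auto
    then show "?C x = map_pmf (\<lambda>y. (y, x)) (map_pmf fst (?C x))" by (simp add: pmf.map_comp o_def)
  qed
  finally show "P = joint ?S (\<lambda>x. map_pmf fst (?C x))" by (simp add: joint_def)
qed

lemma log_sum_inequality:
  fixes a b :: "'i \<Rightarrow> real"
  assumes "finite I" and a: "\<And>i. i \<in> I \<Longrightarrow> 0 \<le> a i" and b: "\<And>i. i \<in> I \<Longrightarrow> 0 \<le> b i"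
    and ab: "\<And>i. i \<in> I \<Longrightarrow> b i = 0 \<Longrightarrow> a i = 0"
  shows "sum a I * ln (sum a I / sum b I) \<le> (\<Sum>i\<in>I. a i * ln (a i / b i))"
proof (cases "sum a I = 0")
  case True
  then have "a i = 0" if "i \<in> I" for i using assms(1) a that by (simp add: sum_nonneg_eq_0_iff)
  then show ?thesis using True by simp
next
  case False
  then have A: "sum a I > 0" using a by (simp add: order.strict_iff_order sum_nonneg)
  have "sum b I \<noteq> 0"
  proof
    assume "sum b I = 0"
    then have "\<forall>i\<in>I. b i = 0" using assms(1) b by (simp add: sum_nonneg_eq_0_iff)
    then have "sum a I = 0" using ab by (intro sum.neutral) auto
    with False show False by simp
  qed
  then have B: "sum b I > 0" using b by (simp add: order.strict_iff_order sum_nonneg)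
  let ?r = "sum a I / sum b I"
  \<comment> \<open>The tangent bound \<open>ln t \<le> t - 1\<close> at the quotient of the total
    ratio and the ratio of the i-th terms; the corrections \<open>b i * ?r - a i\<close> sum to
    0.\<close>
  have "a i * ln ?r \<le> a i * ln (a i / b i) + (b i * ?r - a i)" if i: "i \<in> I" for i
  proof (cases "a i = 0")
    case True
    then show ?thesis using b[OF i] A B by simp
  next
    case False
    then have pos: "a i > 0" "b i > 0" using a[OF i] b[OF i] ab[OF i] by (auto simp: order.strict_iff_order)
    have "ln ?r - ln (a i / b i) = ln (?r / (a i / b i))"
      using pos A B by (intro ln_divide_pos[symmetric]) auto
    also have "\<dots> \<le> ?r / (a i / b i) - 1" using pos A B by (intro ln_le_minus_one) auto
    finally have "a i * (ln ?r - ln (a i / b i)) \<le> a i * (?r / (a i / b i) - 1)"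
      using pos by (intro mult_left_mono) auto
    also have "\<dots> = b i * ?r - a i" using pos by (simp add: field_simps)
    finally show ?thesis by (simp add: algebra_simps)
  qed
  then have "(\<Sum>i\<in>I. a i * ln ?r) \<le> (\<Sum>i\<in>I. a i * ln (a i / b i) + (b i * ?r - a i))"
    by (rule sum_mono)
  also have "\<dots> = (\<Sum>i\<in>I. a i * ln (a i / b i)) + (sum b I * ?r - sum a I)"
    unfolding sum.distrib sum_subtractf sum_distrib_right ..
  also have "sum b I * ?r - sum a I = 0" using B by simp
  finally show ?thesis by (simp add: sum_distrib_right)
qed

text \<open>If \<open>v\<close> is the posterior law of \<open>X\<close> given \<open>U = u\<close>, then \<open>DX\<close> and \<open>DY\<close> are the contributions of \<open>u\<close>
  to \<open>I(X;U)\<close> and \<open>I(Y;U)\<close>; \<open>ln 0 = 0\<close> takes care of the vanishing terms.\<close>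

definition DX :: "'x::finite pmf \<Rightarrow> real^'x \<Rightarrow> real" where
  "DX S v = (\<Sum>x\<in>UNIV. v $ x * ln (v $ x / pmf S x))"

definition outlaw :: "('x::finite \<Rightarrow> 'y pmf) \<Rightarrow> real^'x \<Rightarrow> 'y \<Rightarrow> real" where
  "outlaw W v y = (\<Sum>x\<in>UNIV. v $ x * pmf (W x) y)"

definition DY :: "'x::finite pmf \<Rightarrow> ('x \<Rightarrow> 'y::finite pmf) \<Rightarrow> real^'x \<Rightarrow> real" where
  "DY S W v = (\<Sum>y\<in>UNIV. outlaw W v y * ln (outlaw W v y / pmf (bind_pmf S W) y))"

text \<open>The last clause keeps to laws dominated by \<open>S\<close>, for which \<open>DX\<close>
  and \<open>DY\<close> are genuine relative entropies in spite of division by 0.\<close>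

definition simplex_on :: "'x::finite pmf \<Rightarrow> (real^'x) set" where
  "simplex_on S = {v. (\<forall>x. 0 \<le> v $ x) \<and> (\<Sum>x\<in>UNIV. v $ x) = 1 \<and> (\<forall>x. pmf S x = 0 \<longrightarrow> v $ x = 0)}"

text \<open>The posterior is kept as a coordinate so that the requirement that posteriors average to
  \<open>S\<close> becomes linear. The slice over \<open>law_vec S\<close> consists exactly of the
  pairs of informations of kernels.\<close>

definition region :: "'x::finite pmf \<Rightarrow> ('x \<Rightarrow> 'y::finite pmf) \<Rightarrow> ((real^'x) \<times> real \<times> real) set" where
  "region S W = convex hull ((\<lambda>v. (v, DX S v, DY S W v)) ` simplex_on S)"

definition law_vec :: "'x::finite pmf \<Rightarrow> real^'x" where
  "law_vec S = (\<chi> x. pmf S x)"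

lemma law_vec_nth [simp]: "law_vec S $ x = pmf S x" by (simp add: law_vec_def)

lemma sum_pmf_UNIV [simp]: "(\<Sum>x\<in>UNIV. pmf S (x::'x::finite)) = 1"
  by (rule sum_pmf_eq_1) auto

lemma pmf_bind_UNIV: "pmf (bind_pmf S W) y = (\<Sum>x\<in>UNIV. pmf S (x::'x::finite) * pmf (W x) y)"
  by (simp add: pmf_bind_expect expect_superset[of UNIV])

lemma outlaw_law_vec: "outlaw W (law_vec S) y = pmf (bind_pmf S W) y"
  by (simp add: outlaw_def pmf_bind_UNIV)

lemma law_vec_in_simplex: "law_vec S \<in> simplex_on S"
  by (simp add: simplex_on_def)

lemma DX_law_vec [simp]: "DX S (law_vec S) = 0"
  unfolding DX_def by (rule sum.neutral) (auto simp: divide_self_if)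

lemma DY_law_vec [simp]: "DY S W (law_vec S) = 0"
  unfolding DY_def outlaw_law_vec by (rule sum.neutral) (auto simp: divide_self_if)

text \<open>Data processing: for each output letter, apply the log sum inequality over the
  inputs.\<close>

lemma DY_le_DX:
  assumes v: "v \<in> simplex_on S" shows "DY S W v \<le> DX S v"
proof -
  have "DY S W v \<le> (\<Sum>y\<in>UNIV. \<Sum>x\<in>UNIV. v $ x * pmf (W x) y * ln (v $ x * pmf (W x) y / (pmf S x * pmf (W x) y)))"
    unfolding DY_def outlaw_def pmf_bind_UNIV
    using v by (intro sum_mono log_sum_inequality) (auto simp: simplex_on_def)
  also have "\<dots> = (\<Sum>y\<in>UNIV. \<Sum>x\<in>UNIV. pmf (W x) y * (v $ x * ln (v $ x / pmf S x)))"
    by (intro sum.cong refl) (auto simp: mult_ac)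
  also have "\<dots> = DX S v"
    by (subst sum.swap) (simp add: DX_def flip: sum_distrib_right)
  finally show ?thesis .
qed

text \<open>Convexity of relative entropy, stated as a comparison with the affine interpolation of
  the values at the vertices. It will show that revealing X maximizes \<open>I(Y;U)\<close>.\<close>

lemma DY_le_linear:
  assumes v: "v \<in> simplex_on S"
  shows "DY S W v \<le> (\<Sum>x\<in>UNIV. v $ x * DY S W (axis x 1))"
proof -
  have ax: "outlaw W (axis x 1) y = pmf (W x) y" for x y
    by (simp add: outlaw_def axis_def if_distrib if_distribR cong: if_cong)
  have nn: "0 \<le> v $ x" and s1: "(\<Sum>x\<in>UNIV. v $ x) = 1" and z: "pmf S x = 0 \<Longrightarrow> v $ x = 0" for x
    using v by (auto simp: simplex_on_def)
  \<comment> \<open>Splitting the output probability with the weights of \<open>v\<close> turns the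
    single logarithm into the left side of a log sum inequality.\<close>
  have PY: "pmf (bind_pmf S W) y = (\<Sum>x\<in>UNIV. v $ x * pmf (bind_pmf S W) y)" for y
    by (simp add: s1 flip: sum_distrib_right)
  have "DY S W v \<le> (\<Sum>y\<in>UNIV. \<Sum>x\<in>UNIV. v $ x * pmf (W x) y * ln (v $ x * pmf (W x) y / (v $ x * pmf (bind_pmf S W) y)))"
    unfolding DY_def
  proof (rule sum_mono)
    fix y
    have zero: "v $ x * pmf (W x) y = 0" if "v $ x * pmf (bind_pmf S W) y = 0" for x
    proof (cases "v $ x = 0")
      case False
      with that have "(\<Sum>x\<in>UNIV. pmf S x * pmf (W x) y) = 0" by (simp add: pmf_bind_UNIV)
      then have "pmf S x * pmf (W x) y = 0" by (subst (asm) sum_nonneg_eq_0_iff) auto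
      with z[of x] False show ?thesis by auto
    qed simp
    show "outlaw W v y * ln (outlaw W v y / pmf (bind_pmf S W) y) \<le>
        (\<Sum>x\<in>UNIV. v $ x * pmf (W x) y * ln (v $ x * pmf (W x) y / (v $ x * pmf (bind_pmf S W) y)))"
      unfolding outlaw_def
      by (subst PY, rule log_sum_inequality) (use nn zero in auto)
  qed
  also have "\<dots> = (\<Sum>y\<in>UNIV. \<Sum>x\<in>UNIV. v $ x * (pmf (W x) y * ln (pmf (W x) y / pmf (bind_pmf S W) y)))"
    by (intro sum.cong refl) auto
  also have "\<dots> = (\<Sum>x\<in>UNIV. v $ x * DY S W (axis x 1))"
    by (subst sum.swap) (simp add: DY_def ax sum_distrib_left)
  finally show ?thesis .
qed

section \<open>Continuity of the contributions and compactness of the region\<close>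

lemma continuous_x_ln_x: "continuous_on {0..} (\<lambda>t::real. t * ln t)"
proof (rule continuous_on_eq_continuous_within[THEN iffD2], rule ballI)
  fix t :: real assume "t \<in> {0..}"
  show "continuous (at t within {0..}) (\<lambda>t. t * ln t)"
  proof (cases "t = 0")
    case True
    have "((\<lambda>t::real. t * ln t) \<longlongrightarrow> 0) (at_right 0)" by real_asymp
    then have "((\<lambda>t::real. t * ln t) \<longlongrightarrow> 0) (at 0 within {0..})"
      by (rule Lim_transform_within_set)
        (auto simp: eventually_at intro!: exI[of _ 1])
    then show ?thesis using True by (simp add: continuous_within)
  next
    case False
    then have "isCont (\<lambda>t. t * ln t) t" by (intro continuous_intros) auto
    then show ?thesis by (rule continuous_at_imp_continuous_at_within)
  qed
qed

lemma continuous_x_ln_div: 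
  assumes "s \<ge> 0" shows "continuous_on {0..} (\<lambda>t::real. t * ln (t / s))"
proof (cases "s = 0")
  case False
  have "t * ln (t / s) = t * ln t - t * ln s" for t
    using False assms by (simp add: ln_div algebra_simps)
  then show ?thesis by (simp add: continuous_intros continuous_x_ln_x)
qed simp

lemma continuous_on_x_ln_div_compose:
  fixes f :: "'b::topological_space \<Rightarrow> real"
  assumes "s \<ge> 0" "continuous_on A f" "\<And>v. v \<in> A \<Longrightarrow> f v \<ge> 0"
  shows "continuous_on A (\<lambda>v. f v * ln (f v / s))"
  using continuous_on_compose2[OF continuous_x_ln_div[OF assms(1)] assms(2)] assms(3) by auto

lemma continuous_DX: "continuous_on (simplex_on S) (DX S)"
  unfolding DX_def
  by (intro continuous_on_sum continuous_on_x_ln_div_compose) (auto simp: simplex_on_def intro!: continuous_intros)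

lemma outlaw_nonneg: "v \<in> simplex_on S \<Longrightarrow> 0 \<le> outlaw W v y"
  by (auto simp: outlaw_def simplex_on_def intro!: sum_nonneg)

lemma continuous_DY: "continuous_on (simplex_on S) (DY S W)"
  unfolding DY_def
  by (intro continuous_on_sum continuous_on_x_ln_div_compose)
    (auto simp: outlaw_nonneg, auto simp: outlaw_def intro!: continuous_intros)

lemma compact_simplex_on: "compact (simplex_on S)"
proof -
  have "norm v \<le> 1" if "v \<in> simplex_on S" for v
    using norm_le_l1_cart[of v] that by (simp add: simplex_on_def)
  then have "bounded (simplex_on S)" by (rule boundedI)
  moreover have "closed (simplex_on S)"
  proof -
    have "simplex_on S = (\<Inter>x. {v. 0 \<le> v $ x}) \<inter> {v. (\<Sum>x\<in>UNIV. v $ x) = 1} \<inter>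
        (\<Inter>x\<in>{x. pmf S x = 0}. {v. v $ x = 0})"
      by (auto simp: simplex_on_def)
    also have "closed \<dots>"
      by (intro closed_Int closed_INT ballI closed_Collect_le closed_Collect_eq continuous_intros)
    finally show ?thesis .
  qed
  ultimately show ?thesis by (simp add: compact_eq_bounded_closed)
qed

lemma compact_region: "compact (region S W)"
  unfolding region_def
  by (intro compact_convex_hull compact_continuous_image compact_simplex_on continuous_on_Pair
      continuous_on_id continuous_DX continuous_DY)

lemma convex_region: "convex (region S W)"
  by (simp add: region_def)

lemma simplex_in_region: "v \<in> simplex_on S \<Longrightarrow> (v, DX S v, DY S W v) \<in> region S W"
  unfolding region_def by (rule hull_inc) auto

lemma region_origin: "(law_vec S, 0, 0) \<in> region S W"
  using simplex_in_region[OF law_vec_in_simplex, of S W] by simp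

text \<open>The inequality is linear in the coordinates of the region, so it passes from the graph
  to its convex hull.\<close>

lemma region_DY_le_DX:
  fixes v :: "real^'x"
  assumes *: "(v, a, b) \<in> region S W" shows "b \<le> a"
proof -
  have "region S W \<subseteq> {z. snd (snd z) \<le> fst (snd z)}"
    unfolding region_def
  proof (rule hull_minimal)
    show "convex {z :: (real^'x) \<times> real \<times> real. snd (snd z) \<le> fst (snd z)}"
      by (auto simp: convex_def intro!: add_mono mult_left_mono)
  qed (auto simp: DY_le_DX)
  with * show ?thesis by auto
qed

lemma region_DY_le_linear:
  fixes v :: "real^'x"
  assumes *: "(v, a, b) \<in> region S W"
  shows "b \<le> (\<Sum>x\<in>UNIV. v $ x * DY S W (axis x 1))"
proof -
  let ?n = "(- (\<chi> x. DY S W (axis x 1)), 0, 1) :: (real^'x) \<times> real \<times> real"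
  have n: "?n \<bullet> (v, a, b) = b - (\<Sum>x\<in>UNIV. v $ x * DY S W (axis x 1))" for v a b
    by (simp add: inner_vec_def sum_negf mult.commute)
  have "region S W \<subseteq> {z. ?n \<bullet> z \<le> 0}"
    unfolding region_def
  proof (rule hull_minimal)
    show "(\<lambda>v. (v, DX S v, DY S W v)) ` simplex_on S \<subseteq> {z. ?n \<bullet> z \<le> 0}"
    proof safe
      fix v assume "v \<in> simplex_on S"
      then show "?n \<bullet> (v, DX S v, DY S W v) \<le> 0" unfolding n using DY_le_linear by fastforce
    qed
  qed (rule convex_halfspace_le)
  with * have "?n \<bullet> (v, a, b) \<le> 0" by blast
  then show ?thesis unfolding n by simp
qed

text \<open>A kernel is described by the law \<open>w\<close> of \<open>U\<close> and the posterior laws \<open>v u\<close> of \<open>X\<close>.\<close>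

definition kernel_rep :: "'x::finite pmf \<Rightarrow> ('x \<Rightarrow> nat pmf) \<Rightarrow> nat set \<Rightarrow> (nat \<Rightarrow> real) \<Rightarrow> (nat \<Rightarrow> real^'x) \<Rightarrow> bool" where
  "kernel_rep S K I w v \<longleftrightarrow> finite I \<and> (\<forall>u\<in>I. 0 \<le> w u \<and> (\<Sum>x\<in>UNIV. v u $ x) = 1) \<and>
     (\<forall>u\<in>I. \<forall>x. pmf S x * pmf (K x) u = w u * v u $ x) \<and> (\<forall>x\<in>set_pmf S. set_pmf (K x) \<subseteq> I)"

lemma kernel_rep_weight:
  assumes "kernel_rep S K I w v" "u \<in> I"
  shows "pmf (bind_pmf S K) u = w u"
  using assms by (simp add: pmf_bind_UNIV kernel_rep_def flip: sum_distrib_left)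

lemma kernel_rep_sum_weights:
  assumes "kernel_rep S K I w v"
  shows "sum w I = 1"
proof -
  have "sum w I = sum (pmf (bind_pmf S K)) I"
    using kernel_rep_weight[OF assms] by (intro sum.cong) auto
  also have "\<dots> = 1" using assms by (intro sum_pmf_eq_1) (auto simp: kernel_rep_def)
  finally show ?thesis .
qed

lemma I_XU_rep:
  assumes rep: "kernel_rep S K I w v"
  shows "I_XU S K = (\<Sum>u\<in>I. w u * DX S (v u))"
proof -
  let ?J = "bind_pmf S (\<lambda>x. map_pmf (\<lambda>u. (x, u)) (K x))"
  have J: "?J = map_pmf (\<lambda>(u, x). (x, u)) (joint S K)"
    by (simp add: joint_def map_bind_pmf pmf.map_comp o_def)
  have pJ: "pmf ?J (x, u) = pmf S x * pmf (K x) u" for x u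
    using pmf_map_inj'[of "\<lambda>(u, x). (x, u)" "joint S K" "(u, x)"] by (simp add: J inj_on_def pmf_joint)
  have fst: "map_pmf fst ?J = S" and snd: "map_pmf snd ?J = bind_pmf S K"
    by (simp_all add: map_bind_pmf pmf.map_comp o_def map_pmf_const bind_return_pmf')
  have "I_XU S K = (\<Sum>(x, u)\<in>UNIV \<times> I. pmf ?J (x, u) * ln (pmf ?J (x, u) / (pmf S x * pmf (bind_pmf S K) u)))"
    unfolding I_XU_def
    by (subst mutual_info_eq_sum[of "UNIV \<times> I"]) (use rep in \<open>auto simp: fst snd kernel_rep_def\<close>)
  also have "\<dots> = (\<Sum>x\<in>UNIV. \<Sum>u\<in>I. pmf ?J (x, u) * ln (pmf ?J (x, u) / (pmf S x * pmf (bind_pmf S K) u)))"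
    by (simp add: sum.cartesian_product)
  also have "\<dots> = (\<Sum>u\<in>I. \<Sum>x\<in>UNIV. w u * (v u $ x * ln (v u $ x / pmf S x)))"
  proof (subst sum.swap, intro sum.cong refl)
    fix u x assume "u \<in> I"
    then have "pmf ?J (x, u) = w u * v u $ x" "pmf (bind_pmf S K) u = w u"
      using rep kernel_rep_weight[OF rep] by (auto simp: pJ kernel_rep_def)
    then show "pmf ?J (x, u) * ln (pmf ?J (x, u) / (pmf S x * pmf (bind_pmf S K) u)) =
        w u * (v u $ x * ln (v u $ x / pmf S x))"
      by (cases "w u = 0") auto
  qed
  finally show ?thesis by (simp add: DX_def sum_distrib_left)
qed

lemma I_YU_rep:
  assumes rep: "kernel_rep S K I w v"
  shows "I_YU (joint S W) K = (\<Sum>u\<in>I. w u * DY S W (v u))"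
proof -
  let ?J = "bind_pmf (joint S W) (\<lambda>(y, x). map_pmf (\<lambda>u. (y, u)) (K x))"
  have J: "?J = bind_pmf S (\<lambda>x. pair_pmf (W x) (K x))"
    by (simp add: joint_def bind_assoc_pmf bind_map_pmf pair_pmf_def map_pmf_def bind_return_pmf)
  have fst: "map_pmf fst ?J = bind_pmf S W" and snd: "map_pmf snd ?J = bind_pmf S K"
    unfolding J by (simp_all add: map_bind_pmf map_fst_pair_pmf map_snd_pair_pmf)
  have pJ: "pmf ?J (y, u) = w u * outlaw W (v u) y" if "u \<in> I" for y u
  proof -
    have "pmf ?J (y, u) = (\<Sum>x\<in>UNIV. (pmf S x * pmf (K x) u) * pmf (W x) y)"
      unfolding J pmf_bind_UNIV by (simp add: pmf_pair mult_ac)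
    also have "\<dots> = (\<Sum>x\<in>UNIV. (w u * v u $ x) * pmf (W x) y)"
      using rep that by (simp add: kernel_rep_def)
    finally show ?thesis by (simp add: outlaw_def sum_distrib_left mult_ac)
  qed
  have "I_YU (joint S W) K = (\<Sum>(y, u)\<in>UNIV \<times> I. pmf ?J (y, u) * ln (pmf ?J (y, u) / (pmf (bind_pmf S W) y * pmf (bind_pmf S K) u)))"
    unfolding I_YU_def
  proof (subst mutual_info_eq_sum[of "UNIV \<times> I"])
    show "set_pmf ?J \<subseteq> UNIV \<times> I" unfolding J using rep by (auto simp: kernel_rep_def)
  qed (use rep in \<open>auto simp: fst snd kernel_rep_def\<close>)
  also have "\<dots> = (\<Sum>y\<in>UNIV. \<Sum>u\<in>I. pmf ?J (y, u) * ln (pmf ?J (y, u) / (pmf (bind_pmf S W) y * pmf (bind_pmf S K) u)))"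
    by (simp add: sum.cartesian_product)
  also have "\<dots> = (\<Sum>u\<in>I. \<Sum>y\<in>UNIV. w u * (outlaw W (v u) y * ln (outlaw W (v u) y / pmf (bind_pmf S W) y)))"
  proof (subst sum.swap, intro sum.cong refl)
    fix u y assume "u \<in> I"
    then show "pmf ?J (y, u) * ln (pmf ?J (y, u) / (pmf (bind_pmf S W) y * pmf (bind_pmf S K) u)) =
        w u * (outlaw W (v u) y * ln (outlaw W (v u) y / pmf (bind_pmf S W) y))"
      unfolding pJ[OF \<open>u \<in> I\<close>] kernel_rep_weight[OF rep \<open>u \<in> I\<close>]
      by (cases "w u = 0") auto
  qed
  finally show ?thesis by (simp add: DY_def sum_distrib_left)
qed

lemma kernel_rep_exists:
  assumes "K \<in> kernels"
  obtains I w v where "kernel_rep S K I w v" "\<And>u. u \<in> I \<Longrightarrow> v u \<in> simplex_on S"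
proof
  let ?I = "\<Union>x. set_pmf (K x)"
  let ?w = "pmf (bind_pmf S K)"
  \<comment> \<open>A value of probability 0 has no posterior; \<open>law_vec S\<close> is a
    convenient member of the simplex there.\<close>
  let ?v = "\<lambda>u. if ?w u = 0 then law_vec S else (\<chi> x. pmf S x * pmf (K x) u / ?w u)"
  have fin: "finite ?I" using assms by (auto simp: kernels_def)
  have zero: "pmf S x * pmf (K x) u = 0" if "?w u = 0" for x u
    using that unfolding pmf_bind_UNIV by (subst (asm) sum_nonneg_eq_0_iff) auto
  show simplex: "?v u \<in> simplex_on S" if "u \<in> ?I" for u
    using pmf_bind_UNIV[of S K u, symmetric] by (auto simp: law_vec_in_simplex simplex_on_def simp flip: sum_divide_distrib)
  show "kernel_rep S K ?I ?w ?v"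
    using fin simplex zero by (auto simp: kernel_rep_def simplex_on_def)
qed

text \<open>Weighting the graph points of the posteriors by the law of U: the posteriors average to
  \<open>S\<close>, the other coordinates to the two informations.\<close>

lemma kernel_in_region:
  assumes "K \<in> kernels"
  shows "(law_vec S, I_XU S K, I_YU (joint S W) K) \<in> region S W"
proof -
  obtain I w v where rep: "kernel_rep S K I w v" and v: "\<And>u. u \<in> I \<Longrightarrow> v u \<in> simplex_on S"
    using kernel_rep_exists[OF assms] by blast
  let ?p = "\<lambda>u. (v u, DX S (v u), DY S W (v u))"
  have fin: "finite I" using rep by (simp add: kernel_rep_def)
  have "(\<Sum>u\<in>I. w u *\<^sub>R ?p u) \<in> region S W"
    using kernel_rep_sum_weights[OF rep] rep
    by (intro convex_sum convex_region simplex_in_region v fin) (auto simp: kernel_rep_def)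
  moreover have "(\<Sum>u\<in>I. w u *\<^sub>R v u) = law_vec S"
  proof (subst vec_eq_iff, rule allI)
    fix x
    have "(\<Sum>u\<in>I. w u *\<^sub>R v u) $ x = (\<Sum>u\<in>I. pmf S x * pmf (K x) u)"
      using rep by (simp add: kernel_rep_def)
    also have "\<dots> = pmf S x"
    proof (cases "x \<in> set_pmf S")
      case True
      then have "sum (pmf (K x)) I = 1" using rep by (intro sum_pmf_eq_1) (auto simp: kernel_rep_def)
      then show ?thesis by (simp flip: sum_distrib_left)
    qed (simp add: set_pmf_iff)
    finally show "(\<Sum>u\<in>I. w u *\<^sub>R v u) $ x = law_vec S $ x" by simp
  qed
  moreover have "(\<Sum>u\<in>I. w u *\<^sub>R ?p u) =
      ((\<Sum>u\<in>I. w u *\<^sub>R v u), (\<Sum>u\<in>I. w u * DX S (v u)), (\<Sum>u\<in>I. w u * DY S W (v u)))"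
    by (intro prod_eqI) (simp_all add: fst_sum snd_sum)
  ultimately show ?thesis unfolding I_XU_rep[OF rep] I_YU_rep[OF rep] by simp
qed

text \<open>Converse of \<open>kernel_in_region\<close>: the points of a convex combination become
  the values of U, relabelled by natural numbers through \<open>e\<close>, and their first
  coordinates become the posteriors.\<close>

lemma region_kernel:
  assumes "(law_vec S, a, b) \<in> region S W"
  obtains K where "K \<in> kernels" "I_XU S K = a" "I_YU (joint S W) K = b"
proof -
  let ?p = "\<lambda>v. (v, DX S v, DY S W v)"
  obtain T c where T: "finite T" "T \<subseteq> ?p ` simplex_on S" and c: "\<And>z. z \<in> T \<Longrightarrow> 0 \<le> c z" "sum c T = 1"
    and sum: "(\<Sum>z\<in>T. c z *\<^sub>R z) = (law_vec S, a, b)"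
    using assms unfolding region_def convex_hull_explicit by blast
  obtain e :: "_ \<Rightarrow> nat" where e: "inj_on e T"
    using finite_imp_inj_to_nat_seg[OF T(1)] by blast
  define I where "I = e ` T"
  define d where "d = the_inv_into T e"
  have d: "d u \<in> T" "e (d u) = u" if "u \<in> I" for u
    using that e by (auto simp: I_def d_def the_inv_into_f_f)
  have de: "d (e z) = z" if "z \<in> T" for z using that e by (simp add: d_def the_inv_into_f_f)
  define w where "w u = c (d u)" for u
  define v where "v u = fst (d u)" for u
  have reindex: "(\<Sum>u\<in>I. w u * f (d u)) = (\<Sum>z\<in>T. c z * f z)" for f :: "_ \<Rightarrow> real"
    unfolding I_def using e by (subst sum.reindex) (auto simp: w_def de)
  have pt: "v u \<in> simplex_on S" "d u = ?p (v u)" if "u \<in> I" for u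
    using d(1)[OF that] T(2) by (auto simp: v_def)
  have finI: "finite I" using T(1) by (simp add: I_def)
  have mix: "(\<Sum>u\<in>I. w u * v u $ x) = pmf S x" for x
  proof -
    have "(\<Sum>u\<in>I. w u * v u $ x) = (\<Sum>z\<in>T. c z * fst z $ x)"
      unfolding v_def by (rule reindex)
    also have "\<dots> = fst (\<Sum>z\<in>T. c z *\<^sub>R z) $ x" by (simp add: fst_sum)
    finally show ?thesis by (simp add: sum)
  qed
  \<comment> \<open>Bayes' rule turns posteriors back into a kernel. Where \<open>S\<close> vanishes
    the rule says nothing and a fixed law is put in.\<close>
  define K where "K x = (if pmf S x = 0 then return_pmf 0 else
      embed_pmf (\<lambda>u. if u \<in> I then w u * v u $ x / pmf S x else 0))" for x
  have nn: "0 \<le> w u * v u $ x" if "u \<in> I" for u x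
    using pt(1)[OF that] c(1)[OF d(1)[OF that]] by (simp add: w_def simplex_on_def)
  have pK: "pmf (K x) u = (if u \<in> I then w u * v u $ x / pmf S x else 0)" if "pmf S x \<noteq> 0" for x u
  proof -
    have "pmf (embed_pmf (\<lambda>u. if u \<in> I then w u * v u $ x / pmf S x else 0)) u =
        (if u \<in> I then w u * v u $ x / pmf S x else 0)"
    proof (rule pmf_embed_pmf)
      have "(\<integral>\<^sup>+u. ennreal (if u \<in> I then w u * v u $ x / pmf S x else 0) \<partial>count_space UNIV) =
          (\<Sum>u\<in>I. ennreal (w u * v u $ x / pmf S x))"
        by (subst nn_integral_count_space'[OF finI]) auto
      also have "\<dots> = ennreal (\<Sum>u\<in>I. w u * v u $ x / pmf S x)"
        using nn by (intro sum_ennreal) auto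
      also have "(\<Sum>u\<in>I. w u * v u $ x / pmf S x) = 1"
        using that by (simp add: mix flip: sum_divide_distrib)
      finally show "(\<integral>\<^sup>+u. ennreal (if u \<in> I then w u * v u $ x / pmf S x else 0) \<partial>count_space UNIV) = 1"
        by simp
    qed (use nn in auto)
    then show ?thesis using that by (simp add: K_def)
  qed
  have sup: "set_pmf (K x) \<subseteq> I" if "pmf S x \<noteq> 0" for x
    using pK[OF that] by (auto simp: set_pmf_iff split: if_splits)
  have "finite (set_pmf (K x))" for x
    using sup[of x] finI by (cases "pmf S x = 0") (auto simp: K_def intro: finite_subset)
  then have K: "K \<in> kernels" by (simp add: kernels_def)
  have rep: "kernel_rep S K I w v"
    unfolding kernel_rep_def
  proof (intro conjI ballI allI finI)
    fix u x assume u: "u \<in> I"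
    show "0 \<le> w u" using c(1)[OF d(1)[OF u]] by (simp add: w_def)
    show "(\<Sum>x\<in>UNIV. v u $ x) = 1" using pt(1)[OF u] by (simp add: simplex_on_def)
    show "pmf S x * pmf (K x) u = w u * v u $ x"
      using pt(1)[OF u] pK[of x u] u by (cases "pmf S x = 0") (auto simp: simplex_on_def)
  next
    show "set_pmf (K x) \<subseteq> I" if "x \<in> set_pmf S" for x
      using that sup[of x] by (simp add: set_pmf_iff)
  qed
  have "I_XU S K = (\<Sum>u\<in>I. w u * fst (snd (d u)))"
    unfolding I_XU_rep[OF rep] using pt(2) by (intro sum.cong) auto
  also have "\<dots> = (\<Sum>z\<in>T. c z * fst (snd z))" by (rule reindex)
  also have "\<dots> = fst (snd (\<Sum>z\<in>T. c z *\<^sub>R z))" by (simp add: fst_sum snd_sum)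
  finally have 1: "I_XU S K = a" by (simp add: sum)
  have "I_YU (joint S W) K = (\<Sum>u\<in>I. w u * snd (snd (d u)))"
    unfolding I_YU_rep[OF rep] using pt(2) by (intro sum.cong) auto
  also have "\<dots> = (\<Sum>z\<in>T. c z * snd (snd z))" by (rule reindex)
  also have "\<dots> = snd (snd (\<Sum>z\<in>T. c z *\<^sub>R z))" by (simp add: fst_sum snd_sum)
  finally have 2: "I_YU (joint S W) K = b" by (simp add: sum)
  from that[OF K 1 2] show ?thesis .
qed

section \<open>Extreme kernels and attainment of the maximum\<close>

definition XU_max :: "'x::finite pmf \<Rightarrow> real" where
  "XU_max S = (\<Sum>x\<in>UNIV. pmf S x * DX S (axis x 1))"

text \<open>The vertex at x is the posterior of X when U reveals X. Thus \<open>XU_max\<close> is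
  the entropy of \<open>S\<close>, and \<open>YU_max\<close> is the mutual information between input
  and output of the channel.\<close>

definition YU_max :: "'x::finite pmf \<Rightarrow> ('x \<Rightarrow> 'y::finite pmf) \<Rightarrow> real" where
  "YU_max S W = (\<Sum>x\<in>UNIV. pmf S x * DY S W (axis x 1))"

definition full_kernel :: "'x::finite \<Rightarrow> nat pmf" where
  "full_kernel x = return_pmf (to_nat x)"

lemma full_kernel_in_kernels: "full_kernel \<in> kernels"
  by (simp add: kernels_def full_kernel_def)

lemma full_kernel_info:
  fixes S :: "'x::finite pmf"
  shows "I_XU S full_kernel = XU_max S" "I_YU (joint S W) full_kernel = YU_max S W"
proof -
  let ?I = "to_nat ` (UNIV :: 'x set)"
  let ?w = "\<lambda>u. pmf S (from_nat u)"
  let ?v = "\<lambda>u. axis (from_nat u) 1 :: real^'x"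
  have rep: "kernel_rep S full_kernel ?I ?w ?v"
    by (auto simp: kernel_rep_def full_kernel_def axis_def indicator_def)
  show "I_XU S full_kernel = XU_max S"
    unfolding I_XU_rep[OF rep] by (subst sum.reindex) (auto simp: XU_max_def)
  show "I_YU (joint S W) full_kernel = YU_max S W"
    unfolding I_YU_rep[OF rep] by (subst sum.reindex) (auto simp: YU_max_def)
qed

lemma I_YU_le_I_XU: "K \<in> kernels \<Longrightarrow> I_YU (joint S W) K \<le> I_XU S K"
  by (rule region_DY_le_DX[OF kernel_in_region])

lemma I_YU_le_YU_max: "K \<in> kernels \<Longrightarrow> I_YU (joint S W) K \<le> YU_max S W"
  using region_DY_le_linear[OF kernel_in_region, of K S W] by (simp add: YU_max_def)

lemma const_kernel:
  "(\<lambda>_. return_pmf u) \<in> kernels" "I_XU S (\<lambda>_. return_pmf u) = 0" "I_YU (joint S W) (\<lambda>_. return_pmf u) = 0"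
proof -
  show "(\<lambda>_. return_pmf u) \<in> kernels" by (simp add: kernels_def)
  have rep: "kernel_rep S (\<lambda>_. return_pmf u) {u} (\<lambda>_. 1) (\<lambda>_. law_vec S)"
    by (auto simp: kernel_rep_def)
  show "I_XU S (\<lambda>_. return_pmf u) = 0" "I_YU (joint S W) (\<lambda>_. return_pmf u) = 0"
    unfolding I_XU_rep[OF rep] I_YU_rep[OF rep] by simp_all
qed

lemma I_YU_le_max:
  assumes "K \<in> kernels" "I_XU S K \<le> R"
  shows "I_YU (joint S W) K \<le> max_I_YU (joint S W) R"
  unfolding max_I_YU_def map_snd_joint
proof (rule cSup_upper)
  show "bdd_above {I_YU (joint S W) K |K. K \<in> kernels \<and> I_XU S K \<le> R}"
    by (rule bdd_aboveI[of _ "YU_max S W"]) (auto simp: I_YU_le_YU_max)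
qed (use assms in auto)

lemma region_le_max:
  assumes "(law_vec S, a, b) \<in> region S W" "a \<le> R"
  shows "b \<le> max_I_YU (joint S W) R"
  using region_kernel[OF assms(1)] I_YU_le_max assms(2) by metis

text \<open>Kernels with alphabets of unlimited size do not form a compact set, but the relevant
  slice of \<open>region\<close> is compact. This takes the place of a cardinality bound on the
  alphabet of U.\<close>

lemma max_I_YU_attained:
  fixes S :: "'x::finite pmf" and W :: "'x \<Rightarrow> 'y::finite pmf"
  assumes "R \<ge> 0"
  obtains K where "K \<in> kernels" "I_XU S K \<le> R" "I_YU (joint S W) K = max_I_YU (joint S W) R"
proof -
  let ?C = "region S W \<inter> {z. fst z = law_vec S \<and> fst (snd z) \<le> R}"
  have "closed {z :: (real^'x) \<times> real \<times> real. fst z = law_vec S \<and> fst (snd z) \<le> R}"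
    by (intro closed_Collect_conj closed_Collect_eq closed_Collect_le continuous_intros)
  then have 1: "compact ?C" using compact_region by (rule compact_Int_closed[rotated])
  have 2: "?C \<noteq> {}" using region_origin[of S W] assms by auto
  have 3: "continuous_on ?C (\<lambda>z. snd (snd z))" by (intro continuous_intros)
  obtain z where z: "z \<in> ?C" "\<forall>y\<in>?C. snd (snd y) \<le> snd (snd z)"
    using continuous_attains_sup[OF 1 2 3] by blast
  obtain a b where ab: "z = (law_vec S, a, b)" "a \<le> R" "(law_vec S, a, b) \<in> region S W"
    using z(1) by (cases z) auto
  obtain K where K: "K \<in> kernels" "I_XU S K = a" "I_YU (joint S W) K = b"
    using region_kernel[OF ab(3)] by blast
  have "max_I_YU (joint S W) R \<le> b"
    unfolding max_I_YU_def map_snd_joint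
  proof (rule cSup_least)
    fix t assume "t \<in> {I_YU (joint S W) K |K. K \<in> kernels \<and> I_XU S K \<le> R}"
    then obtain K where K: "t = I_YU (joint S W) K" "K \<in> kernels" "I_XU S K \<le> R" by blast
    show "t \<le> b"
      using z(2)[rule_format, of "(law_vec S, I_XU S K, I_YU (joint S W) K)"] kernel_in_region[OF K(2), of S W] K
      by (simp add: ab(1))
  qed (use K ab in auto)
  with I_YU_le_max[OF K(1), of S R W] K ab(2) that[OF K(1)] show ?thesis by force
qed

text \<open>The separability condition speaks of kernels that spend exactly \<open>R\<close>. Moving
  from an optimal point of the region straight towards the point of \<open>full_kernel\<close>
  raises the first information to \<open>R\<close> without lowering the second, since no kernel
  exceeds \<open>YU_max\<close>.\<close>

lemma W_opt_nonempty:
  fixes S :: "'x::finite pmf"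
  assumes "0 \<le> R" "R \<le> XU_max S" and P: "PYX i = joint S W"
  shows "W_opt PYX S R i \<noteq> {}"
proof -
  obtain K0 where K0: "K0 \<in> kernels" "I_XU S K0 \<le> R" "I_YU (joint S W) K0 = max_I_YU (joint S W) R"
    using max_I_YU_attained[OF assms(1)] by metis
  let ?a = "I_XU S K0" and ?b = "I_YU (joint S W) K0"
  have "\<exists>e. 0 \<le> e \<and> e \<le> 1 \<and> (1 - e) * ?a + e * XU_max S = R"
  proof (cases "?a = XU_max S")
    case True
    then show ?thesis using K0(2) assms(2) by (intro exI[of _ 0]) auto
  next
    case False
    then have pos: "XU_max S - ?a > 0" using K0(2) assms(2) by simp
    let ?e = "(R - ?a) / (XU_max S - ?a)"
    have "(1 - ?e) * ?a + ?e * XU_max S = ?a + ?e * (XU_max S - ?a)" by (simp only: algebra_simps)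
    also have "\<dots> = R" using pos by simp
    finally show ?thesis using pos K0(2) assms(2) by (intro exI[of _ ?e]) auto
  qed
  then obtain e where e: "0 \<le> e" "e \<le> 1" "(1 - e) * ?a + e * XU_max S = R" by blast
  have "(1 - e) *\<^sub>R (law_vec S, ?a, ?b) + e *\<^sub>R (law_vec S, XU_max S, YU_max S W) \<in> region S W"
    using kernel_in_region[OF full_kernel_in_kernels, of S W] kernel_in_region[OF K0(1), of S W] e(1,2)
    by (intro convexD[OF convex_region]) (auto simp: full_kernel_info)
  then have "(law_vec S, R, (1 - e) * ?b + e * YU_max S W) \<in> region S W"
    by (simp add: e(3) flip: scaleR_add_left)
  then obtain K where K: "K \<in> kernels" "I_XU S K = R" "I_YU (joint S W) K = (1 - e) * ?b + e * YU_max S W"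
    using region_kernel by metis
  have "?b \<le> (1 - e) * ?b + e * YU_max S W"
    using mult_left_mono[OF I_YU_le_YU_max[OF K0(1), of S W] e(1)] by (simp add: algebra_simps)
  then have "I_YU (joint S W) K = max_I_YU (joint S W) R"
    using K K0(3) I_YU_le_max[OF K(1), of S R W] by simp
  then show ?thesis using K P by (auto simp: W_opt_def W_set_def)
qed

text \<open>U is replaced by the symbol 0 with probability \<open>e\<close> and shifted by
  \<open>Suc\<close> otherwise. Given an erasure the posterior is \<open>S\<close> itself and
  contributes nothing. \<open>K'\<close> is chosen before the channel, so it works for all channels
  at once.\<close>

lemma erasure_kernel:
  fixes S :: "'x::finite pmf"
  assumes K: "K \<in> kernels" and e: "0 \<le> e" "e \<le> 1"
  obtains K' where "K' \<in> kernels" "I_XU S K' = (1 - e) * I_XU S K"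
    "\<And>W :: 'x \<Rightarrow> 'y::finite pmf. I_YU (joint S W) K' = (1 - e) * I_YU (joint S W) K"
proof -
  obtain I w v where rep: "kernel_rep S K I w v" and "\<And>u. u \<in> I \<Longrightarrow> v u \<in> simplex_on S"
    using kernel_rep_exists[OF K] by blast
  define K' where "K' x = bind_pmf (bernoulli_pmf e) (\<lambda>b. if b then return_pmf 0 else map_pmf Suc (K x))" for x
  let ?I = "insert 0 (Suc ` I)"
  let ?w = "\<lambda>u. if u = 0 then e else (1 - e) * w (u - 1)"
  let ?v = "\<lambda>u. if u = 0 then law_vec S else v (u - 1)"
  have fin: "finite I" using rep by (simp add: kernel_rep_def)
  have p0: "pmf (K' x) 0 = e" for x
  proof -
    have "pmf (map_pmf Suc (K x)) 0 = 0" by (auto simp: pmf_eq_0_set_pmf)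
    then show ?thesis using e by (simp add: K'_def pmf_bind)
  qed
  have pS: "pmf (K' x) (Suc u) = (1 - e) * pmf (K x) u" for x u
    using e by (simp add: K'_def pmf_bind pmf_map_inj')
  have "finite (set_pmf (K' x))" for x
    using K unfolding K'_def by (auto simp: kernels_def)
  then have "K' \<in> kernels" by (simp add: kernels_def)
  moreover have rep': "kernel_rep S K' ?I ?w ?v"
    unfolding kernel_rep_def
  proof (intro conjI ballI allI)
    show "set_pmf (K' x) \<subseteq> ?I" if "x \<in> set_pmf S" for x
      using that rep unfolding K'_def kernel_rep_def by (fastforce split: if_splits)
    show "pmf S x * pmf (K' x) u = ?w u * ?v u $ x" if "u \<in> ?I" for u x
      using that rep by (auto simp: p0 pS kernel_rep_def algebra_simps)
  qed (use rep e fin in \<open>auto simp: kernel_rep_def\<close>)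
  have split: "(\<Sum>u\<in>?I. ?w u * f (?v u)) = e * f (law_vec S) + (1 - e) * (\<Sum>u\<in>I. w u * f (v u))" for f :: "real^'x \<Rightarrow> real"
    using fin by (simp add: sum.reindex sum_distrib_left mult_ac)
  have "I_XU S K' = (1 - e) * I_XU S K"
    unfolding I_XU_rep[OF rep'] I_XU_rep[OF rep] split by simp
  moreover have "I_YU (joint S W) K' = (1 - e) * I_YU (joint S W) K" for W :: "'x \<Rightarrow> 'y pmf"
    unfolding I_YU_rep[OF rep'] I_YU_rep[OF rep] split by simp
  ultimately show ?thesis using that by blast
qed

text \<open>\<open>lam\<close> is the price of rate. The separation is strict, by compactness, so no constraint qualification
  is needed and \<open>R = 0\<close> is not special.\<close>

lemma separating_price:
  fixes S :: "'x::finite pmf" and W :: "'x \<Rightarrow> 'y::finite pmf"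
  assumes R: "R \<ge> 0" and "\<eta> > 0"
  obtains g lam where "lam > 0"
    "\<And>v. v \<in> simplex_on S \<Longrightarrow> DY S W v \<le> lam * DX S v + (\<Sum>x\<in>UNIV. v $ x * g x)"
    "(\<Sum>x\<in>UNIV. pmf S x * g x) \<le> max_I_YU (joint S W) R + \<eta> - lam * R"
proof -
  \<comment> \<open>One half lifts the separated set strictly above the maximum, the other pays for
    a strictly positive price.\<close>
  define \<eta>' where "\<eta>' = \<eta> / 2"
  have \<eta>': "\<eta>' > 0" using assms by (simp add: \<eta>'_def)
  let ?\<theta> = "max_I_YU (joint S W) R + \<eta>'"
  let ?T = "{z :: (real^'x) \<times> real \<times> real. fst z = law_vec S \<and> fst (snd z) \<le> R \<and> ?\<theta> \<le> snd (snd z)}"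
  have "closed ?T"
    by (intro closed_Collect_conj closed_Collect_eq closed_Collect_le continuous_intros)
  moreover have "convex ?T"
  proof (rule convexI)
    fix p q :: "(real^'x) \<times> real \<times> real" and s t :: real
    assume *: "p \<in> ?T" "q \<in> ?T" "0 \<le> s" "0 \<le> t" "s + t = 1"
    have "s * fst (snd p) + t * fst (snd q) \<le> s * R + t * R"
      using * by (intro add_mono mult_left_mono) auto
    moreover have "s * ?\<theta> + t * ?\<theta> \<le> s * snd (snd p) + t * snd (snd q)"
      using * by (intro add_mono mult_left_mono) auto
    ultimately show "s *\<^sub>R p + t *\<^sub>R q \<in> ?T"
      using * by (simp flip: distrib_right scaleR_add_left)
  qed
  moreover have "region S W \<inter> ?T = {}"
  proof -
    have False if "(law_vec S, a, b) \<in> region S W" "a \<le> R" "?\<theta> \<le> b" for a b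
      using region_le_max[OF that(1,2)] that(3) \<eta>' by simp
    then show ?thesis by force
  qed
  ultimately obtain n \<beta> where n: "\<And>z. z \<in> region S W \<Longrightarrow> n \<bullet> z < \<beta>" "\<And>z. z \<in> ?T \<Longrightarrow> \<beta> < n \<bullet> z"
    using separating_hyperplane_compact_closed[of "region S W" ?T] convex_region[of S W] compact_region[of S W]
      region_origin[of S W] by blast
  obtain g0 \<alpha> \<gamma> where n_eq: "n = (g0, \<alpha>, \<gamma>)" by (cases n) auto
  have below: "g0 \<bullet> v + \<alpha> * a + \<gamma> * b < \<beta>" if "(v, a, b) \<in> region S W" for v a b
    using n(1)[OF that] by (simp add: n_eq)
  have above: "\<beta> < g0 \<bullet> law_vec S + \<alpha> * a + \<gamma> * b" if "a \<le> R" "?\<theta> \<le> b" for a b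
    using n(2)[of "(law_vec S, a, b)"] that by (simp add: n_eq)
  let ?c = "g0 \<bullet> law_vec S"
  \<comment> \<open>\<open>?T\<close> contains points with arbitrarily small rate coordinate and
    arbitrarily large last coordinate; being bounded below on them fixes the signs of
    \<open>\<alpha>\<close> and \<open>\<gamma>\<close>.\<close>
  have \<alpha>: "\<alpha> \<le> 0"
  proof (rule ccontr)
    assume "\<not> \<alpha> \<le> 0"
    define a where "a = min R ((\<beta> - ?c - \<gamma> * ?\<theta>) / \<alpha>)"
    have "\<alpha> * a \<le> \<beta> - ?c - \<gamma> * ?\<theta>"
      using \<open>\<not> \<alpha> \<le> 0\<close> by (auto simp: a_def min_def field_simps)
    moreover have "a \<le> R" by (simp add: a_def)
    ultimately show False using above[of a ?\<theta>] by simp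
  qed
  have \<gamma>0: "\<gamma> \<ge> 0"
  proof (rule ccontr)
    assume "\<not> \<gamma> \<ge> 0"
    define b where "b = max ?\<theta> ((\<beta> - ?c - \<alpha> * R) / \<gamma>)"
    have "\<gamma> * b \<le> \<gamma> * ((\<beta> - ?c - \<alpha> * R) / \<gamma>)"
      using \<open>\<not> \<gamma> \<ge> 0\<close> by (intro mult_left_mono_neg) (auto simp: b_def)
    also have "\<dots> = \<beta> - ?c - \<alpha> * R" using \<open>\<not> \<gamma> \<ge> 0\<close> by simp
    finally have "\<gamma> * b \<le> \<beta> - ?c - \<alpha> * R" .
    moreover have "?\<theta> \<le> b" by (simp add: b_def)
    ultimately show False using above[of R b] by simp
  qed
  \<comment> \<open>A vertical hyperplane is excluded by the point of the constant kernel: it lies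
    over \<open>law_vec S\<close> with rate 0, and separation is strict.\<close>
  have \<gamma>: "\<gamma> > 0"
  proof (rule ccontr)
    assume "\<not> \<gamma> > 0"
    then have "\<gamma> = 0" using \<gamma>0 by simp
    then have "?c < ?c + \<alpha> * R"
      using below[OF region_origin] above[of R ?\<theta>] by simp
    moreover have "\<alpha> * R \<le> 0" using \<alpha> R by (simp add: mult_nonpos_nonneg)
    ultimately show False by simp
  qed
  \<comment> \<open>The slope \<open>\<alpha>\<close> may be 0, but the price is to be a divisor
    later. Raising it by \<open>\<epsilon>\<close> costs
    \<open>\<epsilon> * R \<le> \<eta>'\<close>.\<close>
  define \<epsilon> where "\<epsilon> = \<eta>' / (R + 1)"
  have \<epsilon>: "\<epsilon> > 0" "\<epsilon> * R \<le> \<eta>'" using \<eta>' R by (auto simp: \<epsilon>_def field_simps)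
  define lam where "lam = - \<alpha> / \<gamma> + \<epsilon>"
  \<comment> \<open>The entries of a law sum to 1, so the constant of the hyperplane can be absorbed
    into the linear term.\<close>
  define g where "g x = \<beta> / \<gamma> - g0 $ x / \<gamma>" for x
  have "lam > 0" using divide_nonpos_pos[OF \<alpha> \<gamma>] \<epsilon> by (simp add: lam_def)
  moreover have "DY S W v \<le> lam * DX S v + (\<Sum>x\<in>UNIV. v $ x * g x)" if v: "v \<in> simplex_on S" for v
  proof -
    have s1: "(\<Sum>x\<in>UNIV. v $ x) = 1" using v by (simp add: simplex_on_def)
    have DX: "DX S v \<ge> 0"
      using log_sum_inequality[of UNIV "\<lambda>x. v $ x" "pmf S"] v s1 by (simp add: simplex_on_def DX_def)
    have "g0 \<bullet> v + \<alpha> * DX S v + \<gamma> * DY S W v < \<beta>"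
      by (rule below[OF simplex_in_region[OF v]])
    then have "(g0 \<bullet> v + \<alpha> * DX S v + \<gamma> * DY S W v) / \<gamma> < \<beta> / \<gamma>"
      using \<gamma> by (rule divide_strict_right_mono)
    then have "DY S W v < \<beta> / \<gamma> - (g0 \<bullet> v) / \<gamma> + (- \<alpha> / \<gamma>) * DX S v"
      using \<gamma> by (simp add: add_divide_distrib)
    moreover have "(\<Sum>x\<in>UNIV. v $ x * g x) = \<beta> / \<gamma> - (g0 \<bullet> v) / \<gamma>"
    proof -
      have "(\<Sum>x\<in>UNIV. v $ x * g x) = (\<Sum>x\<in>UNIV. v $ x * (\<beta> / \<gamma>)) - (\<Sum>x\<in>UNIV. g0 $ x * v $ x / \<gamma>)"
        by (simp add: g_def algebra_simps sum_subtractf)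
      then show ?thesis by (simp add: s1 inner_vec_def flip: sum_distrib_right sum_divide_distrib)
    qed
    moreover have "0 \<le> \<epsilon> * DX S v" using \<epsilon> DX by simp
    ultimately show ?thesis by (simp add: lam_def algebra_simps)
  qed
  moreover have "(\<Sum>x\<in>UNIV. pmf S x * g x) \<le> max_I_YU (joint S W) R + \<eta> - lam * R"
  proof -
    have "(\<Sum>x\<in>UNIV. pmf S x * g x) = (\<Sum>x\<in>UNIV. pmf S x * (\<beta> / \<gamma>)) - (\<Sum>x\<in>UNIV. g0 $ x * law_vec S $ x / \<gamma>)"
      by (simp add: g_def algebra_simps sum_subtractf)
    also have "\<dots> = \<beta> / \<gamma> - ?c / \<gamma>"
      by (simp only: sum_pmf_UNIV inner_vec_def inner_real_def flip: sum_distrib_right sum_divide_distrib)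
    also have "\<dots> \<le> ?\<theta> + \<alpha> / \<gamma> * R"
    proof -
      have "\<beta> - ?c \<le> \<alpha> * R + \<gamma> * ?\<theta>" using above[of R ?\<theta>] by simp
      then have "(\<beta> - ?c) / \<gamma> \<le> (\<alpha> * R + \<gamma> * ?\<theta>) / \<gamma>"
        using \<gamma> by (intro divide_right_mono) auto
      then show ?thesis using \<gamma> by (simp add: diff_divide_distrib add_divide_distrib)
    qed
    also have "\<dots> = max_I_YU (joint S W) R + \<eta>' + \<epsilon> * R - lam * R" by (simp add: lam_def algebra_simps)
    also have "\<dots> \<le> max_I_YU (joint S W) R + \<eta> - lam * R" using \<epsilon>(2) by (simp add: \<eta>'_def)
    finally show ?thesis .
  qed
  ultimately show ?thesis using that by blast
qed

section \<open>The image size inequality\<close>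

fun kpow :: "('a \<Rightarrow> 'b pmf) \<Rightarrow> 'a list \<Rightarrow> 'b list pmf" where
  "kpow K [] = return_pmf []"
| "kpow K (x # xs) = bind_pmf (K x) (\<lambda>y. map_pmf (Cons y) (kpow K xs))"

lemma finite_set_kpow: "(\<And>x. finite (set_pmf (K x))) \<Longrightarrow> finite (set_pmf (kpow K xs))"
  by (induction xs) auto

lemma in_set_kpow: "ys \<in> set_pmf (kpow K xs) \<longleftrightarrow> list_all2 (\<lambda>x y. y \<in> set_pmf (K x)) xs ys"
  by (induction xs arbitrary: ys) (auto simp: list_all2_Cons1)

lemma expect_kpow_Cons:
  assumes "\<And>x. finite (set_pmf (K x))"
  shows "expect (kpow K (x # xs)) f = expect (K x) (\<lambda>y. expect (kpow K xs) (\<lambda>ys. f (y # ys)))"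
  using assms by (simp add: expect_bind expect_map finite_set_kpow)

lemma pmf_kpow_Cons: "pmf (kpow K (x # xs)) (y # ys) = pmf (K x) y * pmf (kpow K xs) ys"
proof -
  have "kpow K (x # xs) = map_pmf (\<lambda>(y, ys). y # ys) (pair_pmf (K x) (kpow K xs))"
    by (simp add: pair_pmf_def map_pmf_def bind_assoc_pmf bind_return_pmf)
  also have "pmf \<dots> (y # ys) = pmf (pair_pmf (K x) (kpow K xs)) (y, ys)"
    using pmf_map_inj'[of "\<lambda>(y, ys). y # ys" "pair_pmf (K x) (kpow K xs)" "(y, ys)"] by (simp add: inj_on_def)
  finally show ?thesis by (simp add: pmf_pair)
qed

lemma iid_pair_joint:
  "iid_pair n (joint S W) = bind_pmf (replicate_pmf n S) (\<lambda>xs. map_pmf (\<lambda>ys. (ys, xs)) (kpow W xs))"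
proof (induction n)
  case 0
  show ?case by (simp add: iid_pair_def bind_return_pmf)
next
  case (Suc n)
  have "iid_pair (Suc n) (joint S W) = bind_pmf (joint S W) (\<lambda>z. bind_pmf (iid_pair n (joint S W))
      (\<lambda>zs. return_pmf (fst z # fst zs, snd z # snd zs)))"
    by (simp add: iid_pair_def map_bind_pmf bind_map_pmf map_pmf_def bind_assoc_pmf bind_return_pmf)
  also have "\<dots> = bind_pmf S (\<lambda>x. bind_pmf (W x) (\<lambda>y. bind_pmf (replicate_pmf n S) (\<lambda>xs.
      bind_pmf (kpow W xs) (\<lambda>ys. return_pmf (y # ys, x # xs)))))"
    unfolding Suc.IH by (simp add: joint_def map_pmf_def bind_assoc_pmf bind_return_pmf)
  also have "\<dots> = bind_pmf S (\<lambda>x. bind_pmf (replicate_pmf n S) (\<lambda>xs. bind_pmf (W x) (\<lambda>y.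
      bind_pmf (kpow W xs) (\<lambda>ys. return_pmf (y # ys, x # xs)))))"
    by (subst bind_commute_pmf) (rule refl)
  also have "\<dots> = bind_pmf (replicate_pmf (Suc n) S) (\<lambda>xs. map_pmf (\<lambda>ys. (ys, xs)) (kpow W xs))"
    by (simp add: map_pmf_def bind_assoc_pmf bind_return_pmf)
  finally show ?case .
qed

lemma map_replicate_pmf: "map_pmf (map f) (replicate_pmf n p) = replicate_pmf n (map_pmf f p)"
proof (induction n)
  case (Suc n)
  then show ?case by (simp add: map_bind_pmf bind_map_pmf Suc.IH[symmetric])
qed simp

lemma map_fst_iid_pair: "map_pmf fst (iid_pair n P) = replicate_pmf n (map_pmf fst P)"
  by (simp add: iid_pair_def pmf.map_comp o_def flip: map_replicate_pmf)

lemma map_snd_iid_pair: "map_pmf snd (iid_pair n P) = replicate_pmf n (map_pmf snd P)"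
  by (simp add: iid_pair_def pmf.map_comp o_def flip: map_replicate_pmf)

lemma replicate_bind_kpow: "replicate_pmf n (bind_pmf S W) = bind_pmf (replicate_pmf n S) (kpow W)"
  using map_fst_iid_pair[of n "joint S W"]
  by (simp add: iid_pair_joint map_bind_pmf pmf.map_comp o_def)

section \<open>Functional form of the entropy inequality and its tensorization\<close>

lemma expect_pos:
  assumes "finite (set_pmf p)" "\<And>x. x \<in> set_pmf p \<Longrightarrow> 0 < f x"
  shows "0 < expect p f"
  unfolding expect_def using assms set_pmf_not_empty[of p]
  by (intro sum_pos) (auto simp: pmf_positive)

lemma exp_expect_le:
  assumes "finite (set_pmf p)"
  shows "exp (expect p f) \<le> expect p (\<lambda>x. exp (f x))"
proof -
  let ?m = "expect p f"
  have "exp ?m = expect p (\<lambda>x. exp ?m * (1 + (f x - ?m)))"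
    by (simp add: expect_cmult expect_add expect_diff assms)
  also have "\<dots> \<le> expect p (\<lambda>x. exp (f x))"
  proof (rule expect_mono)
    fix x
    have "exp ?m * (1 + (f x - ?m)) \<le> exp ?m * exp (f x - ?m)"
      by (intro mult_left_mono exp_ge_add_one_self) auto
    then show "exp ?m * (1 + (f x - ?m)) \<le> exp (f x)" by (simp flip: exp_add)
  qed
  finally show ?thesis .
qed

text \<open>Hoelder's inequality for a family of functions with weights \<open>q\<close>. After
  dividing each function by its mean \<open>Z y\<close>, the convexity of exp bounds the weighted
  product by the weighted sum, whose mean is 1.\<close>

lemma expect_exp_log_convex:
  assumes p: "finite (set_pmf p)" and q: "finite (set_pmf q)"
  shows "expect p (\<lambda>x. exp (expect q (\<lambda>y. \<psi> y x))) \<le> exp (expect q (\<lambda>y. ln (expect p (\<lambda>x. exp (\<psi> y x)))))"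
proof -
  define Z where "Z y = expect p (\<lambda>x. exp (\<psi> y x))" for y
  have Z: "Z y > 0" for y unfolding Z_def by (intro expect_pos p) auto
  let ?z = "expect q (\<lambda>y. ln (Z y))"
  have "expect p (\<lambda>x. exp (expect q (\<lambda>y. \<psi> y x))) = exp ?z * expect p (\<lambda>x. exp (expect q (\<lambda>y. \<psi> y x - ln (Z y))))"
    unfolding expect_cmult[symmetric] by (simp add: expect_diff flip: exp_add)
  also have "expect p (\<lambda>x. exp (expect q (\<lambda>y. \<psi> y x - ln (Z y)))) \<le>
      expect p (\<lambda>x. expect q (\<lambda>y. exp (\<psi> y x - ln (Z y))))"
    by (intro expect_mono exp_expect_le q)
  also have "\<dots> = expect q (\<lambda>y. expect p (\<lambda>x. exp (\<psi> y x - ln (Z y))))"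
    by (rule expect_swap)
  also have "\<dots> = expect q (\<lambda>y. 1)"
  proof (rule expect_cong)
    fix y
    have "expect p (\<lambda>x. exp (\<psi> y x - ln (Z y))) = expect p (\<lambda>x. (1 / Z y) * exp (\<psi> y x))"
      using Z[of y] by (simp add: exp_diff)
    also have "\<dots> = (1 / Z y) * Z y" by (simp only: expect_cmult Z_def)
    also have "\<dots> = 1" using Z[of y] by simp
    finally show "expect p (\<lambda>x. exp (\<psi> y x - ln (Z y))) = 1" .
  qed
  also have "\<dots> = 1" using q by simp
  finally show ?thesis by (simp add: Z_def)
qed

lemma expect_UNIV: "expect p f = (\<Sum>x\<in>UNIV. pmf p x * f x)" for p :: "'a::finite pmf"
  by (rule expect_superset) auto

text \<open>The price inequality is evaluated at one law only, the one tilted by the exponent on the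
  left. There \<open>DX\<close> is known exactly, and \<open>DY\<close> is bounded below by its
  variational formula with test function \<open>ln f\<close>.\<close>

lemma functional_inequality:
  fixes S :: "'x::finite pmf" and W :: "'x \<Rightarrow> 'y::finite pmf"
  assumes lam: "lam > 0"
    and price: "\<And>v. v \<in> simplex_on S \<Longrightarrow> DY S W v \<le> lam * DX S v + (\<Sum>x\<in>UNIV. v $ x * g x)"
    and f: "\<And>y. f y > 0"
  shows "expect S (\<lambda>x. exp ((expect (W x) (\<lambda>y. ln (f y)) - g x) / lam)) \<le> exp (ln (expect (bind_pmf S W) f) / lam)"
proof -
  define a where "a x = (expect (W x) (\<lambda>y. ln (f y)) - g x) / lam" for x
  define Z where "Z = expect S (\<lambda>x. exp (a x))"
  define F where "F = expect (bind_pmf S W) f"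
  have Z: "Z > 0" unfolding Z_def by (intro expect_pos) auto
  have F: "F > 0" unfolding F_def using f by (intro expect_pos) auto
  \<comment> \<open>The Gibbs law of \<open>a\<close>: it maximizes the mean of \<open>a\<close>
    minus \<open>DX\<close>, with maximum \<open>ln Z\<close>.\<close>
  define v :: "real^'x" where "v = (\<chi> x. pmf S x * exp (a x) / Z)"
  have sv: "(\<Sum>x\<in>UNIV. v $ x) = 1"
    using Z by (simp add: v_def Z_def expect_UNIV flip: sum_divide_distrib)
  then have v: "v \<in> simplex_on S" using Z by (simp add: simplex_on_def) (simp add: v_def)
  have "DX S v = (\<Sum>x\<in>UNIV. v $ x * (a x - ln Z))"
    unfolding DX_def
  proof (rule sum.cong[OF refl])
    fix x
    show "v $ x * ln (v $ x / pmf S x) = v $ x * (a x - ln Z)"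
    proof (cases "pmf S x = 0")
      case False
      then have "v $ x / pmf S x = exp (a x) / Z" by (simp add: v_def)
      then show ?thesis using Z by (simp add: ln_div)
    qed (simp add: v_def)
  qed
  also have "\<dots> = (\<Sum>x\<in>UNIV. v $ x * a x) - ln Z"
    by (simp add: right_diff_distrib sum_subtractf sv flip: sum_distrib_right)
  finally have DX: "DX S v = (\<Sum>x\<in>UNIV. v $ x * a x) - ln Z" .
  have so: "(\<Sum>y\<in>UNIV. outlaw W v y) = 1"
    unfolding outlaw_def by (subst sum.swap) (simp add: sv flip: sum_distrib_left)
  have zero: "outlaw W v y = 0" if "pmf (bind_pmf S W) y = 0" for y
  proof -
    have "pmf S x * pmf (W x) y = 0" for x
      using that unfolding pmf_bind_UNIV by (subst (asm) sum_nonneg_eq_0_iff) auto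
    then have "v $ x * pmf (W x) y = 0" for x by (auto simp: v_def)
    then show ?thesis unfolding outlaw_def by (intro sum.neutral) blast
  qed
  \<comment> \<open>The Donsker-Varadhan bound, obtained from the log sum inequality with the output
    law reweighted by \<open>f\<close>.\<close>
  have "(\<Sum>y\<in>UNIV. outlaw W v y) * ln ((\<Sum>y\<in>UNIV. outlaw W v y) / (\<Sum>y\<in>UNIV. pmf (bind_pmf S W) y * f y)) \<le>
      (\<Sum>y\<in>UNIV. outlaw W v y * ln (outlaw W v y / (pmf (bind_pmf S W) y * f y)))"
  proof (rule log_sum_inequality)
    fix y
    show "0 \<le> outlaw W v y" by (rule outlaw_nonneg[OF v])
    show "0 \<le> pmf (bind_pmf S W) y * f y" using f[of y] by simp
    show "outlaw W v y = 0" if "pmf (bind_pmf S W) y * f y = 0" using that zero[of y] f[of y] by simp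
  qed simp
  also have "\<dots> = (\<Sum>y\<in>UNIV. outlaw W v y * ln (outlaw W v y / pmf (bind_pmf S W) y) - outlaw W v y * ln (f y))"
  proof (rule sum.cong[OF refl])
    fix y
    show "outlaw W v y * ln (outlaw W v y / (pmf (bind_pmf S W) y * f y)) =
        outlaw W v y * ln (outlaw W v y / pmf (bind_pmf S W) y) - outlaw W v y * ln (f y)"
    proof (cases "outlaw W v y = 0")
      case False
      then have "pmf (bind_pmf S W) y \<noteq> 0" using zero by blast
      then have "ln (outlaw W v y / pmf (bind_pmf S W) y / f y) = ln (outlaw W v y / pmf (bind_pmf S W) y) - ln (f y)"
        using False f[of y] by (subst ln_div) auto
      then show ?thesis by (simp add: right_diff_distrib divide_divide_eq_left)
    qed simp
  qed
  also have "\<dots> = DY S W v - (\<Sum>y\<in>UNIV. outlaw W v y * ln (f y))"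
    by (simp add: DY_def sum_subtractf)
  also have "(\<Sum>y\<in>UNIV. outlaw W v y * ln (f y)) = (\<Sum>x\<in>UNIV. v $ x * expect (W x) (\<lambda>y. ln (f y)))"
    unfolding outlaw_def expect_UNIV sum_distrib_left sum_distrib_right
    by (subst sum.swap) (simp add: mult.assoc)
  finally have "- ln F \<le> DY S W v - (\<Sum>x\<in>UNIV. v $ x * expect (W x) (\<lambda>y. ln (f y)))"
    using F by (simp add: so F_def expect_UNIV ln_div)
  also have "\<dots> \<le> lam * DX S v + (\<Sum>x\<in>UNIV. v $ x * g x) - (\<Sum>x\<in>UNIV. v $ x * expect (W x) (\<lambda>y. ln (f y)))"
    using price[OF v] by simp
  also have "\<dots> = - lam * ln Z"
  proof -
    have "v $ x * expect (W x) (\<lambda>y. ln (f y)) = lam * (v $ x * a x) + v $ x * g x" for x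
      using lam by (simp add: a_def field_simps)
    then have "(\<Sum>x\<in>UNIV. v $ x * expect (W x) (\<lambda>y. ln (f y))) =
        lam * (\<Sum>x\<in>UNIV. v $ x * a x) + (\<Sum>x\<in>UNIV. v $ x * g x)"
      by (simp add: sum.distrib sum_distrib_left)
    then show ?thesis by (simp add: DX algebra_simps)
  qed
  finally have "ln Z \<le> ln F / lam" using lam by (simp add: field_simps)
  then have "exp (ln Z) \<le> exp (ln F / lam)" by (simp only: exp_le_cancel_iff)
  then have "Z \<le> exp (ln F / lam)" using Z by (simp only: exp_ln)
  then show ?thesis by (simp add: Z_def a_def F_def)
qed

text \<open>Induction on the first letter. Hoelder's inequality moves the average over the first
  output letter out of the expectation over the remaining inputs; the induction hypothesis then
  applies to each section \<open>f (y # ys)\<close>, and the one-letter inequality to the function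
  \<open>F\<close> of first letters.\<close>

lemma functional_inequality_tensor:
  fixes S :: "'x::finite pmf" and W :: "'x \<Rightarrow> 'y::finite pmf"
  assumes lam: "lam > 0"
    and price: "\<And>v. v \<in> simplex_on S \<Longrightarrow> DY S W v \<le> lam * DX S v + (\<Sum>x\<in>UNIV. v $ x * g x)"
    and f: "\<And>ys. f ys > 0"
  shows "expect (replicate_pmf n S) (\<lambda>xs. exp ((expect (kpow W xs) (\<lambda>ys. ln (f ys)) - sum_list (map g xs)) / lam))
      \<le> exp (ln (expect (replicate_pmf n (bind_pmf S W)) f) / lam)"
  using f
proof (induction n arbitrary: f)
  case 0
  then show ?case by simp
next
  case (Suc n)
  have fin: "finite (set_pmf S)" "finite (set_pmf (bind_pmf S W))" "\<And>x. finite (set_pmf (W x))" by auto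
  define F where "F y = expect (replicate_pmf n (bind_pmf S W)) (\<lambda>ys. f (y # ys))" for y
  have F: "F y > 0" for y unfolding F_def using Suc.prems
    by (intro expect_pos finite_set_replicate_pmf) auto
  define \<psi> where "\<psi> y xs = (expect (kpow W xs) (\<lambda>ys. ln (f (y # ys))) - sum_list (map g xs)) / lam" for y xs
  have "expect (replicate_pmf (Suc n) S) (\<lambda>xs. exp ((expect (kpow W xs) (\<lambda>ys. ln (f ys)) - sum_list (map g xs)) / lam))
     = expect S (\<lambda>x. expect (replicate_pmf n S) (\<lambda>xs. exp ((expect (kpow W (x # xs)) (\<lambda>ys. ln (f ys)) - (g x + sum_list (map g xs))) / lam)))"
    by (subst expect_replicate_Suc[OF fin(1)]) (simp del: kpow.simps)
  also have "\<dots> = expect S (\<lambda>x. exp (- g x / lam) * expect (replicate_pmf n S) (\<lambda>xs. exp (expect (W x) (\<lambda>y. \<psi> y xs))))"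
  proof (rule expect_cong)
    fix x
    have "exp ((expect (kpow W (x # xs)) (\<lambda>ys. ln (f ys)) - (g x + sum_list (map g xs))) / lam) =
        exp (- g x / lam) * exp (expect (W x) (\<lambda>y. \<psi> y xs))" for xs
    proof -
      have "expect (W x) (\<lambda>y. \<psi> y xs) = expect (W x) (\<lambda>y. (1 / lam) * (expect (kpow W xs) (\<lambda>ys. ln (f (y # ys))) - sum_list (map g xs)))"
        by (simp add: \<psi>_def)
      also have "\<dots> = (1 / lam) * (expect (kpow W (x # xs)) (\<lambda>ys. ln (f ys)) - sum_list (map g xs))"
        unfolding expect_cmult expect_diff expect_kpow_Cons[OF fin(3)] by simp
      finally show ?thesis by (simp add: diff_divide_distrib add_divide_distrib flip: exp_add)
    qed
    then show "expect (replicate_pmf n S) (\<lambda>xs. exp ((expect (kpow W (x # xs)) (\<lambda>ys. ln (f ys)) - (g x + sum_list (map g xs))) / lam))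
       = exp (- g x / lam) * expect (replicate_pmf n S) (\<lambda>xs. exp (expect (W x) (\<lambda>y. \<psi> y xs)))"
      by (simp only: expect_cmult)
  qed
  also have "\<dots> \<le> expect S (\<lambda>x. exp ((expect (W x) (\<lambda>y. ln (F y)) - g x) / lam))"
  proof (rule expect_mono)
    fix x
    have "expect (replicate_pmf n S) (\<lambda>xs. exp (expect (W x) (\<lambda>y. \<psi> y xs)))
        \<le> exp (expect (W x) (\<lambda>y. ln (expect (replicate_pmf n S) (\<lambda>xs. exp (\<psi> y xs)))))"
      by (intro expect_exp_log_convex finite_set_replicate_pmf fin)
    also have "\<dots> \<le> exp (expect (W x) (\<lambda>y. (1 / lam) * ln (F y)))"
    proof (subst exp_le_cancel_iff, rule expect_mono)
      fix y
      have pos: "0 < expect (replicate_pmf n S) (\<lambda>xs. exp (\<psi> y xs))"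
        by (intro expect_pos finite_set_replicate_pmf fin) auto
      have "expect (replicate_pmf n S) (\<lambda>xs. exp (\<psi> y xs)) \<le> exp (ln (F y) / lam)"
        unfolding \<psi>_def F_def by (rule Suc.IH) (rule Suc.prems)
      then have "ln (expect (replicate_pmf n S) (\<lambda>xs. exp (\<psi> y xs))) \<le> ln (exp (ln (F y) / lam))"
        using pos by (subst ln_le_cancel_iff) auto
      then show "ln (expect (replicate_pmf n S) (\<lambda>xs. exp (\<psi> y xs))) \<le> (1 / lam) * ln (F y)" by simp
    qed
    finally have "exp (- g x / lam) * expect (replicate_pmf n S) (\<lambda>xs. exp (expect (W x) (\<lambda>y. \<psi> y xs)))
        \<le> exp (- g x / lam) * exp ((1 / lam) * expect (W x) (\<lambda>y. ln (F y)))"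
      unfolding expect_cmult by (rule mult_left_mono) simp
    then show "exp (- g x / lam) * expect (replicate_pmf n S) (\<lambda>xs. exp (expect (W x) (\<lambda>y. \<psi> y xs)))
        \<le> exp ((expect (W x) (\<lambda>y. ln (F y)) - g x) / lam)"
      by (simp add: diff_divide_distrib flip: exp_add)
  qed
  also have "\<dots> \<le> exp (ln (expect (bind_pmf S W) F) / lam)"
    by (intro functional_inequality lam price F)
  also have "expect (bind_pmf S W) F = expect (replicate_pmf (Suc n) (bind_pmf S W)) f"
    unfolding expect_replicate_Suc[OF fin(2)] F_def[abs_def] ..
  finally show ?case .
qed

section \<open>Hamming distance from a set and its concentration\<close>

text \<open>Meaningful only for lists of equal length.\<close>

fun ham :: "'a list \<Rightarrow> 'a list \<Rightarrow> real" where
  "ham (x # xs) (y # ys) = of_bool (x \<noteq> y) + ham xs ys"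
| "ham _ _ = 0"

lemma ham_nonneg: "0 \<le> ham xs ys"
  by (induction xs ys rule: ham.induct) auto

lemma ham_refl [simp]: "ham xs xs = 0"
  by (induction xs) auto

lemma ham_sym: "ham xs ys = ham ys xs"
  by (induction xs ys rule: ham.induct) auto

lemma ham_triangle:
  "length xs = length ys \<Longrightarrow> length ys = length zs \<Longrightarrow> ham xs zs \<le> ham xs ys + ham ys zs"
  by (induction xs ys zs rule: list_induct3) (auto split: if_splits simp: of_bool_def)

lemma expect_square_deviation:
  assumes "finite (set_pmf p)"
  shows "expect p (\<lambda>x. (f x - expect p f)\<^sup>2) = expect p (\<lambda>x. (f x)\<^sup>2) - (expect p f)\<^sup>2"
proof -
  let ?m = "expect p f"
  have "expect p (\<lambda>x. (f x - ?m)\<^sup>2) = expect p (\<lambda>x. (f x)\<^sup>2 - (2 * ?m) * f x + ?m\<^sup>2)"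
    by (simp add: power2_diff algebra_simps)
  also have "\<dots> = expect p (\<lambda>x. (f x)\<^sup>2) - ?m\<^sup>2"
    unfolding expect_add expect_diff expect_cmult using assms by (simp add: power2_eq_square)
  finally show ?thesis .
qed

text \<open>Decomposition of the variance along the first letter: given it, the induction hypothesis
  bounds the variance of the rest, and the conditional means \<open>g\<close> differ by at most 1
  from each other.\<close>

lemma lipschitz_variance:
  fixes W :: "'x \<Rightarrow> 'y pmf"
  assumes fin: "\<And>x. finite (set_pmf (W x))"
    and lip: "\<And>ys zs. length ys = length xs \<Longrightarrow> length zs = length xs \<Longrightarrow> \<bar>f ys - f zs\<bar> \<le> ham ys zs"
  shows "expect (kpow W xs) (\<lambda>ys. (f ys)\<^sup>2) - (expect (kpow W xs) f)\<^sup>2 \<le> real (length xs)"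
  using lip
proof (induction xs arbitrary: f)
  case Nil
  then show ?case by simp
next
  case (Cons x xs)
  define g where "g y = expect (kpow W xs) (\<lambda>ys. f (y # ys))" for y
  let ?m = "expect (W x) g"
  have fk: "finite (set_pmf (kpow W xs))" using fin by (rule finite_set_kpow)
  have len: "length ys = length xs" if "ys \<in> set_pmf (kpow W xs)" for ys
    using that by (auto simp: in_set_kpow dest: list_all2_lengthD)
  have "expect (kpow W xs) (\<lambda>ys. (f (y # ys))\<^sup>2) - (g y)\<^sup>2 \<le> real (length xs)" for y
    unfolding g_def
  proof (rule Cons.IH)
    fix ys zs :: "'y list" assume "length ys = length xs" "length zs = length xs"
    then show "\<bar>f (y # ys) - f (y # zs)\<bar> \<le> ham ys zs" using Cons.prems[of "y # ys" "y # zs"] by simp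
  qed
  then have "expect (kpow W (x # xs)) (\<lambda>ys. (f ys)\<^sup>2) \<le> expect (W x) (\<lambda>y. (g y)\<^sup>2 + real (length xs))"
    unfolding expect_kpow_Cons[OF fin] by (intro expect_mono) (simp add: algebra_simps)
  also have "\<dots> = (expect (W x) (\<lambda>y. (g y)\<^sup>2) - ?m\<^sup>2) + ?m\<^sup>2 + real (length xs)"
    by (simp add: expect_add fin)
  also have "expect (W x) (\<lambda>y. (g y)\<^sup>2) - ?m\<^sup>2 = expect (W x) (\<lambda>y. (g y - ?m)\<^sup>2)"
    by (simp add: expect_square_deviation fin)
  also have "\<dots> \<le> expect (W x) (\<lambda>y. 1)"
  proof (rule expect_mono)
    fix y
    have close: "\<bar>g y - g z\<bar> \<le> 1" for z
    proof -
      have *: "f (y # ys) - f (z # ys) \<le> 1 \<and> - 1 \<le> f (y # ys) - f (z # ys)" if "ys \<in> set_pmf (kpow W xs)" for ys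
        using Cons.prems[of "y # ys" "z # ys"] len[OF that] by (auto simp: of_bool_def split: if_splits)
      have "g y - g z = expect (kpow W xs) (\<lambda>ys. f (y # ys) - f (z # ys))" by (simp add: g_def expect_diff)
      moreover have "\<dots> \<le> expect (kpow W xs) (\<lambda>_. 1)" using * by (intro expect_mono) auto
      moreover have "expect (kpow W xs) (\<lambda>_. - 1) \<le> expect (kpow W xs) (\<lambda>ys. f (y # ys) - f (z # ys))"
        using * by (intro expect_mono) auto
      ultimately show ?thesis using fk by simp
    qed
    have "g y - ?m = expect (W x) (\<lambda>z. g y - g z)" by (simp add: expect_diff fin)
    moreover have "\<dots> \<le> expect (W x) (\<lambda>_. 1)" by (rule expect_mono, use close in \<open>auto simp: abs_le_iff\<close>)
    moreover have "expect (W x) (\<lambda>_. - 1) \<le> expect (W x) (\<lambda>z. g y - g z)"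
      by (rule expect_mono, use close in \<open>auto simp: abs_le_iff\<close>) (smt (verit) close)
    ultimately have "\<bar>g y - ?m\<bar> \<le> 1" using fin by simp
    then show "(g y - ?m)\<^sup>2 \<le> 1" by (simp add: abs_square_le_1)
  qed
  finally have "expect (kpow W (x # xs)) (\<lambda>ys. (f ys)\<^sup>2) \<le> 1 + ?m\<^sup>2 + real (length xs)" using fin by simp
  moreover have "expect (kpow W (x # xs)) f = ?m" unfolding expect_kpow_Cons[OF fin] g_def[abs_def] ..
  ultimately show ?case by simp
qed

definition hdist :: "'a list set \<Rightarrow> 'a list \<Rightarrow> real" where
  "hdist B ys = Min (ham ys ` B)"

context
  fixes B :: "'y list set" and n :: nat
  assumes B: "finite B" "B \<noteq> {}" and len: "\<And>b. b \<in> B \<Longrightarrow> length b = n"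
begin

lemma hdist_attained: obtains b where "b \<in> B" "hdist B ys = ham ys b"
proof -
  have "Min (ham ys ` B) \<in> ham ys ` B" using B by (intro Min_in) auto
  then show ?thesis using that by (auto simp: hdist_def)
qed

lemma hdist_le: "b \<in> B \<Longrightarrow> hdist B ys \<le> ham ys b"
  unfolding hdist_def using B by (intro Min_le) auto

lemma hdist_nonneg: "0 \<le> hdist B ys"
  by (rule hdist_attained[of ys]) (simp add: ham_nonneg)

lemma hdist_member: "ys \<in> B \<Longrightarrow> hdist B ys = 0"
  using hdist_le[of ys ys] hdist_nonneg[of ys] by simp

lemma hdist_lipschitz:
  assumes "length ys = n" "length zs = n" shows "\<bar>hdist B ys - hdist B zs\<bar> \<le> ham ys zs"
proof -
  have *: "hdist B ys \<le> ham ys zs + hdist B zs" if "length ys = n" "length zs = n" for ys zs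
  proof -
    obtain b where b: "b \<in> B" "hdist B zs = ham zs b" by (rule hdist_attained)
    have "hdist B ys \<le> ham ys b" by (rule hdist_le[OF b(1)])
    also have "\<dots> \<le> ham ys zs + ham zs b" using that len[OF b(1)] by (intro ham_triangle) auto
    finally show ?thesis using b by simp
  qed
  from *[OF assms] *[OF assms(2,1)] show ?thesis by (simp add: ham_sym abs_le_iff)
qed

text \<open>On \<open>B\<close> the distance is 0 and thus misses its mean by the whole mean. If
  \<open>B\<close> has probability at least \<open>\<delta>\<close>, the variance bound n limits the
  squared mean to \<open>n / \<delta>\<close>.\<close>

lemma expect_hdist_le:
  fixes W :: "'x \<Rightarrow> 'y pmf"
  assumes fin: "\<And>x. finite (set_pmf (W x))" and xs: "length xs = n"
    and \<delta>: "\<delta> > 0" "\<delta> \<le> measure_pmf.prob (kpow W xs) B"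
  shows "expect (kpow W xs) (hdist B) \<le> sqrt (real n / \<delta>)"
proof -
  let ?p = "kpow W xs" and ?m = "expect (kpow W xs) (hdist B)"
  have fk: "finite (set_pmf ?p)" using fin by (rule finite_set_kpow)
  have "\<delta> * ?m\<^sup>2 \<le> ?m\<^sup>2 * measure_pmf.prob ?p B" using \<delta> by (simp add: mult.commute mult_right_mono)
  also have "\<dots> = expect ?p (\<lambda>ys. ?m\<^sup>2 * indicator B ys)" by (simp add: expect_cmult expect_indicator fk)
  also have "\<dots> \<le> expect ?p (\<lambda>ys. (hdist B ys - ?m)\<^sup>2)"
    by (rule expect_mono) (auto simp: indicator_def hdist_member)
  also have "\<dots> \<le> real n"
    using lipschitz_variance[OF fin, of xs "hdist B"] hdist_lipschitz xs
    by (simp add: expect_square_deviation[OF fk])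
  finally have "?m\<^sup>2 \<le> real n / \<delta>" using \<delta>(1) by (simp add: field_simps)
  then show ?thesis by (rule real_le_rsqrt)
qed

end

text \<open>Both sides are products over letters. For one letter the left side is at most
  \<open>pmf P y + \<kappa>\<close>, and the lower bound \<open>p\<close> turns this into a relative
  error \<open>\<kappa> / p\<close>.\<close>

lemma expect_exp_ham_le:
  fixes P :: "'y pmf"
  assumes fin: "finite (set_pmf P)" and "0 \<le> \<kappa>" and p: "p > 0" "\<And>y. y \<in> set_pmf P \<Longrightarrow> p \<le> pmf P y"
    and c: "exp (- c) = \<kappa>" and "set b \<subseteq> set_pmf P"
  shows "expect (replicate_pmf (length b) P) (\<lambda>ys. exp (- (c * ham ys b)))
      \<le> pmf (replicate_pmf (length b) P) b * (1 + \<kappa> / p) ^ length b"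
  using \<open>set b \<subseteq> set_pmf P\<close>
proof (induction b)
  case Nil
  then show ?case by simp
next
  case (Cons y b)
  let ?E = "expect (replicate_pmf (length b) P) (\<lambda>ys. exp (- (c * ham ys b)))"
  have y: "p \<le> pmf P y" using Cons.prems p by simp
  have split: "exp (- (c * ham (z # zs) (y # b))) = exp (- (c * of_bool (z \<noteq> y))) * exp (- (c * ham zs b))" for z zs
    by (simp add: distrib_left flip: exp_add)
  have "expect (replicate_pmf (length (y # b)) P) (\<lambda>ys. exp (- (c * ham ys (y # b)))) =
      expect P (\<lambda>z. exp (- (c * of_bool (z \<noteq> y))) * ?E)"
    unfolding list.size(4) add_0_right add_Suc_right expect_replicate_Suc[OF fin] split expect_cmult ..
  also have "\<dots> = ?E * expect P (\<lambda>z. exp (- (c * of_bool (z \<noteq> y))))"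
    by (subst expect_cmult[symmetric]) (simp add: mult.commute)
  also have "expect P (\<lambda>z. exp (- (c * of_bool (z \<noteq> y)))) \<le> expect P (\<lambda>z. indicator {y} z + \<kappa>)"
    using \<open>0 \<le> \<kappa>\<close> by (intro expect_mono) (auto simp: indicator_def c)
  also have "\<dots> = pmf P y + \<kappa>" by (simp add: expect_add expect_indicator fin measure_pmf_single)
  also have "\<dots> \<le> pmf P y * (1 + \<kappa> / p)"
  proof -
    have "\<kappa> * p \<le> \<kappa> * pmf P y" using y \<open>0 \<le> \<kappa>\<close> by (rule mult_left_mono)
    then show ?thesis using p(1) by (simp add: field_simps)
  qed
  finally have "expect (replicate_pmf (length (y # b)) P) (\<lambda>ys. exp (- (c * ham ys (y # b)))) \<le> ?E * (pmf P y * (1 + \<kappa> / p))"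
    by (simp add: mult_left_mono expect_nonneg)
  also have "\<dots> \<le> (pmf (replicate_pmf (length b) P) b * (1 + \<kappa> / p) ^ length b) * (pmf P y * (1 + \<kappa> / p))"
    using Cons.IH Cons.prems p(1) \<open>0 \<le> \<kappa>\<close> by (intro mult_right_mono) auto
  finally show ?case by (simp add: pmf_replicate_Cons[OF fin] mult_ac del: replicate_pmf.simps)
qed

text \<open>The indicator of \<open>B\<close> has no logarithm, so \<open>f\<close> is
  \<open>\<kappa>\<close> to the power of the distance. From each word of \<open>A\<close> the mean
  of \<open>ln f\<close> loses only a term of order square root of n. Conversely \<open>f\<close> is
  at most the sum over \<open>b\<close> of \<open>\<kappa>\<close> to the distance from
  \<open>b\<close>, so its mean exceeds the probability of \<open>B\<close> by a factor at most
  \<open>exp (n * \<kappa> / p)\<close>, with arbitrarily small exponent for small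
  \<open>\<kappa>\<close>.\<close>

lemma image_size:
  fixes S :: "'x::finite pmf" and W :: "'x \<Rightarrow> 'y::finite pmf"
  assumes lam: "lam > 0"
    and price: "\<And>v. v \<in> simplex_on S \<Longrightarrow> DY S W v \<le> lam * DX S v + (\<Sum>x\<in>UNIV. v $ x * g x)"
    and \<kappa>: "0 < \<kappa>" "\<kappa> < 1" and p: "p > 0" "\<And>y. y \<in> set_pmf (bind_pmf S W) \<Longrightarrow> p \<le> pmf (bind_pmf S W) y"
    and \<delta>: "\<delta> > 0"
    and A: "\<And>xs. xs \<in> A \<Longrightarrow> xs \<in> set_pmf (replicate_pmf n S) \<and> sum_list (map g xs) \<le> real n * t \<and>
        \<delta> \<le> measure_pmf.prob (kpow W xs) B"
    and pos: "measure_pmf.prob (replicate_pmf n S) A > 0"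
  shows "measure_pmf.prob (replicate_pmf n S) A powr lam *
      exp (- (real n * t) - real n * (\<kappa> / p) - ln (1 / \<kappa>) * sqrt (real n / \<delta>))
     \<le> measure_pmf.prob (replicate_pmf n (bind_pmf S W)) B"
proof -
  let ?Sn = "replicate_pmf n S" and ?Pn = "replicate_pmf n (bind_pmf S W)"
  let ?pA = "measure_pmf.prob ?Sn A"
  have fin: "finite (set_pmf ?Sn)" "finite (set_pmf ?Pn)" by (simp_all add: finite_set_replicate_pmf)
  \<comment> \<open>Cutting down to the support makes the set finite, as \<open>hdist\<close>
    requires, and makes the lower bound \<open>p\<close> available for every letter; no word of
    \<open>A\<close> notices the difference.\<close>
  define B' where "B' = B \<inter> set_pmf ?Pn"
  have finB: "finite B'" using fin by (simp add: B'_def)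
  have lenB: "\<And>b. b \<in> B' \<Longrightarrow> length b = n" by (simp add: B'_def in_set_replicate_pmf del: replicate_pmf.simps)
  have AB: "\<delta> \<le> measure_pmf.prob (kpow W xs) B'" "length xs = n" if "xs \<in> A" for xs
  proof -
    have "set_pmf (kpow W xs) \<subseteq> set_pmf ?Pn"
      using A[OF that] by (auto simp: replicate_bind_kpow simp del: replicate_pmf.simps)
    then have "measure_pmf.prob (kpow W xs) B = measure_pmf.prob (kpow W xs) B'"
      unfolding B'_def by (intro measure_pmf.finite_measure_eq_AE) (auto simp: AE_measure_pmf_iff)
    then show "\<delta> \<le> measure_pmf.prob (kpow W xs) B'" using A[OF that] by simp
    show "length xs = n" using A[OF that] by (simp add: in_set_replicate_pmf del: replicate_pmf.simps)
  qed
  have "A \<noteq> {}" using pos by auto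
  then have "B' \<noteq> {}" using AB(1) \<delta> by force
  note ctx = finB \<open>B' \<noteq> {}\<close> lenB
  define c where "c = ln (1 / \<kappa>)"
  have c: "exp (- c) = \<kappa>" "c > 0" using \<kappa> by (auto simp: c_def ln_div)
  define f where "f ys = exp (- (c * hdist B' ys))" for ys
  let ?s = "sqrt (real n / \<delta>)"
  define G where "G = expect ?Pn f"
  have G: "G > 0" unfolding G_def by (intro expect_pos fin) (simp add: f_def)
  have "?pA * exp ((- (c * ?s) - real n * t) / lam) = expect ?Sn (\<lambda>xs. exp ((- (c * ?s) - real n * t) / lam) * indicator A xs)"
    by (simp add: expect_cmult expect_indicator fin)
  also have "\<dots> \<le> expect ?Sn (\<lambda>xs. exp ((expect (kpow W xs) (\<lambda>ys. ln (f ys)) - sum_list (map g xs)) / lam))"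
  proof (rule expect_mono)
    fix xs
    show "exp ((- (c * ?s) - real n * t) / lam) * indicator A xs \<le>
        exp ((expect (kpow W xs) (\<lambda>ys. ln (f ys)) - sum_list (map g xs)) / lam)"
    proof (cases "xs \<in> A")
      case True
      have "expect (kpow W xs) (hdist B') \<le> ?s"
        using AB[OF True] \<delta> by (intro expect_hdist_le[OF ctx]) auto
      moreover have "expect (kpow W xs) (\<lambda>ys. ln (f ys)) = - c * expect (kpow W xs) (hdist B')"
        unfolding expect_cmult[symmetric] by (simp add: f_def)
      ultimately have "- (c * ?s) \<le> expect (kpow W xs) (\<lambda>ys. ln (f ys))" using c(2) by simp
      then show ?thesis using True A[OF True] lam by (simp add: divide_right_mono)
    qed simp
  qed
  also have "\<dots> \<le> exp (ln G / lam)"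
    unfolding G_def by (rule functional_inequality_tensor[OF lam price]) (simp_all add: f_def)
  finally have "ln (?pA * exp ((- (c * ?s) - real n * t) / lam)) \<le> ln (exp (ln G / lam))"
    using pos by (subst ln_le_cancel_iff) auto
  then have "ln ?pA + (- (c * ?s) - real n * t) / lam \<le> ln G / lam"
    using pos by (simp add: ln_mult)
  then have "lam * (ln ?pA + (- (c * ?s) - real n * t) / lam) \<le> lam * (ln G / lam)"
    using lam by (intro mult_left_mono) auto
  then have lower: "lam * ln ?pA - c * ?s - real n * t \<le> ln G"
    using lam by (simp add: distrib_left)
  have "G \<le> expect ?Pn (\<lambda>ys. \<Sum>b\<in>B'. exp (- (c * ham ys b)))"
    unfolding G_def
  proof (rule expect_mono)
    fix ys
    obtain b where "b \<in> B'" "hdist B' ys = ham ys b" by (rule hdist_attained[OF ctx])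
    then show "f ys \<le> (\<Sum>b\<in>B'. exp (- (c * ham ys b)))"
      unfolding f_def using finB by (simp add: member_le_sum[of b B' "\<lambda>b. exp (- (c * ham ys b))"])
  qed
  also have "\<dots> = (\<Sum>b\<in>B'. expect ?Pn (\<lambda>ys. exp (- (c * ham ys b))))" by (rule expect_sum)
  also have "\<dots> \<le> (\<Sum>b\<in>B'. pmf ?Pn b * (1 + \<kappa> / p) ^ n)"
  proof (rule sum_mono)
    fix b assume b: "b \<in> B'"
    then have "set b \<subseteq> set_pmf (bind_pmf S W)" by (simp add: B'_def in_set_replicate_pmf del: set_bind_pmf)
    from expect_exp_ham_le[OF _ _ p c(1) this] lenB[OF b] \<kappa>
    show "expect ?Pn (\<lambda>ys. exp (- (c * ham ys b))) \<le> pmf ?Pn b * (1 + \<kappa> / p) ^ n" by simp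
  qed
  also have "\<dots> = measure_pmf.prob ?Pn B' * (1 + \<kappa> / p) ^ n"
    using finB by (simp add: measure_measure_pmf_finite sum_distrib_right)
  also have "\<dots> \<le> measure_pmf.prob ?Pn B * exp (real n * (\<kappa> / p))"
  proof (rule mult_mono)
    show "measure_pmf.prob ?Pn B' \<le> measure_pmf.prob ?Pn B"
      by (intro measure_pmf.finite_measure_mono) (auto simp: B'_def)
    have "(1 + \<kappa> / p) ^ n \<le> exp (\<kappa> / p) ^ n"
      using \<kappa> p(1) by (intro power_mono exp_ge_add_one_self) auto
    then show "(1 + \<kappa> / p) ^ n \<le> exp (real n * (\<kappa> / p))" by (simp flip: exp_of_nat_mult)
  qed (use \<kappa> p(1) in auto)
  finally have upper: "G \<le> measure_pmf.prob ?Pn B * exp (real n * (\<kappa> / p))" .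
  have "exp (lam * ln ?pA - c * ?s - real n * t) \<le> G"
    using lower G by (metis exp_le_cancel_iff exp_ln)
  also note upper
  finally have "exp (lam * ln ?pA - c * ?s - real n * t) * exp (- (real n * (\<kappa> / p))) \<le>
      measure_pmf.prob ?Pn B * exp (real n * (\<kappa> / p)) * exp (- (real n * (\<kappa> / p)))"
    by (rule mult_right_mono) simp
  also have "\<dots> = measure_pmf.prob ?Pn B"
    unfolding mult.assoc exp_add[symmetric] by simp
  finally show ?thesis
    using pos by (simp add: powr_def c_def algebra_simps flip: exp_add)
qed

section \<open>Strong converse\<close>

lemma prob_H0_eq:
  assumes "finite (set_pmf P)"
  shows "prob_H0 (compressed \<phi> P) \<psi> = expect P (\<lambda>z. pmf (\<psi> (fst z, \<phi> (snd z))) H0)"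
  using assms by (simp add: prob_H0_def compressed_def bind_map_pmf pmf_bind_expect case_prod_unfold)

lemma expect_mixture:
  assumes A: "finite A" "\<And>a. a \<in> A \<Longrightarrow> w a \<ge> 0" "sum w A = 1"
    and p: "\<And>a. a \<in> A \<Longrightarrow> finite (set_pmf (p a))"
  shows "expect (mixture_pmf A w p) f = (\<Sum>a\<in>A. w a * expect (p a) f)"
    and "finite (set_pmf (mixture_pmf A w p))"
proof -
  let ?U = "\<Union>a\<in>A. set_pmf (p a)"
  have fin: "finite ?U" using A p by auto
  have sub: "set_pmf (mixture_pmf A w p) \<subseteq> ?U"
  proof
    fix z assume "z \<in> set_pmf (mixture_pmf A w p)"
    then have "(\<Sum>a\<in>A. w a * pmf (p a) z) \<noteq> 0" by (simp add: set_pmf_iff pmf_mixture_pmf[OF A])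
    then obtain a where "a \<in> A" "w a * pmf (p a) z \<noteq> 0" by (rule sum.not_neutral_contains_not_neutral)
    then show "z \<in> ?U" by (auto simp: set_pmf_iff)
  qed
  show "finite (set_pmf (mixture_pmf A w p))" using sub fin by (rule finite_subset)
  have "expect (mixture_pmf A w p) f = (\<Sum>z\<in>?U. (\<Sum>a\<in>A. w a * pmf (p a) z) * f z)"
    by (simp add: expect_superset[OF fin sub] pmf_mixture_pmf[OF A])
  also have "\<dots> = (\<Sum>a\<in>A. w a * (\<Sum>z\<in>?U. pmf (p a) z * f z))"
    unfolding sum_distrib_left sum_distrib_right by (subst sum.swap) (simp add: mult.assoc)
  also have "\<dots> = (\<Sum>a\<in>A. w a * expect (p a) f)"
    using fin by (intro sum.cong refl, subst expect_superset[of ?U]) auto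
  finally show "expect (mixture_pmf A w p) f = (\<Sum>a\<in>A. w a * expect (p a) f)" .
qed

lemma finite_set_iid_pair: "finite (set_pmf P) \<Longrightarrow> finite (set_pmf (iid_pair n P))"
  by (simp add: iid_pair_def finite_set_replicate_pmf)

lemma expect_iid_pair_joint:
  fixes S :: "'x::finite pmf" and W :: "'x \<Rightarrow> 'y::finite pmf"
  shows "expect (iid_pair n (joint S W)) f = expect (replicate_pmf n S) (\<lambda>xs. expect (kpow W xs) (\<lambda>ys. f (ys, xs)))"
  unfolding iid_pair_joint by (simp add: expect_bind expect_map finite_set_replicate_pmf finite_set_kpow)

lemma expect_pair_pmf:
  assumes "finite (set_pmf p)" "finite (set_pmf q)"
  shows "expect (pair_pmf p q) f = expect p (\<lambda>x. expect q (\<lambda>y. f (x, y)))"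
  using assms by (simp add: pair_pmf_def expect_bind)

lemma expect_pair_pmf':
  assumes "finite (set_pmf p)" "finite (set_pmf q)"
  shows "expect (pair_pmf p q) f = expect q (\<lambda>y. expect p (\<lambda>x. f (x, y)))"
  unfolding expect_pair_pmf[OF assms] by (rule expect_swap)

lemma expect_pair_rectangle:
  assumes fin: "finite (set_pmf p)" "finite (set_pmf q)"
  shows "expect (pair_pmf p q) (\<lambda>z. indicator A (snd z) * indicator B (fst z)) =
    measure_pmf.prob q A * measure_pmf.prob p B"
proof -
  have "expect (pair_pmf p q) (\<lambda>z. indicator A (snd z) * indicator B (fst z)) =
      expect q (\<lambda>x. indicator A x * measure_pmf.prob p B)"
    unfolding expect_pair_pmf'[OF fin] fst_conv snd_conv expect_cmult expect_indicator[OF fin(1)] ..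
  also have "\<dots> = measure_pmf.prob p B * expect q (indicator A)"
    by (subst expect_cmult[symmetric]) (simp add: mult.commute)
  also have "\<dots> = measure_pmf.prob q A * measure_pmf.prob p B"
    by (simp add: expect_indicator fin)
  finally show ?thesis .
qed

lemma le_exp_cmultI:
  fixes a x y :: real
  assumes "exp (- a) * x \<le> y" shows "x \<le> exp a * y"
proof -
  have "exp a * (exp (- a) * x) \<le> exp a * y" using assms by (rule mult_left_mono) simp
  then show ?thesis by (simp add: mult.assoc[symmetric] flip: exp_add)
qed

text \<open>The part of the strong converse that does not concern information quantities. A
  randomized test is replaced by rectangles \<open>Am m\<close> times \<open>B m\<close>, on which
  it accepts with probability at least \<open>\<delta> / 4\<close>; independence under the
  alternative and change of measure do the rest. The image size bound enters as the hypothesis on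
  \<open>b\<close>.\<close>

lemma strong_converse_step:
  fixes S :: "'x::finite pmf" and W :: "'x \<Rightarrow> 'y::finite pmf"
  assumes fin: "finite (set_pmf qY)" "finite (set_pmf qX)"
    and enc: "encoder n M \<phi>" and \<delta>: "\<delta> > 0"
    and acc: "prob_H0 (compressed \<phi> (iid_pair n (joint S W))) \<psi> \<ge> \<delta>"
    and T: "measure_pmf.prob (replicate_pmf n S) {xs. \<not> T xs} \<le> \<delta> / 4"
    and G: "measure_pmf.prob (replicate_pmf n (bind_pmf S W)) {ys. \<not> G ys} \<le> \<delta> / 4"
    and cX: "cX > 0" "\<And>xs. T xs \<Longrightarrow> pmf (replicate_pmf n S) xs \<le> cX * pmf qX xs"
    and cY: "cY > 0" "\<And>ys. G ys \<Longrightarrow> pmf (replicate_pmf n (bind_pmf S W)) ys \<le> cY * pmf qY ys"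
    and b: "b \<ge> 0" "\<And>A B. measure_pmf.prob (replicate_pmf n S) A \<ge> \<delta> / (16 * card M) \<Longrightarrow>
      (\<And>xs. xs \<in> A \<Longrightarrow> xs \<in> set_pmf (replicate_pmf n S) \<and> T xs \<and> measure_pmf.prob (kpow W xs) B \<ge> \<delta> / 8) \<Longrightarrow>
      b \<le> measure_pmf.prob (replicate_pmf n (bind_pmf S W)) B"
  shows "\<delta> / 4 * (\<delta> / 16) * b / (cX * cY) \<le> prob_H0 (compressed \<phi> (pair_pmf qY qX)) \<psi>"
proof -
  let ?Sn = "replicate_pmf n S" and ?Pn = "iid_pair n (joint S W)"
  let ?Yn = "replicate_pmf n (bind_pmf S W)"
  define a where "a y m = pmf (\<psi> (y, m)) H0" for y m
  have a01: "0 \<le> a y m" "a y m \<le> 1" for y m by (auto simp: a_def pmf_le_1)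
  have finS: "finite (set_pmf ?Sn)" and finP: "finite (set_pmf ?Pn)" and finY: "finite (set_pmf ?Yn)"
    by (simp_all add: finite_set_replicate_pmf finite_set_iid_pair)
  have finK: "finite (set_pmf (kpow W xs))" for xs by (simp add: finite_set_kpow)
  \<comment> \<open>Thresholding derandomizes the decision: outside \<open>B m\<close> the test
    accepts with probability below \<open>\<delta> / 4\<close> or the Y-word is atypical.\<close>
  define B where "B m = {y. a y m \<ge> \<delta> / 4 \<and> G y}" for m
  define q where "q x = measure_pmf.prob (kpow W x) (B (\<phi> x))" for x
  define A where "A = {x \<in> set_pmf ?Sn. T x \<and> q x \<ge> \<delta> / 8}"
  have "\<delta> \<le> expect ?Pn (\<lambda>z. a (fst z) (\<phi> (snd z)))"
    using acc by (simp add: prob_H0_eq[OF finP] a_def)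
  \<comment> \<open>Three losses of \<open>\<delta> / 4\<close> each: the threshold, atypical
    Y-words and atypical X-words. A quarter of the acceptance remains.\<close>
  also have "\<dots> \<le> expect ?Pn (\<lambda>z. \<delta> / 4 + indicator {y. \<not> G y} (fst z) + indicator {x. \<not> T x} (snd z) +
      indicator {x. T x} (snd z) * indicator (B (\<phi> (snd z))) (fst z))"
  proof (rule expect_mono)
    fix z
    show "a (fst z) (\<phi> (snd z)) \<le> \<delta> / 4 + indicator {y. \<not> G y} (fst z) + indicator {x. \<not> T x} (snd z) +
      indicator {x. T x} (snd z) * indicator (B (\<phi> (snd z))) (fst z)"
      using a01[of "fst z" "\<phi> (snd z)"] \<delta> by (auto simp: B_def indicator_def)
  qed
  also have "\<dots> = \<delta> / 4 + expect ?Yn (indicator {y. \<not> G y}) + expect ?Sn (indicator {x. \<not> T x}) +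
      expect ?Pn (\<lambda>z. indicator {x. T x} (snd z) * indicator (B (\<phi> (snd z))) (fst z))"
    using expect_map[OF finP, of fst "indicator {y. \<not> G y}"] expect_map[OF finP, of snd "indicator {x. \<not> T x}"]
    by (simp add: expect_add finP map_fst_iid_pair map_snd_iid_pair)
  also have "expect ?Pn (\<lambda>z. indicator {x. T x} (snd z) * indicator (B (\<phi> (snd z))) (fst z)) =
      expect ?Sn (\<lambda>x. indicator {x. T x} x * q x)"
    by (simp add: expect_iid_pair_joint expect_cmult expect_indicator finK q_def)
  finally have "\<delta> / 4 \<le> expect ?Sn (\<lambda>x. indicator {x. T x} x * q x)"
    using T G by (simp add: expect_indicator finS finY)
  also have "\<dots> \<le> expect ?Sn (\<lambda>x. \<delta> / 8 + indicator A x)"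
    using \<delta> by (intro expect_mono) (auto simp: A_def indicator_def q_def not_le add_increasing)
  also have "\<dots> = \<delta> / 8 + measure_pmf.prob ?Sn A" by (simp add: expect_add expect_indicator finS)
  finally have SA: "\<delta> / 8 \<le> measure_pmf.prob ?Sn A" by simp
  have M: "finite M" "\<And>x. x \<in> A \<Longrightarrow> \<phi> x \<in> M"
    using enc by (auto simp: encoder_def A_def in_set_replicate_pmf simp del: replicate_pmf.simps)
  define Am where "Am m = A \<inter> \<phi> -` {m}" for m
  define s where "s m = measure_pmf.prob ?Sn (Am m)" for m
  have "A = (\<Union>m\<in>M. Am m)" using M by (auto simp: Am_def)
  moreover have "measure_pmf.prob ?Sn (\<Union>m\<in>M. Am m) = (\<Sum>m\<in>M. s m)"
    unfolding s_def using M(1)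
    by (intro measure_pmf.finite_measure_finite_Union) (auto simp: disjoint_family_on_def Am_def)
  ultimately have sumM: "measure_pmf.prob ?Sn A = (\<Sum>m\<in>M. s m)" by metis
  have "M \<noteq> {}" using SA \<delta> sumM by auto
  then have cM: "card M > 0" using M(1) by (simp add: card_gt_0_iff)
  \<comment> \<open>Cells below this threshold have total probability at most
    \<open>card M * thr = \<delta> / 16\<close>, half of what \<open>A\<close> is known to
    have.\<close>
  define thr where "thr = \<delta> / (16 * card M)"
  define M1 where "M1 = {m \<in> M. s m \<ge> thr}"
  have "(\<Sum>m\<in>M. s m) \<le> (\<Sum>m\<in>M. thr + (if m \<in> M1 then s m else 0))"
    using \<delta> by (intro sum_mono) (auto simp: M1_def thr_def)
  also have "\<dots> = \<delta> / 16 + (\<Sum>m\<in>M1. s m)"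
    using M(1) cM \<open>M \<noteq> {}\<close> by (simp add: sum.distrib thr_def M1_def sum.inter_filter)
  finally have sum1: "\<delta> / 16 \<le> (\<Sum>m\<in>M1. s m)" using SA sumM by simp
  have Bb: "b \<le> measure_pmf.prob ?Yn (B m)" if "m \<in> M1" for m
  proof (rule b(2))
    show "measure_pmf.prob ?Sn (Am m) \<ge> \<delta> / (16 * card M)" using that by (simp add: M1_def s_def thr_def)
  qed (auto simp: Am_def A_def q_def)
  have "\<delta> / 4 * (\<delta> / 16) * b / (cX * cY) \<le> \<delta> / 4 * (\<Sum>m\<in>M1. s m) * b / (cX * cY)"
    using \<delta> cX cY b sum1 by (intro divide_right_mono mult_right_mono mult_left_mono) auto
  also have "\<dots> = (\<Sum>m\<in>M1. \<delta> / 4 * ((s m / cX) * (b / cY)))"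
    by (simp add: sum_distrib_left sum_distrib_right sum_divide_distrib mult_ac)
  also have "\<dots> \<le> (\<Sum>m\<in>M1. \<delta> / 4 * (measure_pmf.prob qX (Am m) * measure_pmf.prob qY (B m)))"
  proof (intro sum_mono mult_left_mono mult_mono)
    fix m assume m: "m \<in> M1"
    have "s m \<le> cX * measure_pmf.prob qX (Am m)"
      unfolding s_def using cX by (intro prob_le_cmult finS) (auto simp: Am_def A_def)
    then show "s m / cX \<le> measure_pmf.prob qX (Am m)" using cX by (simp add: field_simps)
    have "b \<le> cY * measure_pmf.prob qY (B m)"
      using cY by (intro order_trans[OF Bb[OF m]] prob_le_cmult finY) (auto simp: B_def)
    then show "b / cY \<le> measure_pmf.prob qY (B m)" using cY by (simp add: field_simps)
  qed (use \<delta> cY b in auto)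
  also have "\<dots> = expect (pair_pmf qY qX) (\<lambda>z. \<Sum>m\<in>M1. \<delta> / 4 * (indicator (Am m) (snd z) * indicator (B m) (fst z)))"
    by (simp only: expect_sum expect_cmult expect_pair_rectangle[OF fin])
  also have "\<dots> \<le> expect (pair_pmf qY qX) (\<lambda>z. a (fst z) (\<phi> (snd z)))"
  proof (rule expect_mono)
    fix z :: "'y list \<times> 'x list"
    \<comment> \<open>An X-word determines its message, so at most one rectangle contains
      \<open>z\<close>.\<close>
    have "(\<Sum>m\<in>M1. \<delta> / 4 * (indicator (Am m) (snd z) * indicator (B m) (fst z))) \<le>
        (\<Sum>m\<in>M1. if m = \<phi> (snd z) then a (fst z) m else 0)"
      using a01 by (intro sum_mono) (auto simp: indicator_def Am_def B_def)
    also have "\<dots> \<le> a (fst z) (\<phi> (snd z))"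
      using M(1) a01 by (simp add: M1_def)
    finally show "(\<Sum>m\<in>M1. \<delta> / 4 * (indicator (Am m) (snd z) * indicator (B m) (fst z))) \<le> a (fst z) (\<phi> (snd z))" .
  qed
  also have "\<dots> = prob_H0 (compressed \<phi> (pair_pmf qY qX)) \<psi>"
    using fin by (subst prob_H0_eq) (auto simp: a_def)
  finally show ?thesis .
qed

text \<open>The slack \<open>\<eta>1\<close> is fixed before the length and the code, because a
  limsup condition on the rate controls the size of codes only up to such a slack. All codes of one
  length are treated at once.\<close>

lemma strong_converse:
  fixes S :: "'x::finite pmf" and W :: "'x \<Rightarrow> 'y::finite pmf"
  assumes fin: "\<And>n. finite (set_pmf (QY n))" "\<And>n. finite (set_pmf (QX n))"
    and lr: "lr_upper (bind_pmf S W) QY (ereal dy)" "lr_upper S QX (ereal dx)"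
    and R: "R \<ge> 0" and \<delta>: "\<delta> > 0" and \<eta>: "\<eta> > 0"
  obtains \<eta>1 where "\<eta>1 > 0"
    "eventually (\<lambda>n. \<forall>M \<phi> \<psi>. encoder n M \<phi> \<longrightarrow> real (card M) \<le> exp (real n * (R + \<eta>1)) \<longrightarrow>
       \<delta> \<le> prob_H0 (compressed \<phi> (iid_pair n (joint S W))) \<psi> \<longrightarrow>
       exp (- (real n * (max_I_YU (joint S W) R + (dy + dx) + \<eta>))) \<le>
         prob_H0 (compressed \<phi> (pair_pmf (QY n) (QX n))) \<psi>) sequentially"
proof -
  \<comment> \<open>Eight shares: slack of the price, law of large numbers for \<open>g\<close>,
    \<open>\<kappa> / p\<close>, slack in the code size, the square root term, the constant
    \<open>c0\<close>, and one change of measure each for X and Y.\<close>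
  define h where "h = \<eta> / 8"
  have h: "h > 0" using \<eta> by (simp add: h_def)
  obtain g lam where lam: "lam > 0"
    and price: "\<And>v. v \<in> simplex_on S \<Longrightarrow> DY S W v \<le> lam * DX S v + (\<Sum>x\<in>UNIV. v $ x * g x)"
    and Sg: "(\<Sum>x\<in>UNIV. pmf S x * g x) \<le> max_I_YU (joint S W) R + h - lam * R"
    by (rule separating_price[OF R h, of S W]) (blast intro: that)
  define t where "t = expect S g + h"
  let ?Y = "bind_pmf S W"
  define p where "p = Min (pmf ?Y ` set_pmf ?Y)"
  have finY: "finite (set_pmf ?Y)" by (rule finite)
  have "p \<in> pmf ?Y ` set_pmf ?Y"
    unfolding p_def using finY set_pmf_not_empty[of ?Y] by (intro Min_in) blast+
  then have p0: "p > 0" by (force simp: pmf_positive simp del: set_bind_pmf)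
  have p: "p \<le> pmf ?Y y" if "y \<in> set_pmf ?Y" for y
    unfolding p_def using finY that by (intro Min_le) auto
  define \<kappa> where "\<kappa> = min (1 / 2) (p * h)"
  have \<kappa>: "0 < \<kappa>" "\<kappa> < 1" "\<kappa> / p \<le> h"
  proof -
    show "0 < \<kappa>" "\<kappa> < 1" using p0 h by (auto simp: \<kappa>_def)
    have "\<kappa> \<le> h * p" by (simp add: \<kappa>_def mult.commute)
    then show "\<kappa> / p \<le> h" using p0 by (simp add: divide_le_eq)
  qed
  \<comment> \<open>Extra rate is paid for at the price \<open>lam\<close>, hence the
    denominator.\<close>
  define \<eta>1 where "\<eta>1 = h / (lam + 1)"
  have \<eta>1: "\<eta>1 > 0" "lam * \<eta>1 \<le> h" using h lam by (auto simp: \<eta>1_def field_simps)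
  have lln: "whp (\<lambda>n. replicate_pmf n S) (\<lambda>n xs. sum_list (map g xs) \<le> real n * t)"
    by (rule whp_mono[OF iid_lln[OF _ h, of S g]]) (auto simp: t_def algebra_simps intro!: always_eventually)
  have lX: "whp (\<lambda>n. replicate_pmf n S) (\<lambda>n xs. pmf (QX n) xs \<ge> exp (- (real n * (dx + h))) * pmf (replicate_pmf n S) xs)"
    using lr(2) h by (simp add: lr_upper_def)
  have lY: "whp (\<lambda>n. replicate_pmf n ?Y) (\<lambda>n ys. pmf (QY n) ys \<ge> exp (- (real n * (dy + h))) * pmf (replicate_pmf n ?Y) ys)"
    using lr(1) h by (simp add: lr_upper_def)
  define c0 where "c0 = \<delta> / 4 * (\<delta> / 16) * (\<delta> / 16) powr lam"
  have c0: "c0 > 0" using \<delta> by (simp add: c0_def)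
  have "eventually (\<lambda>n. ln (1 / \<kappa>) * sqrt (real n / (\<delta> / 8)) \<le> real n * h) sequentially"
  proof -
    let ?c = "(ln (1 / \<kappa>))\<^sup>2 / (\<delta> / 8)"
    show ?thesis
      using eventually_le_linear[of "h\<^sup>2" ?c]  
    proof (rule eventually_mono)
      show "h\<^sup>2 > 0" using h by simp
      fix n assume n: "?c \<le> real n * h\<^sup>2"
      have "(ln (1 / \<kappa>) * sqrt (real n / (\<delta> / 8)))\<^sup>2 = real n * ?c"
        using \<delta> by (simp add: power_mult_distrib)
      also have "\<dots> \<le> real n * (real n * h\<^sup>2)" using n by (rule mult_left_mono) simp
      also have "\<dots> = (real n * h)\<^sup>2" by (simp add: power2_eq_square)
      finally show "ln (1 / \<kappa>) * sqrt (real n / (\<delta> / 8)) \<le> real n * h"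
        by (rule power2_le_imp_le) (use h in simp)
    qed
  qed
  moreover have "eventually (\<lambda>n. - ln c0 \<le> real n * h) sequentially"
    by (rule eventually_le_linear[OF h])
  moreover have "\<delta> / 4 > 0" using \<delta> by simp
  note whpD[OF whp_conj[OF lln lX] this] whpD[OF lY this]
  ultimately have "eventually (\<lambda>n. \<forall>M \<phi> \<psi>. encoder n M \<phi> \<longrightarrow> real (card M) \<le> exp (real n * (R + \<eta>1)) \<longrightarrow>
       \<delta> \<le> prob_H0 (compressed \<phi> (iid_pair n (joint S W))) \<psi> \<longrightarrow>
       exp (- (real n * (max_I_YU (joint S W) R + (dy + dx) + \<eta>))) \<le>
         prob_H0 (compressed \<phi> (pair_pmf (QY n) (QX n))) \<psi>) sequentially"
  proof eventually_elim
    case (elim n)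
    show ?case
    proof (intro allI impI)
      fix M and \<phi> :: "'x list \<Rightarrow> nat" and \<psi> :: "'y list \<times> nat \<Rightarrow> hypothesis pmf"
      assume enc: "encoder n M \<phi>" and card: "real (card M) \<le> exp (real n * (R + \<eta>1))"
        and acc: "\<delta> \<le> prob_H0 (compressed \<phi> (iid_pair n (joint S W))) \<psi>"
      define b where "b = (\<delta> / 16) powr lam * exp (- (lam * (real n * (R + \<eta>1)))) *
          exp (- (real n * t) - real n * (\<kappa> / p) - ln (1 / \<kappa>) * sqrt (real n / (\<delta> / 8)))"
      have cM: "card M > 0"
      proof -
        have "\<phi> (replicate n undefined) \<in> M" "finite M" using enc by (auto simp: encoder_def)
        then show ?thesis by (auto simp: card_gt_0_iff)
      qed
      have "\<delta> / 4 * (\<delta> / 16) * b / (exp (real n * (dx + h)) * exp (real n * (dy + h))) \<le>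
          prob_H0 (compressed \<phi> (pair_pmf (QY n) (QX n))) \<psi>"
      proof (rule strong_converse_step[OF fin enc \<delta> acc elim(3,4)])
        show "exp (real n * (dx + h)) > 0" "exp (real n * (dy + h)) > 0" by auto
        show "pmf (replicate_pmf n S) xs \<le> exp (real n * (dx + h)) * pmf (QX n) xs"
          if "sum_list (map g xs) \<le> real n * t \<and> exp (- (real n * (dx + h))) * pmf (replicate_pmf n S) xs \<le> pmf (QX n) xs" for xs
          using that by (intro le_exp_cmultI) simp
        show "pmf (replicate_pmf n ?Y) ys \<le> exp (real n * (dy + h)) * pmf (QY n) ys"
          if "exp (- (real n * (dy + h))) * pmf (replicate_pmf n ?Y) ys \<le> pmf (QY n) ys" for ys
          using that by (intro le_exp_cmultI) simp
        show "b \<ge> 0" using \<delta> by (simp add: b_def)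
        fix A B
        assume A: "\<delta> / real (16 * card M) \<le> measure_pmf.prob (replicate_pmf n S) A"
          "\<And>xs. xs \<in> A \<Longrightarrow> xs \<in> set_pmf (replicate_pmf n S) \<and>
            (sum_list (map g xs) \<le> real n * t \<and> exp (- (real n * (dx + h))) * pmf (replicate_pmf n S) xs \<le> pmf (QX n) xs) \<and>
            \<delta> / 8 \<le> measure_pmf.prob (kpow W xs) B"
        have "\<delta> / 16 * exp (- (real n * (R + \<eta>1))) \<le> \<delta> / 16 * (1 / real (card M))"
          using le_imp_inverse_le[OF card] cM \<delta>
          by (intro mult_left_mono) (simp_all add: exp_minus inverse_eq_divide)
        also have "\<dots> \<le> measure_pmf.prob (replicate_pmf n S) A" using A(1) by simp
        finally have pA: "\<delta> / 16 * exp (- (real n * (R + \<eta>1))) \<le> measure_pmf.prob (replicate_pmf n S) A" .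
        have pos: "measure_pmf.prob (replicate_pmf n S) A > 0"
          by (rule less_le_trans[OF _ pA]) (use \<delta> in simp)
        have "(\<delta> / 16) powr lam * exp (- (lam * (real n * (R + \<eta>1)))) = (\<delta> / 16 * exp (- (real n * (R + \<eta>1)))) powr lam"
          unfolding powr_mult by (simp add: powr_def)
        also have "\<dots> \<le> measure_pmf.prob (replicate_pmf n S) A powr lam"
          using pA lam \<delta> by (intro powr_mono2) auto
        finally have "b \<le> measure_pmf.prob (replicate_pmf n S) A powr lam *
          exp (- (real n * t) - real n * (\<kappa> / p) - ln (1 / \<kappa>) * sqrt (real n / (\<delta> / 8)))"
          unfolding b_def by (rule mult_right_mono) simp
        also have "\<dots> \<le> measure_pmf.prob (replicate_pmf n ?Y) B"
          using A(2) \<delta> by (intro image_size[OF lam price \<kappa>(1,2) p0 p _ _ pos]) auto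
        finally show "b \<le> measure_pmf.prob (replicate_pmf n ?Y) B" .
      qed
      moreover have "exp (- (real n * (max_I_YU (joint S W) R + (dy + dx) + \<eta>))) \<le>
          \<delta> / 4 * (\<delta> / 16) * b / (exp (real n * (dx + h)) * exp (real n * (dy + h)))"
      proof -
        let ?r = "ln (1 / \<kappa>) * sqrt (real n / (\<delta> / 8))"
        have eq: "\<delta> / 4 * (\<delta> / 16) * b / (exp (real n * (dx + h)) * exp (real n * (dy + h))) =
           exp (ln c0 - lam * (real n * (R + \<eta>1)) - real n * t - real n * (\<kappa> / p) - ?r - real n * (dx + h) - real n * (dy + h))"
        proof -
          have *: "\<delta> / 4 * (\<delta> / 16) * b = exp (ln c0) * exp (- (lam * (real n * (R + \<eta>1)))) *
              exp (- (real n * t) - real n * (\<kappa> / p) - ?r)"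
            using c0 by (simp add: b_def c0_def)
          show ?thesis unfolding * exp_add[symmetric] exp_diff[symmetric] by (simp add: algebra_simps)
        qed
        have 1: "real n * (lam * \<eta>1) \<le> real n * h" using \<eta>1(2) by (rule mult_left_mono) simp
        have 2: "real n * (\<kappa> / p) \<le> real n * h" using \<kappa>(3) by (rule mult_left_mono) simp
        have "t \<le> max_I_YU (joint S W) R + 2 * h - lam * R" using Sg by (simp add: t_def expect_UNIV)
        then have 3: "real n * t \<le> real n * (max_I_YU (joint S W) R + 2 * h - lam * R)" by (rule mult_left_mono) simp
        have 4: "\<eta> = 8 * h" by (simp add: h_def)
        have "- (real n * (max_I_YU (joint S W) R + (dy + dx) + \<eta>)) \<le>
           ln c0 - lam * (real n * (R + \<eta>1)) - real n * t - real n * (\<kappa> / p) - ?r - real n * (dx + h) - real n * (dy + h)"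
          using 1 2 3 elim(1,2) unfolding 4 by (simp add: algebra_simps)
        then show ?thesis unfolding eq by simp
      qed
      ultimately show "exp (- (real n * (max_I_YU (joint S W) R + (dy + dx) + \<eta>))) \<le>
          prob_H0 (compressed \<phi> (pair_pmf (QY n) (QX n))) \<psi>" by linarith
    qed
  qed
  with \<eta>1(1) that show ?thesis by blast
qed

section \<open>Codes for one class\<close>

lemma expect_exists_ge:
  assumes "finite (set_pmf p)" "c \<le> expect p f"
  shows "\<exists>x\<in>set_pmf p. c \<le> f x"
proof (rule ccontr)
  assume "\<not> ?thesis"
  then have "0 < expect p (\<lambda>x. c - f x)" using assms(1) by (intro expect_pos) auto
  then show False using assms by (simp add: expect_diff)
qed

text \<open>Averaged over \<open>u\<close> drawn from \<open>q\<close>, a codeword covers at least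
  the fraction \<open>\<theta>\<close> of what is still uncovered, so some codeword does. Each
  choice shrinks the uncovered probability by \<open>1 - \<theta>\<close>.\<close>

lemma greedy_cover:
  fixes p :: "'x pmf" and q :: "'u pmf"
  assumes fin: "finite (set_pmf p)" "finite (set_pmf q)"
    and \<theta>: "\<theta> \<le> 1" "\<And>x. x \<in> X \<Longrightarrow> \<theta> \<le> measure_pmf.prob q {u. good u x}"
  shows "\<exists>us. length us = N \<and> set us \<subseteq> set_pmf q \<and>
    measure_pmf.prob p {x \<in> X. \<forall>u\<in>set us. \<not> good u x} \<le> (1 - \<theta>) ^ N"
proof (induction N)
  case 0
  show ?case by (intro exI[of _ "[]"]) simp
next
  case (Suc N)
  then obtain us where us: "length us = N" "set us \<subseteq> set_pmf q"
    "measure_pmf.prob p {x \<in> X. \<forall>u\<in>set us. \<not> good u x} \<le> (1 - \<theta>) ^ N" by blast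
  define D where "D = {x \<in> X. \<forall>u\<in>set us. \<not> good u x}"
  have "\<theta> * measure_pmf.prob p D = expect p (\<lambda>x. \<theta> * indicator D x)"
    by (simp add: expect_cmult expect_indicator fin)
  also have "\<dots> \<le> expect p (\<lambda>x. expect q (\<lambda>u. indicator {x \<in> D. good u x} x))"
  proof (rule expect_mono)
    fix x
    show "\<theta> * indicator D x \<le> expect q (\<lambda>u. indicator {x \<in> D. good u x} x)"
    proof (cases "x \<in> D")
      case True
      then have "expect q (\<lambda>u. indicator {x \<in> D. good u x} x) = expect q (indicator {u. good u x})"
        by (intro expect_cong) (auto simp: indicator_def)
      then show ?thesis using \<theta>(2)[of x] True by (simp add: expect_indicator fin D_def)
    qed (simp add: expect_nonneg)
  qed
  also have "\<dots> = expect q (\<lambda>u. expect p (indicator {x \<in> D. good u x}))" by (rule expect_swap)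
  finally obtain u where u: "u \<in> set_pmf q" "\<theta> * measure_pmf.prob p D \<le> expect p (indicator {x \<in> D. good u x})"
    using expect_exists_ge[OF fin(2)] by blast
  have "{x \<in> X. \<forall>u\<in>set (u # us). \<not> good u x} = D - {x \<in> D. good u x}"
    by (auto simp: D_def)
  then have "measure_pmf.prob p {x \<in> X. \<forall>u\<in>set (u # us). \<not> good u x} =
      measure_pmf.prob p D - measure_pmf.prob p {x \<in> D. good u x}"
    by (simp add: measure_pmf.finite_measure_Diff)
  also have "\<dots> \<le> (1 - \<theta>) * measure_pmf.prob p D"
    using u(2) by (simp add: expect_indicator fin algebra_simps)
  also have "\<dots> \<le> (1 - \<theta>) * (1 - \<theta>) ^ N"
    using us(3) \<theta>(1) by (intro mult_left_mono) (auto simp: D_def)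
  finally show ?case using us u(1) by (intro exI[of _ "u # us"]) auto
qed

lemma markov_pmf:
  assumes "finite (set_pmf p)" "c > 0" "\<And>x. x \<in> set_pmf p \<Longrightarrow> 0 \<le> f x"
  shows "measure_pmf.prob p {x. \<not> f x \<le> c} \<le> expect p f / c"
proof -
  have "c * measure_pmf.prob p {x. \<not> f x \<le> c} = expect p (\<lambda>x. c * indicator {x. \<not> f x \<le> c} x)"
    by (simp add: expect_cmult expect_indicator assms)
  also have "\<dots> \<le> expect p f"
    using assms by (intro expect_mono) (auto simp: indicator_def)
  finally show ?thesis using assms(2) by (simp add: field_simps)
qed

lemma prob_not: "measure_pmf.prob p {x. \<not> A x} = 1 - measure_pmf.prob p {x. A x}"
  by (subst measure_pmf.prob_compl[symmetric]) (auto intro!: arg_cong2[where f = measure])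

text \<open>A codeword counts as good for \<open>x\<close> only if the decoder misses with small probability given \<open>x\<close>;
  Markov's inequality then plays the role of the Markov lemma on joint typicality.\<close>

lemma one_shot_cover:
  fixes p :: "'x pmf" and K :: "'x \<Rightarrow> 'u pmf" and V :: "nat \<Rightarrow> 'x \<Rightarrow> 'y pmf" and B :: "nat \<Rightarrow> 'u \<Rightarrow> 'y set"
  assumes fin: "finite (set_pmf p)" "finite (set_pmf q)" "\<And>x. finite (set_pmf (K x))" and J: "finite J"
    and L: "L \<ge> 1" and \<zeta>: "\<zeta> > 0"
    and G: "measure_pmf.prob p {x. \<not> G x} \<le> \<epsilon>"
    and KL: "expect p (\<lambda>x. measure_pmf.prob (K x) {u. \<not> pmf (K x) u \<le> L * pmf q u}) \<le> \<epsilon>"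
    and VB: "\<And>j. j \<in> J \<Longrightarrow> expect p (\<lambda>x. expect (K x) (\<lambda>u. measure_pmf.prob (V j x) {y. y \<notin> B j u})) \<le> \<epsilon>"
  obtains us f where "length us = N" "set us \<subseteq> set_pmf q" "\<And>x u. f x = Some u \<Longrightarrow> u \<in> set us \<and> G x"
    "\<And>j. j \<in> J \<Longrightarrow> expect p (\<lambda>x. case f x of None \<Rightarrow> 0 | Some u \<Rightarrow> measure_pmf.prob (V j x) (B j u)) \<ge>
       1 - \<zeta> - 2 * (2 * \<epsilon> + real (card J) * \<epsilon> / \<zeta>) - (1 - 1 / (2 * L)) ^ N"
proof -
  define miss where "miss j x u = measure_pmf.prob (V j x) {y. y \<notin> B j u}" for j x u
  define good where "good u x \<longleftrightarrow> G x \<and> pmf (K x) u \<le> L * pmf q u \<and> (\<forall>j\<in>J. miss j x u \<le> \<zeta>)" for u x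
  define bad where "bad x = measure_pmf.prob (K x) {u. \<not> good u x}" for x
  have "expect p bad \<le> expect p (\<lambda>x. indicator {x. \<not> G x} x + measure_pmf.prob (K x) {u. \<not> pmf (K x) u \<le> L * pmf q u} +
      (\<Sum>j\<in>J. expect (K x) (\<lambda>u. miss j x u) / \<zeta>))"
  proof (rule expect_mono)
    fix x
    have "bad x = expect (K x) (indicator {u. \<not> good u x})" by (simp add: bad_def expect_indicator fin)
    also have "\<dots> \<le> expect (K x) (\<lambda>u. indicator {x. \<not> G x} x + indicator {u. \<not> pmf (K x) u \<le> L * pmf q u} u +
        (\<Sum>j\<in>J. indicator {u. \<not> miss j x u \<le> \<zeta>} u))"
    proof (rule expect_mono)
      fix u
      have "indicator {u. \<not> miss j x u \<le> \<zeta>} u \<le> (\<Sum>j\<in>J. indicator {u. \<not> miss j x u \<le> \<zeta>} u :: real)" if "j \<in> J" for j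
        by (rule member_le_sum[OF that]) (use J in auto)
      then show "indicator {u. \<not> good u x} u \<le> indicator {x. \<not> G x} x + indicator {u. \<not> pmf (K x) u \<le> L * pmf q u} u +
        (\<Sum>j\<in>J. indicator {u. \<not> miss j x u \<le> \<zeta>} u :: real)"
        by (force simp: good_def indicator_def sum_nonneg)
    qed
    also have "\<dots> = indicator {x. \<not> G x} x + measure_pmf.prob (K x) {u. \<not> pmf (K x) u \<le> L * pmf q u} +
        (\<Sum>j\<in>J. measure_pmf.prob (K x) {u. \<not> miss j x u \<le> \<zeta>})"
      by (simp add: expect_add expect_sum expect_indicator fin)
    also have "\<dots> \<le> indicator {x. \<not> G x} x + measure_pmf.prob (K x) {u. \<not> pmf (K x) u \<le> L * pmf q u} +
        (\<Sum>j\<in>J. expect (K x) (\<lambda>u. miss j x u) / \<zeta>)"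
      by (intro add_left_mono sum_mono markov_pmf fin \<zeta>) (simp add: miss_def)
    finally show "bad x \<le> \<dots>" .
  qed
  also have "\<dots> = measure_pmf.prob p {x. \<not> G x} + expect p (\<lambda>x. measure_pmf.prob (K x) {u. \<not> pmf (K x) u \<le> L * pmf q u}) +
      (\<Sum>j\<in>J. expect p (\<lambda>x. expect (K x) (\<lambda>u. miss j x u)) / \<zeta>)"
  proof -
    have "expect p (\<lambda>x. \<Sum>j\<in>J. expect (K x) (\<lambda>u. miss j x u) / \<zeta>) =
        (\<Sum>j\<in>J. expect p (\<lambda>x. (1 / \<zeta>) * expect (K x) (\<lambda>u. miss j x u)))"
      by (simp add: expect_sum)
    then show ?thesis unfolding expect_cmult by (simp add: expect_add expect_indicator fin)
  qed
  also have "\<dots> \<le> \<epsilon> + \<epsilon> + (\<Sum>j\<in>J. \<epsilon> / \<zeta>)"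
    using G KL VB \<zeta> by (intro add_mono sum_mono divide_right_mono) (auto simp: miss_def)
  finally have bad: "expect p bad \<le> 2 * \<epsilon> + real (card J) * \<epsilon> / \<zeta>" by simp
  \<comment> \<open>Inputs whose own kernel produces a good codeword with probability at least 1/2;
    Markov's inequality at level 1/2 gives the factor 2.\<close>
  define X where "X = {x. bad x \<le> 1 / 2}"
  have notX: "measure_pmf.prob p {x. x \<notin> X} \<le> 2 * (2 * \<epsilon> + real (card J) * \<epsilon> / \<zeta>)"
    using markov_pmf[OF fin(1), of "1 / 2" bad] bad by (simp add: X_def bad_def)
  \<comment> \<open>A codeword from \<open>q\<close> instead of from the kernel of \<open>x\<close>
    is good with probability smaller by at most the factor \<open>L\<close>, the bound on the
    density.\<close>
  have cover: "1 / (2 * L) \<le> measure_pmf.prob q {u. good u x}" if "x \<in> X" for x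
  proof -
    have "1 / 2 \<le> measure_pmf.prob (K x) {u. good u x}"
      using that by (simp add: X_def bad_def prob_not)
    also have "\<dots> \<le> L * measure_pmf.prob q {u. good u x}"
      using L by (intro prob_le_cmult fin) (auto simp: good_def)
    finally show ?thesis using L by (simp add: field_simps)
  qed
  have "1 / (2 * L) \<le> 1" using L by simp
  from greedy_cover[of p q "1 / (2 * L)" X good N, OF fin(1,2) this cover] obtain us
    where us: "length us = N" "set us \<subseteq> set_pmf q"
      "measure_pmf.prob p {x \<in> X. \<forall>u\<in>set us. \<not> good u x} \<le> (1 - 1 / (2 * L)) ^ N" by blast
  define f where "f x = (if \<exists>u\<in>set us. good u x then Some (SOME u. u \<in> set us \<and> good u x) else None)" for x
  have f: "u \<in> set us \<and> good u x" if "f x = Some u" for x u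
  proof -
    have "\<exists>u. u \<in> set us \<and> good u x" "u = (SOME u. u \<in> set us \<and> good u x)"
      using that by (auto simp: f_def split: if_splits)
    then show ?thesis by (metis (mono_tags, lifting) someI_ex)
  qed
  have none: "f x = None \<longleftrightarrow> (\<forall>u\<in>set us. \<not> good u x)" for x by (auto simp: f_def)
  show ?thesis
  proof (rule that[OF us(1,2)])
    show "u \<in> set us \<and> G x" if "f x = Some u" for x u using f[OF that] by (simp add: good_def)
    fix j assume j: "j \<in> J"
    have "1 - \<zeta> - 2 * (2 * \<epsilon> + real (card J) * \<epsilon> / \<zeta>) - (1 - 1 / (2 * L)) ^ N \<le>
       expect p (\<lambda>x. 1 - \<zeta> - indicator {x. x \<notin> X} x - indicator {x \<in> X. \<forall>u\<in>set us. \<not> good u x} x)"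
      using notX us(3) by (simp add: expect_diff expect_indicator fin)
    also have "\<dots> \<le> expect p (\<lambda>x. case f x of None \<Rightarrow> 0 | Some u \<Rightarrow> measure_pmf.prob (V j x) (B j u))"
    proof (rule expect_mono)
      fix x
      show "1 - \<zeta> - indicator {x. x \<notin> X} x - indicator {x \<in> X. \<forall>u\<in>set us. \<not> good u x} x \<le>
        (case f x of None \<Rightarrow> 0 | Some u \<Rightarrow> measure_pmf.prob (V j x) (B j u))"
      proof (cases "f x")
        case None
        then have "\<forall>u\<in>set us. \<not> good u x" using none by blast
        then show ?thesis unfolding None option.case using \<zeta> by (simp add: indicator_def)
      next
        case (Some u)
        then have "miss j x u \<le> \<zeta>" using f[OF Some] j by (simp add: good_def)
        then have "1 - \<zeta> \<le> measure_pmf.prob (V j x) (B j u)" by (simp add: miss_def prob_not)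
        moreover have "0 \<le> measure_pmf.prob (V j x) (B j u)" by simp
        ultimately show ?thesis unfolding Some option.case using \<zeta> by (simp add: indicator_def)
      qed
    qed
    finally show "expect p (\<lambda>x. case f x of None \<Rightarrow> 0 | Some u \<Rightarrow> measure_pmf.prob (V j x) (B j u)) \<ge>
       1 - \<zeta> - 2 * (2 * \<epsilon> + real (card J) * \<epsilon> / \<zeta>) - (1 - 1 / (2 * L)) ^ N" .
  qed
qed

section \<open>Information densities of words\<close>

text \<open>The density of \<open>J\<close> with respect to the product of its marginals, 0 where that product vanishes.\<close>

definition dens :: "('a \<times> 'b) pmf \<Rightarrow> 'a \<Rightarrow> 'b \<Rightarrow> real" where
  "dens J a b = pmf J (a, b) / (pmf (map_pmf fst J) a * pmf (map_pmf snd J) b)"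

definition list_dens :: "('a \<times> 'b) pmf \<Rightarrow> 'a list \<Rightarrow> 'b list \<Rightarrow> real" where
  "list_dens J as bs = prod_list (map2 (dens J) as bs)"

lemma list_dens_Cons: "list_dens J (a # as) (b # bs) = dens J a b * list_dens J as bs"
  by (simp add: list_dens_def)

lemma list_dens_Nil: "list_dens J [] [] = 1"
  by (simp add: list_dens_def)

lemma dens_nonneg: "0 \<le> dens J a b"
  by (simp add: dens_def)

lemma list_dens_nonneg: "0 \<le> list_dens J as bs"
  unfolding list_dens_def by (induction as bs rule: list_induct2') (simp_all add: dens_nonneg)

lemma pmf_snd_expect:
  assumes "finite (set_pmf J)"
  shows "(\<Sum>a\<in>set_pmf (map_pmf fst J). pmf J (a, b)) = pmf (map_pmf snd J) b"
proof -
  let ?A = "set_pmf (map_pmf fst J)"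
  have "pmf (map_pmf snd J) b = measure_pmf.prob J (snd -` {b})"
    by (simp add: pmf_map)
  also have "\<dots> = measure_pmf.prob J ((\<lambda>a. (a, b)) ` ?A)"
    by (intro measure_pmf.finite_measure_eq_AE) (force simp: AE_measure_pmf_iff)+
  also have "\<dots> = (\<Sum>z\<in>(\<lambda>a. (a, b)) ` ?A. pmf J z)"
    using assms by (intro measure_measure_pmf_finite) auto
  also have "\<dots> = (\<Sum>a\<in>?A. pmf J (a, b))" by (subst sum.reindex) (auto simp: inj_on_def)
  finally show ?thesis ..
qed

text \<open>As a function of \<open>a\<close> the density is the ratio of the conditional law given
  \<open>b\<close> to the marginal, so its mean is 1; it is 0 if \<open>b\<close> has probability
  0.\<close>

lemma expect_dens_le_1:
  assumes "finite (set_pmf J)"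
  shows "expect (map_pmf fst J) (\<lambda>a. dens J a b) \<le> 1"
proof -
  have "expect (map_pmf fst J) (\<lambda>a. dens J a b) = (\<Sum>a\<in>set_pmf (map_pmf fst J). pmf J (a, b) / pmf (map_pmf snd J) b)"
    unfolding expect_def dens_def by (intro sum.cong refl) (auto simp: pmf_eq_0_set_pmf)
  also have "\<dots> = pmf (map_pmf snd J) b / pmf (map_pmf snd J) b"
    by (simp only: pmf_snd_expect[OF assms] flip: sum_divide_distrib)
  finally show ?thesis by (simp add: divide_self_if)
qed

lemma expect_list_dens_le_1:
  assumes fin: "finite (set_pmf J)"
  shows "expect (replicate_pmf (length bs) (map_pmf fst J)) (\<lambda>as. list_dens J as bs) \<le> 1"
proof (induction bs)
  case Nil
  then show ?case by (simp add: list_dens_Nil)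
next
  case (Cons b bs)
  let ?P = "map_pmf fst J"
  have finP: "finite (set_pmf ?P)" using fin by simp
  have "expect (replicate_pmf (length (b # bs)) ?P) (\<lambda>as. list_dens J as (b # bs)) =
      expect ?P (\<lambda>a. dens J a b * expect (replicate_pmf (length bs) ?P) (\<lambda>as. list_dens J as bs))"
    unfolding list.size(4) add_0_right add_Suc_right expect_replicate_Suc[OF finP] list_dens_Cons expect_cmult ..
  also have "\<dots> \<le> expect ?P (\<lambda>a. dens J a b)"
    using Cons.IH by (intro expect_mono) (simp add: dens_nonneg mult_left_le)
  also have "\<dots> \<le> 1" by (rule expect_dens_le_1[OF fin])
  finally show ?case .
qed

text \<open>Markov's inequality: an independent word looks jointly typical with a fixed codeword
  with probability at most \<open>exp (- t)\<close>. This yields the information term of the false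
  acceptance exponent.\<close>

lemma prob_list_dens_le:
  assumes fin: "finite (set_pmf J)"
  shows "measure_pmf.prob (replicate_pmf (length bs) (map_pmf fst J)) {as. exp t \<le> list_dens J as bs} \<le> exp (- t)"
proof -
  let ?p = "replicate_pmf (length bs) (map_pmf fst J)"
  have finp: "finite (set_pmf ?p)" using fin by (intro finite_set_replicate_pmf) simp
  have "exp t * measure_pmf.prob ?p {as. exp t \<le> list_dens J as bs} = expect ?p (\<lambda>as. exp t * indicator {as. exp t \<le> list_dens J as bs} as)"
    by (simp add: expect_cmult expect_indicator finp)
  also have "\<dots> \<le> expect ?p (\<lambda>as. list_dens J as bs)"
    by (intro expect_mono) (auto simp: indicator_def list_dens_nonneg)
  also have "\<dots> \<le> 1" by (rule expect_list_dens_le_1[OF fin])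
  finally show ?thesis by (simp add: exp_minus field_simps)
qed

lemma mutual_info_eq_expect:
  fixes J :: "('a::countable \<times> 'b::countable) pmf"
  assumes "finite (set_pmf J)"
  shows "mutual_info J = expect J (\<lambda>z. ln (dens J (fst z) (snd z)))"
  unfolding mutual_info_eq_sum[OF assms subset_refl] expect_def dens_def
  by (simp add: case_prod_unfold)

text \<open>The logarithm of the density is a sum of i.i.d. terms with mean the mutual
  information.\<close>

lemma whp_list_dens:
  fixes J :: "('a::countable \<times> 'b::countable) pmf"
  assumes fin: "finite (set_pmf J)" and "\<eta> > 0"
  shows "whp (\<lambda>n. iid_pair n J) (\<lambda>n z. exp (real n * (mutual_info J - \<eta>)) \<le> list_dens J (fst z) (snd z) \<and>
     list_dens J (fst z) (snd z) \<le> exp (real n * (mutual_info J + \<eta>)))"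
proof -
  let ?i = "\<lambda>z. ln (dens J (fst z) (snd z))"
  have pos: "dens J a b > 0" if "(a, b) \<in> set_pmf J" for a b
  proof -
    have "a \<in> set_pmf (map_pmf fst J)" "b \<in> set_pmf (map_pmf snd J)" using that by force+
    then show ?thesis using that unfolding dens_def by (simp add: pmf_positive del: set_map_pmf)
  qed
  have *: "list_dens J (map fst zs) (map snd zs) = exp (sum_list (map ?i zs))" if "set zs \<subseteq> set_pmf J" for zs
    using that by (induction zs) (auto simp: list_dens_Nil list_dens_Cons exp_add pos)
  show ?thesis
    unfolding iid_pair_def whp_map fst_conv snd_conv mutual_info_eq_expect[OF fin]
  proof (rule whp_mono[OF iid_lln[OF assms, of ?i]], rule always_eventually, safe)
    fix n zs assume "zs \<in> set_pmf (replicate_pmf n J)"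
      and i: "\<bar>sum_list (map ?i zs) - real n * expect J ?i\<bar> \<le> real n * \<eta>"
    then have "list_dens J (map fst zs) (map snd zs) = exp (sum_list (map ?i zs))"
      by (intro *) (simp add: in_set_replicate_pmf)
    then show "exp (real n * (expect J ?i - \<eta>)) \<le> list_dens J (map fst zs) (map snd zs)"
      "list_dens J (map fst zs) (map snd zs) \<le> exp (real n * (expect J ?i + \<eta>))"
      using i by (auto simp: algebra_simps abs_le_iff)
  qed
qed

lemma iid_pair_Suc:
  "iid_pair (Suc n) P = bind_pmf P (\<lambda>z. bind_pmf (iid_pair n P) (\<lambda>zs. return_pmf (fst z # fst zs, snd z # snd zs)))"
  by (simp add: iid_pair_def map_bind_pmf bind_map_pmf map_pmf_def bind_assoc_pmf bind_return_pmf)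

text \<open>The Markov chain Y - X - U for words: given the X-word, the Y-word and the codeword are
  drawn independently. The proof only reorders the independent draws.\<close>

lemma iid_pair_mix:
  "iid_pair n (bind_pmf S (\<lambda>x. pair_pmf (W x) (K x))) =
    bind_pmf (replicate_pmf n S) (\<lambda>xs. pair_pmf (kpow W xs) (kpow K xs))"
proof (induction n)
  case 0
  show ?case by (simp add: iid_pair_def bind_return_pmf pair_pmf_def)
next
  case (Suc n)
  let ?r = "\<lambda>y ys u us. return_pmf (y # ys, u # us)"
  have "iid_pair (Suc n) (bind_pmf S (\<lambda>x. pair_pmf (W x) (K x))) = bind_pmf S (\<lambda>x. bind_pmf (W x) (\<lambda>y.
      bind_pmf (K x) (\<lambda>u. bind_pmf (replicate_pmf n S) (\<lambda>xs. bind_pmf (kpow W xs) (\<lambda>ys. bind_pmf (kpow K xs) (\<lambda>us. ?r y ys u us))))))"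
    unfolding iid_pair_Suc Suc.IH by (simp add: pair_pmf_def bind_assoc_pmf bind_return_pmf)
  also have "\<dots> = bind_pmf S (\<lambda>x. bind_pmf (W x) (\<lambda>y. bind_pmf (replicate_pmf n S) (\<lambda>xs.
      bind_pmf (K x) (\<lambda>u. bind_pmf (kpow W xs) (\<lambda>ys. bind_pmf (kpow K xs) (\<lambda>us. ?r y ys u us))))))"
    by (intro bind_pmf_cong refl bind_commute_pmf)
  also have "\<dots> = bind_pmf S (\<lambda>x. bind_pmf (replicate_pmf n S) (\<lambda>xs. bind_pmf (W x) (\<lambda>y.
      bind_pmf (K x) (\<lambda>u. bind_pmf (kpow W xs) (\<lambda>ys. bind_pmf (kpow K xs) (\<lambda>us. ?r y ys u us))))))"
    by (intro bind_pmf_cong refl bind_commute_pmf)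
  also have "\<dots> = bind_pmf S (\<lambda>x. bind_pmf (replicate_pmf n S) (\<lambda>xs. bind_pmf (W x) (\<lambda>y.
      bind_pmf (kpow W xs) (\<lambda>ys. bind_pmf (K x) (\<lambda>u. bind_pmf (kpow K xs) (\<lambda>us. ?r y ys u us))))))"
    by (intro bind_pmf_cong refl bind_commute_pmf)
  also have "\<dots> = bind_pmf (replicate_pmf (Suc n) S) (\<lambda>xs. pair_pmf (kpow W xs) (kpow K xs))"
    by (simp add: pair_pmf_def map_pmf_def bind_assoc_pmf bind_return_pmf)
  finally show ?case .
qed

lemma kpow_const: "kpow (\<lambda>_. q) xs = replicate_pmf (length xs) q"
  by (induction xs) (simp_all add: map_pmf_def)

lemma pmf_kpow_eq_list_dens:
  fixes S :: "'x::finite pmf" and K :: "'x \<Rightarrow> 'u pmf"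
  assumes "set xs \<subseteq> set_pmf S" "length us = length xs" and fin: "\<And>x. finite (set_pmf (K x))"
  shows "pmf (kpow K xs) us = list_dens (joint S K) us xs * pmf (replicate_pmf (length xs) (bind_pmf S K)) us"
  using assms(2,1)
proof (induction us xs rule: list_induct2)
  case Nil
  then show ?case by (simp add: list_dens_Nil)
next
  case (Cons u us x xs)
  have x: "pmf S x \<noteq> 0" using Cons.prems by (simp add: set_pmf_iff)
  have finU: "finite (set_pmf (bind_pmf S K))" using fin by simp
  have "pmf (K x) u = dens (joint S K) u x * pmf (bind_pmf S K) u"
  proof (cases "pmf (bind_pmf S K) u = 0")
    case True
    then have "pmf S x * pmf (K x) u = 0"
      unfolding pmf_bind_UNIV by (subst (asm) sum_nonneg_eq_0_iff) auto
    then show ?thesis using x True by simp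
  next
    case False
    then show ?thesis using x by (simp add: dens_def pmf_joint)
  qed
  then show ?case using Cons
    by (simp add: pmf_kpow_Cons pmf_replicate_Cons[OF finU] list_dens_Cons mult_ac del: kpow.simps replicate_pmf.simps)
qed

lemma prob_eq_expect:
  assumes "finite (set_pmf p)"
  shows "measure_pmf.prob p {x. A x} = expect p (\<lambda>x. of_bool (A x))"
  unfolding expect_indicator[OF assms, symmetric] by (rule expect_cong) (simp add: indicator_def)

text \<open>Below \<open>R\<close> the law of large numbers has room for its error. For the constant
  kernel the law of the codeword does not depend on the X-word, and \<open>R \<ge> 0\<close>
  suffices.\<close>

lemma whp_kernel_density:
  fixes S :: "'x::finite pmf" and K :: "'x \<Rightarrow> nat pmf"
  assumes K: "K \<in> kernels" and R: "R \<ge> 0" and rate: "I_XU S K < R \<or> K = (\<lambda>_. return_pmf 0)"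
  shows "whp (\<lambda>n. iid_pair n (joint S K)) (\<lambda>n z. pmf (kpow K (snd z)) (fst z) \<le>
      exp (real n * R) * pmf (replicate_pmf n (bind_pmf S K)) (fst z))"
  using rate
proof
  have fin: "finite (set_pmf (K x))" for x using K by (simp add: kernels_def)
  then have finJ: "finite (set_pmf (joint S K))" by (simp add: joint_def)
  have len: "length (fst z) = n" "length (snd z) = n" "set (snd z) \<subseteq> set_pmf S"
    if z: "z \<in> set_pmf (iid_pair n (joint S K))" for z n
  proof -
    obtain zs where zs: "zs \<in> set_pmf (replicate_pmf n (joint S K))" "z = (map fst zs, map snd zs)"
      using z unfolding iid_pair_def set_map_pmf by blast
    then have "length zs = n" "set zs \<subseteq> set_pmf (joint S K)" by (auto simp: in_set_replicate_pmf)
    moreover have "snd ` set_pmf (joint S K) \<subseteq> set_pmf S" using map_snd_joint[of S K] by (metis order_refl set_map_pmf)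
    ultimately show "length (fst z) = n" "length (snd z) = n" "set (snd z) \<subseteq> set_pmf S"
      using zs(2) by auto
  qed
  {
    assume "I_XU S K < R"
    define \<eta> where "\<eta> = R - I_XU S K"
    have \<eta>: "\<eta> > 0" using \<open>I_XU S K < R\<close> by (simp add: \<eta>_def)
    \<comment> \<open>\<open>joint\<close> lists U first and \<open>I_XU\<close> lists X first; the
      two agree because the density is symmetric.\<close>
    have "joint S K = map_pmf prod.swap (bind_pmf S (\<lambda>x. map_pmf (\<lambda>u. (x, u)) (K x)))"
      by (simp add: joint_def map_bind_pmf pmf.map_comp o_def)
    then have "bind_pmf S (\<lambda>x. map_pmf (\<lambda>u. (x, u)) (K x)) = map_pmf prod.swap (joint S K)"
      by (simp add: pmf.map_comp o_def)
    moreover have "mutual_info (map_pmf prod.swap (joint S K)) = mutual_info (joint S K)"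
    proof -
      have d: "dens (map_pmf prod.swap (joint S K)) x u = dens (joint S K) u x" for x u
        using pmf_map_inj'[of prod.swap "joint S K" "(u, x)"]
        by (simp add: dens_def pmf.map_comp o_def mult.commute)
      show ?thesis
        using finJ d by (simp add: mutual_info_eq_expect expect_map)
    qed
    ultimately have I: "mutual_info (joint S K) = I_XU S K" by (simp add: I_XU_def)
    show ?thesis
    proof (rule whp_mono[OF whp_list_dens[OF finJ \<eta>]], rule always_eventually, safe)
      fix n and us xs assume z: "(us, xs) \<in> set_pmf (iid_pair n (joint S K))"
        and "list_dens (joint S K) (fst (us, xs)) (snd (us, xs)) \<le> exp (real n * (mutual_info (joint S K) + \<eta>))"
      then have "list_dens (joint S K) us xs \<le> exp (real n * R)" by (simp add: I \<eta>_def)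
      then show "pmf (kpow K (snd (us, xs))) (fst (us, xs)) \<le>
          exp (real n * R) * pmf (replicate_pmf n (bind_pmf S K)) (fst (us, xs))"
        using len[OF z] pmf_kpow_eq_list_dens[of xs S us K, OF _ _ fin] by (simp add: mult_right_mono)
    qed
  }
  {
    assume K0: "K = (\<lambda>_. return_pmf 0)"
    show ?thesis
    proof (rule whp_True)
      fix n z assume z: "z \<in> set_pmf (iid_pair n (joint S K))"
      have "kpow K (snd z) = replicate_pmf n (bind_pmf S K)"
        unfolding K0 kpow_const using len(2)[OF z] by simp
      moreover have "exp (real n * R) \<ge> 1" using R by simp
      ultimately show "pmf (kpow K (snd z)) (fst z) \<le> exp (real n * R) * pmf (replicate_pmf n (bind_pmf S K)) (fst z)"
        by (simp add: mult_le_cancel_right1)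
    qed
  }
qed

text \<open>One codebook serves all components in \<open>J\<close>: codewords are chosen to be good
  for each of them, and the decoder accepts if the Y-word fits the codeword under any of them. The
  union costs only the factor \<open>card J\<close> in false acceptance.\<close>

lemma class_scheme:
  fixes S :: "'x::finite pmf" and K :: "'x \<Rightarrow> nat pmf" and W :: "nat \<Rightarrow> 'x \<Rightarrow> 'y::finite pmf"
    and QY :: "nat \<Rightarrow> nat \<Rightarrow> 'y list pmf"
  assumes K: "K \<in> kernels" and R: "R \<ge> 0" and rate: "I_XU S K < R \<or> K = (\<lambda>_. return_pmf 0)"
    and J: "finite J" and G: "whp (\<lambda>n. replicate_pmf n S) G" and \<eta>: "\<eta> > 0" and \<zeta>: "\<zeta> > 0"
    and finQ: "\<And>j' n. j' \<in> {1..k} \<Longrightarrow> finite (set_pmf (QY j' n))"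
    and lr: "\<And>j j'. j \<in> J \<Longrightarrow> j' \<in> {1..k} \<Longrightarrow> lr_lower (bind_pmf S (W j)) (QY j') (c j j') \<and> ereal (d j) \<le> c j j'"
    and b: "\<And>j. j \<in> J \<Longrightarrow> b \<le> I_YU (joint S (W j)) K + d j"
  shows "eventually (\<lambda>n. \<exists>(us :: nat list list) f B. real (length us) \<le> real n * exp (real n * R) + 1 \<and>
     (\<forall>x u. f x = Some u \<longrightarrow> u \<in> set us \<and> G n x) \<and>
     (\<forall>u\<in>set us. \<forall>j'\<in>{1..k}. measure_pmf.prob (QY j' n) (B u) \<le> real (card J) * exp (- (real n * (b - 2 * \<eta>)))) \<and>
     (\<forall>j\<in>J. 1 - \<zeta> \<le> expect (replicate_pmf n S)
        (\<lambda>x. case f x of None \<Rightarrow> 0 | Some u \<Rightarrow> measure_pmf.prob (kpow (W j) x) (B u)))) sequentially"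
proof -
  have finK: "finite (set_pmf (K x))" for x using K by (simp add: kernels_def)
  define JJ where "JJ j = bind_pmf S (\<lambda>x. pair_pmf (W j x) (K x))" for j
  have finJJ: "finite (set_pmf (JJ j))" for j using finK by (simp add: JJ_def)
  have fstJJ: "map_pmf fst (JJ j) = bind_pmf S (W j)" for j
    by (simp add: JJ_def map_bind_pmf map_fst_pair_pmf)
  have I: "mutual_info (JJ j) = I_YU (joint S (W j)) K" for j
    by (simp add: I_YU_def JJ_def joint_def bind_assoc_pmf bind_map_pmf pair_pmf_def map_pmf_def bind_return_pmf)
  let ?Yn = "\<lambda>j n. replicate_pmf n (bind_pmf S (W j))"
  \<comment> \<open>The first condition makes acceptance improbable under the null marginal of Y, by
    the mutual information. The second transfers this to every reference law and gains
    \<open>d j\<close>; each loses one \<open>\<eta>\<close>.\<close>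
  define B where "B j n u = {y. exp (real n * (mutual_info (JJ j) - \<eta>)) \<le> list_dens (JJ j) y u \<and>
      (\<forall>j'\<in>{1..k}. pmf (QY j' n) y \<le> exp (- (real n * (d j - \<eta>))) * pmf (?Yn j n) y)}" for j n u
  have whpB: "whp (\<lambda>n. iid_pair n (JJ j)) (\<lambda>n z. fst z \<in> B j n (snd z))" if j: "j \<in> J" for j
  proof -
    have "whp (\<lambda>n. ?Yn j n) (\<lambda>n y. pmf (QY j' n) y \<le> exp (- (real n * (d j - \<eta>))) * pmf (?Yn j n) y)"
      if "j' \<in> {1..k}" for j'
    proof -
      have "ereal (d j - \<eta>) < c j j'" using lr[OF j that] \<eta> by (metis diff_less_eq ereal_less(2) ereal_less_eq(3) less_add_same_cancel1 less_ereal.simps(1) order_less_le_trans)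
      then show ?thesis using lr[OF j that] by (simp add: lr_lower_def)
    qed
    then have "whp (\<lambda>n. ?Yn j n) (\<lambda>n y. \<forall>j'\<in>{1..k}. pmf (QY j' n) y \<le> exp (- (real n * (d j - \<eta>))) * pmf (?Yn j n) y)"
      by (intro whp_ball) auto
    then have "whp (\<lambda>n. map_pmf fst (iid_pair n (JJ j)))
        (\<lambda>n y. \<forall>j'\<in>{1..k}. pmf (QY j' n) y \<le> exp (- (real n * (d j - \<eta>))) * pmf (?Yn j n) y)"
      by (simp add: map_fst_iid_pair fstJJ)
    then have "whp (\<lambda>n. iid_pair n (JJ j))
        (\<lambda>n z. \<forall>j'\<in>{1..k}. pmf (QY j' n) (fst z) \<le> exp (- (real n * (d j - \<eta>))) * pmf (?Yn j n) (fst z))"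
      by (simp add: whp_map)
    from whp_conj[OF whp_list_dens[OF finJJ \<eta>, of j] this] show ?thesis
      by (rule whp_mono) (auto simp: B_def)
  qed
  \<comment> \<open>Thirds for the decoder's miss on a good codeword, for inputs that are not in the
    covered class \<open>X\<close>, and for inputs of \<open>X\<close> that the codebook leaves
    uncovered.\<close>
  define \<zeta>' where "\<zeta>' = \<zeta> / 3"
  have \<zeta>': "\<zeta>' > 0" using \<zeta> by (simp add: \<zeta>'_def)
  \<comment> \<open>Solved from the requirement that the second loss in
    \<open>one_shot_cover\<close> equal \<open>\<zeta>'\<close>.\<close>
  define \<epsilon> where "\<epsilon> = \<zeta>' / (4 + 2 * real (card J) / \<zeta>')"
  have den: "4 + 2 * real (card J) / \<zeta>' > 0" using \<zeta>' by (simp add: add_pos_nonneg)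
  have \<epsilon>: "\<epsilon> > 0" using \<zeta>' den by (simp add: \<epsilon>_def)
  have \<epsilon>\<zeta>: "2 * (2 * \<epsilon> + real (card J) * \<epsilon> / \<zeta>') = \<zeta>'"
  proof -
    have "2 * (2 * \<epsilon> + real (card J) * \<epsilon> / \<zeta>') = \<epsilon> * (4 + 2 * real (card J) / \<zeta>')" by (simp add: algebra_simps)
    also have "\<dots> = \<zeta>'" using den by (simp add: \<epsilon>_def)
    finally show ?thesis .
  qed
  have ev_exp: "eventually (\<lambda>n. exp (- (real n / 2)) \<le> \<zeta>') sequentially"
    using eventually_le_linear[of "1 / 2" "- ln \<zeta>'"]
  proof (rule eventually_mono)
    fix n assume "- ln \<zeta>' \<le> real n * (1 / 2)"
    then have "exp (- (real n / 2)) \<le> exp (ln \<zeta>')" by (subst exp_le_cancel_iff) simp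
    then show "exp (- (real n / 2)) \<le> \<zeta>'" using \<zeta>' by simp
  qed simp
  have ev_B: "eventually (\<lambda>n. \<forall>j\<in>J. measure_pmf.prob (iid_pair n (JJ j)) {z. \<not> fst z \<in> B j n (snd z)} \<le> \<epsilon>) sequentially"
    using J whpD[OF whpB \<epsilon>] by (intro eventually_ball_finite) auto
  show ?thesis
    using ev_exp ev_B whpD[OF G \<epsilon>] whpD[OF whp_kernel_density[OF K R rate] \<epsilon>]
  proof eventually_elim
    case (elim n)
    let ?p = "replicate_pmf n S" and ?q = "replicate_pmf n (bind_pmf S K)" and ?L = "exp (real n * R)"
    \<comment> \<open>The factor n before \<open>exp (n R)\<close> makes the uncovered probability
      at most \<open>exp (- n / 2)\<close> and leaves the rate unchanged.\<close>
    define N where "N = nat \<lceil>real n * ?L\<rceil>"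
    have N: "real N \<le> real n * ?L + 1" "real n * ?L \<le> real N"
      unfolding N_def by (simp_all add: of_nat_nat)
    have fin: "finite (set_pmf ?p)" "finite (set_pmf ?q)" "\<And>x. finite (set_pmf (kpow K x))"
      "\<And>j x. finite (set_pmf (kpow (W j) x))"
      using finK by (simp_all add: finite_set_replicate_pmf finite_set_kpow)
    have L: "?L \<ge> 1" using R by simp
    obtain us f where us: "length us = N" "set us \<subseteq> set_pmf ?q" "\<And>x u. f x = Some u \<Longrightarrow> u \<in> set us \<and> G n x"
      and good: "\<And>j. j \<in> J \<Longrightarrow> expect ?p (\<lambda>x. case f x of None \<Rightarrow> 0 | Some u \<Rightarrow> measure_pmf.prob (kpow (W j) x) (B j n u)) \<ge>
        1 - \<zeta>' - 2 * (2 * \<epsilon> + real (card J) * \<epsilon> / \<zeta>') - (1 - 1 / (2 * ?L)) ^ N"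
    proof (rule one_shot_cover[OF fin(1,2,3) J L \<zeta>' elim(3), where V = "\<lambda>j. kpow (W j)" and B = "\<lambda>j. B j n" and N = N])
      have "expect ?p (\<lambda>x. measure_pmf.prob (kpow K x) {u. \<not> pmf (kpow K x) u \<le> ?L * pmf ?q u}) =
          measure_pmf.prob (iid_pair n (joint S K)) {z. \<not> pmf (kpow K (snd z)) (fst z) \<le> ?L * pmf ?q (fst z)}"
        unfolding iid_pair_joint using fin
        by (simp add: expect_bind expect_map prob_eq_expect)
      then show "expect ?p (\<lambda>x. measure_pmf.prob (kpow K x) {u. \<not> pmf (kpow K x) u \<le> ?L * pmf ?q u}) \<le> \<epsilon>"
        using elim(4) by simp
      fix j assume j: "j \<in> J"
      have "expect ?p (\<lambda>x. expect (kpow K x) (\<lambda>u. measure_pmf.prob (kpow (W j) x) {y. y \<notin> B j n u})) =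
          measure_pmf.prob (iid_pair n (JJ j)) {z. \<not> fst z \<in> B j n (snd z)}"
        unfolding JJ_def iid_pair_mix using fin
        by (simp add: expect_bind expect_pair_pmf' prob_eq_expect)
      then show "expect ?p (\<lambda>x. expect (kpow K x) (\<lambda>u. measure_pmf.prob (kpow (W j) x) {y. y \<notin> B j n u})) \<le> \<epsilon>"
        using elim(2) j by simp
    qed (blast intro: that)
    have "1 / (2 * ?L) \<le> 1 / 1" by (rule frac_le) (use L in linarith)+
    then have "(1 - 1 / (2 * ?L)) ^ N \<le> exp (- (1 / (2 * ?L))) ^ N"
      using exp_ge_add_one_self[of "- (1 / (2 * ?L))"] by (intro power_mono) linarith+
    also have "\<dots> = exp (- (real N / (2 * ?L)))" by (simp flip: exp_of_nat_mult)
    also have "\<dots> \<le> exp (- (real n / 2))"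
    proof -
      have "real n * ?L / (2 * ?L) \<le> real N / (2 * ?L)" using N(2) by (intro divide_right_mono) auto
      then show ?thesis by simp
    qed
    also note elim(1)
    finally have tail: "(1 - 1 / (2 * ?L)) ^ N \<le> \<zeta>'" .
    let ?B = "\<lambda>u. \<Union>j\<in>J. B j n u"
    show ?case
    proof (rule exI[of _ us], rule exI[of _ f], rule exI[of _ ?B], intro conjI allI ballI impI)
      show "real (length us) \<le> real n * exp (real n * R) + 1" using us(1) N(1) by simp
      show "u \<in> set us" "G n x" if "f x = Some u" for x u using us(3)[OF that] by auto
      show "measure_pmf.prob (QY j' n) (?B u) \<le> real (card J) * exp (- (real n * (b - 2 * \<eta>)))"
        if u: "u \<in> set us" and j': "j' \<in> {1..k}" for u j'
      proof -
        have len: "length u = n" using us(2) u by (auto simp: in_set_replicate_pmf simp del: replicate_pmf.simps)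
        have "measure_pmf.prob (QY j' n) (?B u) \<le> (\<Sum>j\<in>J. measure_pmf.prob (QY j' n) (B j n u))"
          using J by (intro measure_pmf.finite_measure_subadditive_finite) auto
        also have "\<dots> \<le> (\<Sum>j\<in>J. exp (- (real n * (b - 2 * \<eta>))))"
        proof (rule sum_mono)
          fix j assume j: "j \<in> J"
          have "measure_pmf.prob (QY j' n) (B j n u) \<le> exp (- (real n * (d j - \<eta>))) * measure_pmf.prob (?Yn j n) (B j n u)"
            using j' by (intro prob_le_cmult finQ) (auto simp: B_def)
          also have "measure_pmf.prob (?Yn j n) (B j n u) \<le> exp (- (real n * (mutual_info (JJ j) - \<eta>)))"
          proof -
            have "measure_pmf.prob (?Yn j n) (B j n u) \<le> measure_pmf.prob (?Yn j n) {y. exp (real n * (mutual_info (JJ j) - \<eta>)) \<le> list_dens (JJ j) y u}"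
              by (intro measure_pmf.finite_measure_mono) (auto simp: B_def)
            also have "\<dots> \<le> exp (- (real n * (mutual_info (JJ j) - \<eta>)))"
              using prob_list_dens_le[OF finJJ, of u j "real n * (mutual_info (JJ j) - \<eta>)"] by (simp add: len fstJJ)
            finally show ?thesis .
          qed
          also have "exp (- (real n * (d j - \<eta>))) * exp (- (real n * (mutual_info (JJ j) - \<eta>))) =
              exp (- (real n * (mutual_info (JJ j) + d j - 2 * \<eta>)))"
            by (simp add: algebra_simps flip: exp_add)
          also have "\<dots> \<le> exp (- (real n * (b - 2 * \<eta>)))"
            using b[OF j] by (simp add: I mult_left_mono)
          finally show "measure_pmf.prob (QY j' n) (B j n u) \<le> exp (- (real n * (b - 2 * \<eta>)))" by simp
        qed
        finally show ?thesis by simp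
      qed
      show "1 - \<zeta> \<le> expect ?p (\<lambda>x. case f x of None \<Rightarrow> 0 | Some u \<Rightarrow> measure_pmf.prob (kpow (W j) x) (?B u))" if j: "j \<in> J" for j
      proof -
        have "1 - \<zeta> \<le> 1 - \<zeta>' - 2 * (2 * \<epsilon> + real (card J) * \<epsilon> / \<zeta>') - (1 - 1 / (2 * ?L)) ^ N"
          unfolding \<epsilon>\<zeta> using tail by (simp add: \<zeta>'_def)
        also note good[OF j]
        also have "expect ?p (\<lambda>x. case f x of None \<Rightarrow> 0 | Some u \<Rightarrow> measure_pmf.prob (kpow (W j) x) (B j n u)) \<le>
            expect ?p (\<lambda>x. case f x of None \<Rightarrow> 0 | Some u \<Rightarrow> measure_pmf.prob (kpow (W j) x) (?B u))"
          using j by (intro expect_mono) (auto split: option.split intro!: measure_pmf.finite_measure_mono)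
        finally show ?thesis .
      qed
    qed
  qed
qed

section \<open>Joining the classes\<close>

text \<open>The message names the class together with a codeword. Since the sets \<open>G S\<close>
  are disjoint, an X-word is encoded for at most one class, and the errors of the single schemes do
  not interfere.\<close>

lemma combine_step:
  fixes Ss :: "'x::finite pmf set" and W :: "nat \<Rightarrow> 'x \<Rightarrow> 'y::finite pmf"
    and us :: "'x pmf \<Rightarrow> nat list list" and f :: "'x pmf \<Rightarrow> 'x list \<Rightarrow> nat list option"
    and B :: "'x pmf \<Rightarrow> nat list \<Rightarrow> 'y list set" and G :: "'x pmf \<Rightarrow> 'x list \<Rightarrow> bool"
  assumes Ss: "finite Ss"
    and disj: "\<And>S S' x. S \<in> Ss \<Longrightarrow> S' \<in> Ss \<Longrightarrow> G S x \<Longrightarrow> G S' x \<Longrightarrow> S = S'"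
    and f: "\<And>S x u. S \<in> Ss \<Longrightarrow> f S x = Some u \<Longrightarrow> u \<in> set (us S) \<and> G S x"
  obtains M \<phi> \<psi> where "encoder n M \<phi>" "card M \<le> (\<Sum>S\<in>Ss. length (us S)) + 1"
    "\<And>S j. S \<in> Ss \<Longrightarrow> expect (replicate_pmf n S)
        (\<lambda>x. case f S x of None \<Rightarrow> 0 | Some u \<Rightarrow> measure_pmf.prob (kpow (W j) x) (B S u))
      \<le> prob_H0 (compressed \<phi> (iid_pair n (joint S (W j)))) \<psi>"
    "\<And>qY qX c. finite (set_pmf qY) \<Longrightarrow> finite (set_pmf qX) \<Longrightarrow>
      (\<And>S u. S \<in> Ss \<Longrightarrow> u \<in> set (us S) \<Longrightarrow> measure_pmf.prob qX {x. G S x} * measure_pmf.prob qY (B S u) \<le> c) \<Longrightarrow> c \<ge> 0 \<Longrightarrow>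
      prob_H0 (compressed \<phi> (pair_pmf qY qX)) \<psi> \<le> real (card Ss) * c"
proof -
  define h where "h x = (if \<exists>S\<in>Ss. f S x \<noteq> None
      then let S = (SOME S. S \<in> Ss \<and> f S x \<noteq> None) in Some (S, the (f S x)) else None)" for x
  have h1: "S \<in> Ss \<and> f S x = Some u" if "h x = Some (S, u)" for x S u
  proof -
    have ex: "\<exists>S. S \<in> Ss \<and> f S x \<noteq> None" using that by (auto simp: h_def split: if_splits)
    then have "S = (SOME S. S \<in> Ss \<and> f S x \<noteq> None)" "u = the (f S x)"
      using that by (auto simp: h_def Let_def split: if_splits)
    then show ?thesis using someI_ex[OF ex] by auto
  qed
  have h2: "h x = Some (S, u)" if "S \<in> Ss" "f S x = Some u" for x S u
  proof -
    have "\<exists>S\<in>Ss. f S x \<noteq> None" using that by auto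
    then obtain S' u' where h: "h x = Some (S', u')" by (auto simp: h_def Let_def)
    from h1[OF this] have S': "S' \<in> Ss" "f S' x = Some u'" by auto
    have "S' = S" using disj[OF S'(1) that(1)] f[OF S'] f[OF that] by blast
    then show ?thesis using h S' that by simp
  qed
  \<comment> \<open>\<open>None\<close> is for X-words without a codeword; the decoder rejects on
    it. It accounts for the extra message in the size.\<close>
  define MS where "MS = insert None (Some ` (SIGMA S:Ss. set (us S)))"
  have finMS: "finite MS" using Ss by (simp add: MS_def)
  have hMS: "h x \<in> MS" for x
  proof (cases "h x")
    case (Some p)
    then obtain S u where "h x = Some (S, u)" by (cases p) auto
    then show ?thesis using h1[of x S u] f[of S x u] by (auto simp: MS_def)
  qed (simp add: MS_def)
  obtain code :: "_ \<Rightarrow> nat" where code: "inj_on code MS"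
    using finite_imp_inj_to_nat_seg[OF finMS] by blast
  define \<phi> where "\<phi> x = code (h x)" for x
  define \<psi> where "\<psi> z = return_pmf (if \<exists>S u. Some (S, u) \<in> MS \<and> snd z = code (Some (S, u)) \<and> fst z \<in> B S u then H0 else H1)"
    for z :: "'y list \<times> nat"
  have accept: "pmf (\<psi> (y, \<phi> x)) H0 = (case h x of None \<Rightarrow> 0 | Some (S, u) \<Rightarrow> indicator (B S u) y)" for x y
  proof -
    have "code (h x) = code (Some (S, u)) \<longleftrightarrow> h x = Some (S, u)" if "Some (S, u) \<in> MS" for S u
      using inj_on_eq_iff[OF code hMS that] .
    then have "(\<exists>S u. Some (S, u) \<in> MS \<and> \<phi> x = code (Some (S, u)) \<and> y \<in> B S u) \<longleftrightarrow> (\<exists>S u. h x = Some (S, u) \<and> y \<in> B S u)"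
      unfolding \<phi>_def using hMS by metis
    then show ?thesis by (auto simp: \<psi>_def indicator_def split: option.split)
  qed
  show ?thesis
  proof (rule that[of "code ` MS" \<phi> \<psi>])
    show "encoder n (code ` MS) \<phi>" using finMS hMS by (auto simp: encoder_def \<phi>_def)
    have "card (code ` MS) \<le> card MS" using finMS by (rule card_image_le)
    also have "\<dots> \<le> card (Some ` (SIGMA S:Ss. set (us S))) + 1"
      unfolding MS_def using Ss by (subst card_insert_if) auto
    also have "card (Some ` (SIGMA S:Ss. set (us S))) \<le> (\<Sum>S\<in>Ss. length (us S))"
      using Ss by (subst card_image) (auto simp: card_SigmaI intro!: sum_mono card_length)
    finally show "card (code ` MS) \<le> (\<Sum>S\<in>Ss. length (us S)) + 1" by simp
  next
    fix S j assume S: "S \<in> Ss"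
    have "prob_H0 (compressed \<phi> (iid_pair n (joint S (W j)))) \<psi> =
       expect (replicate_pmf n S) (\<lambda>x. expect (kpow (W j) x) (\<lambda>y. case h x of None \<Rightarrow> 0 | Some (S, u) \<Rightarrow> indicator (B S u) y))"
      by (subst prob_H0_eq) (simp add: finite_set_iid_pair, simp only: expect_iid_pair_joint fst_conv snd_conv accept)
    also have "\<dots> \<ge> expect (replicate_pmf n S)
        (\<lambda>x. case f S x of None \<Rightarrow> 0 | Some u \<Rightarrow> measure_pmf.prob (kpow (W j) x) (B S u))"
    proof (rule expect_mono)
      fix x
      show "(case f S x of None \<Rightarrow> 0 | Some u \<Rightarrow> measure_pmf.prob (kpow (W j) x) (B S u)) \<le>
          expect (kpow (W j) x) (\<lambda>y. case h x of None \<Rightarrow> 0 | Some (S, u) \<Rightarrow> indicator (B S u) y)"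
      proof (cases "f S x")
        case None
        then show ?thesis by (auto intro!: expect_nonneg split: option.split)
      next
        case (Some u)
        then show ?thesis by (simp add: h2[OF S Some] expect_indicator finite_set_kpow)
      qed
    qed
    finally show "expect (replicate_pmf n S)
        (\<lambda>x. case f S x of None \<Rightarrow> 0 | Some u \<Rightarrow> measure_pmf.prob (kpow (W j) x) (B S u))
      \<le> prob_H0 (compressed \<phi> (iid_pair n (joint S (W j)))) \<psi>" .
  next
    fix qY :: "'y list pmf" and qX :: "'x list pmf" and c :: real
    assume fin: "finite (set_pmf qY)" "finite (set_pmf qX)" and c: "c \<ge> 0"
      and bound: "\<And>S u. S \<in> Ss \<Longrightarrow> u \<in> set (us S) \<Longrightarrow> measure_pmf.prob qX {x. G S x} * measure_pmf.prob qY (B S u) \<le> c"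
    \<comment> \<open>Given the X-word, exactly one codeword is tested against Y. So false
      acceptance is bounded by the worst codeword of each class, and the size of the codebook does
      not appear as a factor.\<close>
    define bm where "bm S = Max (insert 0 ((\<lambda>u. measure_pmf.prob qY (B S u)) ` set (us S)))" for S
    have bm: "measure_pmf.prob qY (B S u) \<le> bm S" if "u \<in> set (us S)" for S u
      unfolding bm_def using that by (intro Max_ge) auto
    have bm0: "0 \<le> bm S" for S unfolding bm_def by (intro Max_ge) auto
    have bmc: "measure_pmf.prob qX {x. G S x} * bm S \<le> c" if "S \<in> Ss" for S
    proof -
      have "bm S \<in> insert 0 ((\<lambda>u. measure_pmf.prob qY (B S u)) ` set (us S))"
        unfolding bm_def by (intro Max_in) auto
      then show ?thesis using bound[OF that] c by auto
    qed
    have "prob_H0 (compressed \<phi> (pair_pmf qY qX)) \<psi> =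
       expect qX (\<lambda>x. expect qY (\<lambda>y. case h x of None \<Rightarrow> 0 | Some (S, u) \<Rightarrow> indicator (B S u) y))"
      using fin by (subst prob_H0_eq) (simp, simp only: expect_pair_pmf'[OF fin] fst_conv snd_conv accept)
    also have "\<dots> \<le> expect qX (\<lambda>x. \<Sum>S\<in>Ss. bm S * indicator {x. G S x} x)"
    proof (rule expect_mono)
      fix x
      show "expect qY (\<lambda>y. case h x of None \<Rightarrow> 0 | Some (S, u) \<Rightarrow> indicator (B S u) y) \<le>
          (\<Sum>S\<in>Ss. bm S * indicator {x. G S x} x)"
      proof (cases "h x")
        case None
        then show ?thesis using fin by (simp add: sum_nonneg bm0)
      next
        case (Some p)
        then obtain S u where Su: "h x = Some (S, u)" by (cases p) auto
        from h1[OF Su] have S: "S \<in> Ss" "u \<in> set (us S)" "G S x" using f by auto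
        have "expect qY (\<lambda>y. case h x of None \<Rightarrow> 0 | Some (S, u) \<Rightarrow> indicator (B S u) y) = measure_pmf.prob qY (B S u)"
          by (simp add: Su expect_indicator fin)
        also have "\<dots> \<le> bm S * indicator {x. G S x} x" using bm[OF S(2)] S(3) by simp
        also have "\<dots> \<le> (\<Sum>S\<in>Ss. bm S * indicator {x. G S x} x)"
          using S(1) Ss by (intro member_le_sum) (auto simp: bm0)
        finally show ?thesis .
      qed
    qed
    also have "\<dots> = (\<Sum>S\<in>Ss. measure_pmf.prob qX {x. G S x} * bm S)"
      by (simp add: expect_sum expect_cmult expect_indicator fin mult.commute)
    also have "\<dots> \<le> real (card Ss) * c" using bmc by (intro sum_bounded_above)
    finally show "prob_H0 (compressed \<phi> (pair_pmf qY qX)) \<psi> \<le> real (card Ss) * c" .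
  qed
qed

text \<open>Distinct laws differ at some letter; its count is asked to lie within half the gap of
  the expected count. The inequality is strict so that the classes are disjoint at every length,
  including 0.\<close>

lemma whp_separated:
  fixes Ss :: "'x::finite pmf set"
  assumes Ss: "finite Ss"
  obtains T :: "'x pmf \<Rightarrow> nat \<Rightarrow> 'x list \<Rightarrow> bool" where
    "\<And>S. whp (\<lambda>n. replicate_pmf n S) (T S)"
    "\<And>S S' n xs. S \<in> Ss \<Longrightarrow> S' \<in> Ss \<Longrightarrow> T S n xs \<Longrightarrow> T S' n xs \<Longrightarrow> S = S'"
proof
  define cnt where "cnt a xs = sum_list (map (indicator {a}) xs :: real list)" for a :: 'x and xs
  let ?T = "\<lambda>S n xs. \<forall>a\<in>UNIV. \<forall>S'\<in>Ss. pmf S' a \<noteq> pmf S a \<longrightarrow> \<bar>cnt a xs - real n * pmf S a\<bar> < real n * (\<bar>pmf S a - pmf S' a\<bar> / 2)"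
  show "whp (\<lambda>n. replicate_pmf n S) (?T S)" for S
  proof (intro whp_ball Ss finite)
    fix a S'
    show "whp (\<lambda>n. replicate_pmf n S) (\<lambda>n xs. pmf S' a \<noteq> pmf S a \<longrightarrow> \<bar>cnt a xs - real n * pmf S a\<bar> < real n * (\<bar>pmf S a - pmf S' a\<bar> / 2))"
    proof (cases "pmf S' a = pmf S a")
      case True
      then show ?thesis by (intro whp_True) simp
    next
      case False
      then have pos: "\<bar>pmf S a - pmf S' a\<bar> / 4 > 0" by simp
      have "expect S (indicator {a}) = pmf S a" by (simp add: expect_indicator measure_pmf_single)
      then have "whp (\<lambda>n. replicate_pmf n S) (\<lambda>n xs. \<bar>cnt a xs - real n * pmf S a\<bar> \<le> real n * (\<bar>pmf S a - pmf S' a\<bar> / 4))"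
        using iid_lln[OF _ pos, of S "indicator {a}"] by (simp add: cnt_def)
      then show ?thesis
      proof (rule whp_mono)
        show "eventually (\<lambda>n. \<forall>xs\<in>set_pmf (replicate_pmf n S). \<bar>cnt a xs - real n * pmf S a\<bar> \<le> real n * (\<bar>pmf S a - pmf S' a\<bar> / 4) \<longrightarrow>
          pmf S' a \<noteq> pmf S a \<longrightarrow> \<bar>cnt a xs - real n * pmf S a\<bar> < real n * (\<bar>pmf S a - pmf S' a\<bar> / 2)) sequentially"
          using eventually_gt_at_top[of 0]
        proof eventually_elim
          case (elim n)
          have "real n * (\<bar>pmf S a - pmf S' a\<bar> / 4) < real n * (\<bar>pmf S a - pmf S' a\<bar> / 2)"
            using elim False by (intro mult_strict_left_mono) auto
          then show ?case by force
        qed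
      qed
    qed
  qed
  fix S S' n xs
  assume S: "S \<in> Ss" "S' \<in> Ss" and T: "?T S n xs" "?T S' n xs"
  show "S = S'"
  proof (rule ccontr)
    assume "S \<noteq> S'"
    then obtain a where a: "pmf S a \<noteq> pmf S' a" by (metis pmf_eqI)
    have 1: "\<bar>cnt a xs - real n * pmf S a\<bar> < real n * (\<bar>pmf S a - pmf S' a\<bar> / 2)" using T(1) S(2) a by force
    have 2: "\<bar>cnt a xs - real n * pmf S' a\<bar> < real n * (\<bar>pmf S a - pmf S' a\<bar> / 2)"
      using T(2) S(1) a by (force simp: abs_minus_commute)
    have "real n * \<bar>pmf S a - pmf S' a\<bar> = \<bar>real n * pmf S a - real n * pmf S' a\<bar>"
      by (simp add: abs_mult flip: right_diff_distrib)
    also have "\<dots> \<le> \<bar>cnt a xs - real n * pmf S a\<bar> + \<bar>cnt a xs - real n * pmf S' a\<bar>" by linarith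
    also have "\<dots> < real n * \<bar>pmf S a - pmf S' a\<bar>" using 1 2 by (simp add: field_simps)
    finally show False by simp
  qed
qed

lemma prob_H0_le_1: "prob_H0 P \<psi> \<le> 1" and prob_H0_nonneg: "0 \<le> prob_H0 P \<psi>"
  by (simp_all add: prob_H0_def pmf_le_1)

text \<open>No rate at which \<open>\<zeta>\<close> may tend to 0 is given; schemes that almost minimize the error of the first kind
  diagonalize over \<open>\<zeta>\<close>.\<close>

lemma achievableI:
  fixes P Q :: "nat \<Rightarrow> ('y list \<times> 'x list) pmf"
  assumes C: "C \<ge> 1" and R: "R \<ge> 0" and E: "E < E'"
    and schemes: "\<And>\<zeta>. \<zeta> > 0 \<Longrightarrow> eventually (\<lambda>n. \<exists>M \<phi> \<psi>. encoder n M \<phi> \<and>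
        real (card M) \<le> C * (real n + 1) * exp (real n * R) \<and>
        prob_H0 (compressed \<phi> (Q n)) \<psi> \<le> C * exp (- (real n * E')) \<and>
        1 - prob_H0 (compressed \<phi> (P n)) \<psi> \<le> \<epsilon> + \<zeta>) sequentially"
  shows "achievable P Q \<epsilon> R E"
proof -
  define ok where "ok n s \<longleftrightarrow> (case s of (M, \<phi>, \<psi>) \<Rightarrow> encoder n M \<phi> \<and>
        real (card M) \<le> C * (real n + 1) * exp (real n * R) \<and>
        prob_H0 (compressed \<phi> (Q n)) \<psi> \<le> C * exp (- (real n * E')))" for n and s :: "nat set \<times> ('x list \<Rightarrow> nat) \<times> ('y list \<times> nat \<Rightarrow> hypothesis pmf)"
  define val where "val n s = (case s of (M, \<phi>, \<psi>) \<Rightarrow> 1 - prob_H0 (compressed \<phi> (P n)) \<psi>)"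
    for n and s :: "nat set \<times> ('x list \<Rightarrow> nat) \<times> ('y list \<times> nat \<Rightarrow> hypothesis pmf)"
  \<comment> \<open>The test that always rejects meets both constraints, so at every length there is
    something to minimize over, even before the given schemes exist.\<close>
  have ex: "\<exists>s. ok n s" for n
  proof -
    have "1 * 1 * 1 \<le> C * (real n + 1) * exp (real n * R)"
      using C R by (intro mult_mono) auto
    moreover have "prob_H0 (compressed (\<lambda>_. 0) (Q n)) (\<lambda>_. return_pmf H1) = 0" by (simp add: prob_H0_def)
    ultimately have "ok n ({0}, \<lambda>_. 0, \<lambda>_. return_pmf H1)" using C by (simp add: ok_def encoder_def)
    then show ?thesis by blast
  qed
  have bdd: "bdd_below (val n ` Collect (ok n))" for n
    by (rule bdd_belowI[of _ 0]) (auto simp: val_def prob_H0_le_1)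
  \<comment> \<open>The infimum need not be attained; the vanishing slack avoids the
    question.\<close>
  have "\<exists>s. ok n s \<and> val n s < Inf (val n ` Collect (ok n)) + 1 / (real n + 1)" for n
  proof -
    have "Inf (val n ` Collect (ok n)) < Inf (val n ` Collect (ok n)) + 1 / (real n + 1)" by simp
    then show ?thesis using ex[of n] by (subst (asm) cInf_less_iff[OF _ bdd]) auto
  qed
  then obtain s where s: "\<And>n. ok n (s n)" "\<And>n. val n (s n) < Inf (val n ` Collect (ok n)) + 1 / (real n + 1)" by metis
  define M where "M n = fst (s n)" for n
  define \<phi> where "\<phi> n = fst (snd (s n))" for n
  define \<psi> where "\<psi> n = snd (snd (s n))" for n
  have ok: "encoder n (M n) (\<phi> n)" "real (card (M n)) \<le> C * (real n + 1) * exp (real n * R)"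
    "prob_H0 (compressed (\<phi> n) (Q n)) (\<psi> n) \<le> C * exp (- (real n * E'))" for n
    using s(1)[of n] by (auto simp: ok_def M_def \<phi>_def \<psi>_def split: prod.splits)
  have val: "val n (s n) = 1 - prob_H0 (compressed (\<phi> n) (P n)) (\<psi> n)" for n
    by (auto simp: val_def \<phi>_def \<psi>_def split: prod.splits)
  have \<alpha>: "limsup (\<lambda>n. ereal (1 - prob_H0 (compressed (\<phi> n) (P n)) (\<psi> n))) \<le> ereal \<epsilon>"
  proof (rule ereal_le_epsilon2)
    fix e :: real assume e: "e > 0"
    have "eventually (\<lambda>n. 1 / (real n + 1) < e / 2) sequentially"
      by (rule order_tendstoD(2)[of _ 0], real_asymp) (use e in simp)
    moreover have "e / 2 > 0" using e by simp
    note schemes[OF this]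
    ultimately have "eventually (\<lambda>n. ereal (1 - prob_H0 (compressed (\<phi> n) (P n)) (\<psi> n)) \<le> ereal (\<epsilon> + e)) sequentially"
    proof eventually_elim
      case (elim n)
      then obtain M' \<phi>' \<psi>' where "ok n (M', \<phi>', \<psi>')" "val n (M', \<phi>', \<psi>') \<le> \<epsilon> + e / 2"
        by (auto simp: ok_def val_def)
      then have "Inf (val n ` Collect (ok n)) \<le> \<epsilon> + e / 2"
        by (intro cInf_lower2[OF _ _ bdd]) auto
      then show ?case using s(2)[of n] elim(1) by (simp add: val)
    qed
    then have "limsup (\<lambda>n. ereal (1 - prob_H0 (compressed (\<phi> n) (P n)) (\<psi> n))) \<le> ereal (\<epsilon> + e)"
      by (rule Limsup_bounded)
    then show "limsup (\<lambda>n. ereal (1 - prob_H0 (compressed (\<phi> n) (P n)) (\<psi> n))) \<le> ereal \<epsilon> + ereal e" by simp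
  qed
  have \<beta>: "liminf (\<lambda>n. ereal (1 / real n) * log_inv (prob_H0 (compressed (\<phi> n) (Q n)) (\<psi> n))) \<ge> ereal E"
  proof (rule Liminf_bounded)
    have "E' - E > 0" using E by simp
    from eventually_le_linear[OF this, of "ln C"] eventually_gt_at_top[of 0]
    show "eventually (\<lambda>n. ereal E \<le> ereal (1 / real n) * log_inv (prob_H0 (compressed (\<phi> n) (Q n)) (\<psi> n))) sequentially"
    proof eventually_elim
      case (elim n)
      define b where "b = prob_H0 (compressed (\<phi> n) (Q n)) (\<psi> n)"
      show ?case
      proof (cases "b = 0")
        case True
        then show ?thesis using elim by (simp add: log_inv_def b_def[symmetric])
      next
        case False
        then have b: "b > 0" using prob_H0_nonneg by (simp add: b_def order.strict_iff_order)
        have "ln b \<le> ln (C * exp (- (real n * E')))" using b ok(3)[of n] by (subst ln_le_cancel_iff) (auto simp: b_def intro: less_le_trans)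
        also have "\<dots> = ln C - real n * E'" using C by (simp add: ln_mult)
        finally have "real n * E \<le> ln (1 / b)" using elim b by (simp add: ln_div algebra_simps)
        then have "E \<le> 1 / real n * ln (1 / b)" using elim by (simp add: field_simps)
        then show ?thesis using False by (simp add: log_inv_def flip: b_def)
      qed
    qed
  qed
  have "limsup (\<lambda>n. ereal (1 / real n * ln (real (card (M n))))) \<le> ereal R"
  proof (rule ereal_le_epsilon2)
    fix e :: real assume e: "e > 0"
    have "(\<lambda>n. (ln C + ln (real n + 1)) / real n) \<longlonglongrightarrow> 0" by real_asymp
    then have "eventually (\<lambda>n. (ln C + ln (real n + 1)) / real n < e) sequentially"
      using e by (rule order_tendstoD(2))
    then have "eventually (\<lambda>n. ereal (1 / real n * ln (real (card (M n)))) \<le> ereal (R + e)) sequentially"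
      using eventually_gt_at_top[of 0]
    proof eventually_elim
      case (elim n)
      have "\<phi> n (replicate n undefined) \<in> M n" "finite (M n)" using ok(1)[of n] by (auto simp: encoder_def)
      then have "card (M n) > 0" by (auto simp: card_gt_0_iff)
      then have "ln (real (card (M n))) \<le> ln (C * (real n + 1) * exp (real n * R))"
        using ok(2)[of n] by (subst ln_le_cancel_iff) (auto intro: less_le_trans[of 0 "real (card (M n))"])
      also have "\<dots> = ln C + ln (real n + 1) + real n * R" using C by (simp add: ln_mult)
      finally have "1 / real n * ln (real (card (M n))) \<le> (ln C + ln (real n + 1)) / real n + R"
        using elim(2) by (simp add: field_simps)
      then show ?case using elim(1) by simp
    qed
    then have "limsup (\<lambda>n. ereal (1 / real n * ln (real (card (M n))))) \<le> ereal (R + e)"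
      by (rule Limsup_bounded)
    then show "limsup (\<lambda>n. ereal (1 / real n * ln (real (card (M n))))) \<le> ereal R + ereal e" by simp
  qed
  with ok(1) \<alpha> \<beta> show ?thesis unfolding achievable_def by blast
qed

section \<open>Kernel selection and the mixture\<close>

text \<open>The components with index at least \<open>i0\<close> are to reach the level
  \<open>e\<close> with one kernel. The overview treats the case without a common optimizer; a
  common optimizer serves all directly, and rates beyond the entropy of \<open>S\<close> are settled
  by \<open>full_kernel\<close>.\<close>

lemma best_common_kernel:
  fixes PYX :: "nat \<Rightarrow> ('y::finite \<times> 'x::finite) pmf"
  assumes R: "R \<ge> 0" and sep: "separable_at m PYX k cY R" and S: "S \<in> X_laws m PYX"
    and i0: "\<exists>j\<in>F_class m PYX S. i0 \<le> j"
    and mono: "\<And>j. j \<in> {1..m} \<Longrightarrow> i0 \<le> j \<Longrightarrow> e \<le> \<xi> PYX k r cY cX R j"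
  obtains K where "K \<in> kernels" "I_XU S K \<le> R"
    "\<And>j. j \<in> F_class m PYX S \<Longrightarrow> i0 \<le> j \<Longrightarrow> e \<le> I_YU (PYX j) K + (min_cost k (cY j) + min_cost r (cX S))"
proof -
  have W: "\<exists>W. PYX j = joint S W" if "j \<in> F_class m PYX S" for j
    using joint_disintegration[of "PYX j"] that by (metis (mono_tags, lifting) F_class_def PX_def mem_Collect_eq)
  have xi: "e \<le> max_I_YU (PYX j) R + (min_cost k (cY j) + min_cost r (cX S))"
    if "j \<in> F_class m PYX S" "i0 \<le> j" for j
    using mono[of j] that by (simp add: \<xi>_def F_class_def)
  show ?thesis
  proof (cases "R \<le> XU_max S")
    \<comment> \<open>The rate allows U to reveal X, and this kernel is optimal for every component
      simultaneously.\<close>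
    case False
    show ?thesis
    proof (rule that[OF full_kernel_in_kernels])
      show "I_XU S full_kernel \<le> R" using False by (simp add: full_kernel_info)
      fix j assume j: "j \<in> F_class m PYX S" "i0 \<le> j"
      obtain W where W: "PYX j = joint S W" using W[OF j(1)] by blast
      obtain K where "K \<in> kernels" "I_YU (joint S W) K = max_I_YU (joint S W) R"
        using max_I_YU_attained[OF R, of S W] by metis
      then have "max_I_YU (PYX j) R \<le> I_YU (PYX j) full_kernel"
        using I_YU_le_YU_max[of K S W] by (simp add: W full_kernel_info)
      with xi[OF j] show "e \<le> I_YU (PYX j) full_kernel + (min_cost k (cY j) + min_cost r (cX S))" by simp
    qed
  next
    case True
    have ne: "W_opt PYX S R j \<noteq> {}" if "j \<in> F_class m PYX S" for j
      using W[OF that] W_opt_nonempty[OF R True] by blast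
    have opt: "K \<in> kernels" "I_XU S K = R" "I_YU (PYX j) K = max_I_YU (PYX j) R" if "K \<in> W_opt PYX S R j" for K j
      using that by (auto simp: W_opt_def W_set_def)
    show ?thesis
    proof (cases "(\<Inter>i\<in>F_class m PYX S. W_opt PYX S R i) = {}")
      case False
      then obtain K where K: "\<And>j. j \<in> F_class m PYX S \<Longrightarrow> K \<in> W_opt PYX S R j" by blast
      obtain j0 where j0: "j0 \<in> F_class m PYX S" using i0 by blast
      show ?thesis
      proof (rule that[of K])
        show "K \<in> kernels" "I_XU S K \<le> R" using opt[OF K[OF j0]] by auto
        fix j assume j: "j \<in> F_class m PYX S" "i0 \<le> j"
        show "e \<le> I_YU (PYX j) K + (min_cost k (cY j) + min_cost r (cX S))"
          using xi[OF j] opt(3)[OF K[OF j(1)]] by simp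
      qed
    next
      case empty: True
      obtain "is" where enum: "set is = F_class m PYX S"
        and sorted: "\<And>K. K \<in> O_set m PYX S R \<Longrightarrow> sorted (map (\<lambda>i. I_YU (PYX i) K + min_cost k (cY i)) is)"
        using sep S unfolding separable_at_def by metis
      define js where "js = filter (\<lambda>j. i0 \<le> j) is"
      have "js \<noteq> []" using i0 enum by (auto simp: js_def filter_empty_conv)
      then obtain j1 js' where js: "js = j1 # js'" by (cases js) auto
      have "j1 \<in> set js" by (simp add: js)
      then have j1: "j1 \<in> F_class m PYX S" "i0 \<le> j1" using enum by (auto simp: js_def)
      \<comment> \<open>Optimality lifts the value of \<open>j1\<close> to \<open>e\<close>, and the
        ordering lifts all later components above \<open>j1\<close>. Components before
        \<open>j1\<close> in the list have index below \<open>i0\<close> and need no bound.\<close>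
      obtain K where K: "K \<in> W_opt PYX S R j1" using ne[OF j1(1)] by blast
      then have "K \<in> O_set m PYX S R" using empty j1(1) by (auto simp: O_set_def)
      from sorted[OF this] have sorted_js: "sorted (map (\<lambda>i. I_YU (PYX i) K + min_cost k (cY i)) js)"
        unfolding js_def by (rule sorted_filter)
      show ?thesis
      proof (rule that[of K])
        show "K \<in> kernels" "I_XU S K \<le> R" using opt[OF K] by auto
        fix j assume j: "j \<in> F_class m PYX S" "i0 \<le> j"
        then have "j \<in> set js" using enum by (simp add: js_def)
        then have "I_YU (PYX j1) K + min_cost k (cY j1) \<le> I_YU (PYX j) K + min_cost k (cY j)"
          using sorted_js by (auto simp: js)
        then show "e \<le> I_YU (PYX j) K + (min_cost k (cY j) + min_cost r (cX S))"
          using xi[OF j1] opt(3)[OF K] by simp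
      qed
    qed
  qed
qed

text \<open>Prepares a kernel for \<open>whp_kernel_density\<close>. For \<open>R = 0\<close> data
  processing makes the informations about Y nonpositive, so the constant kernel loses nothing;
  otherwise a slight erasure is applied.\<close>

lemma strictly_cheaper_kernel:
  fixes PYX :: "nat \<Rightarrow> ('y::finite \<times> 'x::finite) pmf"
  assumes R: "R \<ge> 0" and K: "K \<in> kernels" "I_XU S K \<le> R" and "finite F" and \<kappa>: "\<kappa> > 0"
    and W: "\<And>j. j \<in> F \<Longrightarrow> PYX j = joint S (W j)"
  obtains K' where "K' \<in> kernels" "I_XU S K' < R \<or> K' = (\<lambda>_. return_pmf 0)"
    "\<And>j. j \<in> F \<Longrightarrow> I_YU (PYX j) K - \<kappa> \<le> I_YU (PYX j) K'"
proof (cases "R = 0")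
  case True
  show ?thesis
  proof (rule that[OF const_kernel(1)[of 0]])
    fix j assume "j \<in> F"
    then have "I_YU (PYX j) K \<le> 0" "I_YU (PYX j) (\<lambda>_. return_pmf 0) = 0"
      using I_YU_le_I_XU[OF K(1), of S "W j"] K(2) True by (simp_all add: W const_kernel)
    then show "I_YU (PYX j) K - \<kappa> \<le> I_YU (PYX j) (\<lambda>_. return_pmf 0)" using \<kappa> by simp
  qed simp
next
  case False
  then have R0: "R > 0" using R by simp
  obtain C where C: "C \<ge> 0" "\<And>j. j \<in> F \<Longrightarrow> \<bar>I_YU (PYX j) K\<bar> \<le> C"
    using finite_bounded[OF \<open>finite F\<close>, of "\<lambda>j. I_YU (PYX j) K"] by blast
  \<comment> \<open>Chosen so that \<open>e * C \<le> \<kappa>\<close> and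
    \<open>0 < e \<le> 1\<close>, also when \<open>C\<close> is 0.\<close>
  define e where "e = \<kappa> / (\<kappa> + C)"
  have e: "0 < e" "e \<le> 1" "e * C \<le> \<kappa>"
  proof -
    show "0 < e" "e \<le> 1" using \<kappa> C(1) by (auto simp: e_def)
    have "e * C \<le> e * (\<kappa> + C)" using \<open>0 < e\<close> \<kappa> by (intro mult_left_mono) auto
    also have "\<dots> = \<kappa>" using \<kappa> C(1) by (simp add: e_def)
    finally show "e * C \<le> \<kappa>" .
  qed
  obtain K' where K': "K' \<in> kernels" "I_XU S K' = (1 - e) * I_XU S K"
    "\<And>W :: 'x \<Rightarrow> 'y pmf. I_YU (joint S W) K' = (1 - e) * I_YU (joint S W) K"
    using erasure_kernel[OF K(1), of e S] e by (metis less_imp_le)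
  show ?thesis
  proof (rule that[OF K'(1)])
    have "(1 - e) * I_XU S K \<le> (1 - e) * R" using K(2) e by (intro mult_left_mono) auto
    also have "\<dots> < R" using e R0 by (simp add: algebra_simps)
    finally show "I_XU S K' < R \<or> K' = (\<lambda>_. return_pmf 0)" using K'(2) by simp
    fix j assume j: "j \<in> F"
    have "e * I_YU (PYX j) K \<le> e * C" using C(2)[OF j] e by (intro mult_left_mono) auto
    then show "I_YU (PYX j) K - \<kappa> \<le> I_YU (PYX j) K'"
      using e(3) K'(3)[of "W j"] by (simp add: W[OF j] algebra_simps)
  qed
qed

text \<open>For Markov marginals, a word of the wrong length corresponds to the empty event and so
  has probability 0.\<close>

lemma standing_finite:
  fixes PYX :: "nat \<Rightarrow> ('y::finite \<times> 'x::finite) pmf"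
  assumes "standing_A m k r PYX QY QX cY cX \<or> standing_B m k r PYX QY QX cY cX"
  shows "j \<in> {1..k} \<Longrightarrow> finite (set_pmf (QY j n))" and "t \<in> {1..r} \<Longrightarrow> finite (set_pmf (QX t n))"
proof -
  have M: "finite (set_pmf (Q n))" if Q: "markov_marginals Q" for Q :: "nat \<Rightarrow> 'c::finite list pmf" and n
  proof -
    obtain M where M: "\<And>n zs. pmf (Q n) zs = measure M {\<omega> \<in> space M. map \<omega> [0..<n] = zs}"
      using Q unfolding markov_marginals_def by blast
    have "pmf (Q n) zs = 0" if "length zs \<noteq> n" for zs
    proof -
      have empty: "{\<omega> \<in> space M. map \<omega> [0..<n] = zs} = {}" using that by auto
      show ?thesis unfolding M empty by simp
    qed
    then have "length zs = n" if "zs \<in> set_pmf (Q n)" for zs using that by (meson set_pmf_iff)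
    then have "set_pmf (Q n) \<subseteq> {zs. set zs \<subseteq> UNIV \<and> length zs = n}" by auto
    then show ?thesis by (rule finite_subset) (rule finite_lists_length_eq, simp)
  qed
  show "finite (set_pmf (QY j n))" if "j \<in> {1..k}"
    using assms that by (auto simp: standing_A_def standing_B_def M finite_set_replicate_pmf)
  show "finite (set_pmf (QX t n))" if "t \<in> {1..r}"
    using assms that by (auto simp: standing_A_def standing_B_def M finite_set_replicate_pmf)
qed

text \<open>What both bounds share. Positivity of the weights at the minimizers is an assumption of
  \<open>upper_bound\<close>, separability one of \<open>lower_bound\<close>; each takes its own
  half of monotonicity.\<close>

locale mixture_test =
  fixes PYX :: "nat \<Rightarrow> ('y::finite \<times> 'x::finite) pmf"
    and QY :: "nat \<Rightarrow> nat \<Rightarrow> 'y list pmf" and QX :: "nat \<Rightarrow> nat \<Rightarrow> 'x list pmf"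
    and cY :: "nat \<Rightarrow> nat \<Rightarrow> ereal" and cX :: "'x pmf \<Rightarrow> nat \<Rightarrow> ereal"
    and \<nu> :: "nat \<Rightarrow> real" and \<tau> :: "nat \<Rightarrow> nat \<Rightarrow> real"
    and m k r :: nat and R :: real
  assumes standing: "standing_A m k r PYX QY QX cY cX \<or> standing_B m k r PYX QY QX cY cX"
    and \<nu>: "\<And>i. i \<in> {1..m} \<Longrightarrow> \<nu> i > 0" "(\<Sum>i=1..m. \<nu> i) = 1"
    and \<tau>: "\<And>j t. j \<in> {1..k} \<Longrightarrow> t \<in> {1..r} \<Longrightarrow> \<tau> j t \<ge> 0" "(\<Sum>j=1..k. \<Sum>t=1..r. \<tau> j t) = 1"
    and R: "R \<ge> 0"
begin

abbreviation dy :: "nat \<Rightarrow> real" where "dy i \<equiv> min_cost k (cY i)"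
abbreviation dx :: "'x pmf \<Rightarrow> real" where "dx S \<equiv> min_cost r (cX S)"
abbreviation Xi :: "nat \<Rightarrow> real" where "Xi \<equiv> \<xi> PYX k r cY cX R"

lemma k: "1 \<le> k" and r: "1 \<le> r"
proof -
  show "1 \<le> k" using \<tau>(2) by (cases k) auto
  show "1 \<le> r" using \<tau>(2) by (cases r) auto
qed

lemma PX_in_X_laws: "i \<in> {1..m} \<Longrightarrow> PX PYX i \<in> X_laws m PYX"
  by (auto simp: X_laws_def)

lemma dy: 
  assumes "i \<in> {1..m}"
  shows "ereal (dy i) = cY i (first_arg_min k (cY i))" "j \<in> {1..k} \<Longrightarrow> ereal (dy i) \<le> cY i j"
  using min_cost[OF k, of "cY i"] assms standing_lr(1)[OF standing assms] standing_lr(3)[OF standing]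
  by (auto simp: min_costs_finite_def)

lemma dx:
  assumes "S \<in> X_laws m PYX"
  shows "ereal (dx S) = cX S (first_arg_min r (cX S))" "t \<in> {1..r} \<Longrightarrow> ereal (dx S) \<le> cX S t"
  using min_cost[OF r, of "cX S"] assms standing_lr(2)[OF standing assms] standing_lr(3)[OF standing]
  by (auto simp: min_costs_finite_def)

lemma finite_QY: "j \<in> {1..k} \<Longrightarrow> finite (set_pmf (QY j n))"
  and finite_QX: "t \<in> {1..r} \<Longrightarrow> finite (set_pmf (QX t n))"
  using standing_finite[OF standing] by auto

definition V :: "nat \<Rightarrow> 'x \<Rightarrow> 'y pmf" where
  "V i = (SOME W. PYX i = joint (PX PYX i) W)"

lemma PYX_joint: "PYX i = joint (PX PYX i) (V i)"
proof -
  have "\<exists>W. PYX i = joint (PX PYX i) W"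
    using joint_disintegration[of "PYX i"] by (metis PX_def)
  then show ?thesis unfolding V_def by (rule someI_ex)
qed

lemma PY_eq: "PY PYX i = bind_pmf (PX PYX i) (V i)"
  unfolding PY_def by (subst PYX_joint) simp

lemma prob_H0_P_mix:
  "prob_H0 (compressed \<phi> (P_mix m \<nu> PYX n)) \<psi> = (\<Sum>i=1..m. \<nu> i * prob_H0 (compressed \<phi> (iid_pair n (PYX i))) \<psi>)"
proof -
  have *: "finite {1..m}" "\<And>i. i \<in> {1..m} \<Longrightarrow> \<nu> i \<ge> 0" "sum \<nu> {1..m} = 1"
    using \<nu> by (auto simp: less_imp_le)
  have fin: "finite (set_pmf (iid_pair n (PYX i)))" if "i \<in> {1..m}" for i
    by (simp add: finite_set_iid_pair)
  have mix: "expect (P_mix m \<nu> PYX n) f = (\<Sum>i=1..m. \<nu> i * expect (iid_pair n (PYX i)) f)"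
    for f unfolding P_mix_def by (rule expect_mixture(1)[OF *]) (assumption, rule fin, assumption)
  have finP: "finite (set_pmf (P_mix m \<nu> PYX n))"
    unfolding P_mix_def by (rule expect_mixture(2)[OF *]) (assumption, rule fin, assumption)
  show ?thesis
    by (simp add: prob_H0_eq[OF finP] mix prob_H0_eq finite_set_iid_pair)
qed

lemma prob_H0_Q_mix:
  "prob_H0 (compressed \<phi> (Q_mix k r \<tau> QY QX n)) \<psi> =
    (\<Sum>j=1..k. \<Sum>t=1..r. \<tau> j t * prob_H0 (compressed \<phi> (pair_pmf (QY j n) (QX t n))) \<psi>)"
proof -
  let ?A = "{1..k} \<times> {1..r}"
  have *: "finite ?A" "\<And>a. a \<in> ?A \<Longrightarrow> (\<lambda>(j, t). \<tau> j t) a \<ge> 0" "sum (\<lambda>(j, t). \<tau> j t) ?A = 1"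
    using \<tau> by (auto simp flip: sum.cartesian_product)
  have fin: "finite (set_pmf ((\<lambda>(j, t). pair_pmf (QY j n) (QX t n)) a))" if "a \<in> ?A" for a
    using that finite_QY finite_QX by auto
  have mix: "expect (Q_mix k r \<tau> QY QX n) f =
      (\<Sum>a\<in>?A. (\<lambda>(j, t). \<tau> j t) a * expect ((\<lambda>(j, t). pair_pmf (QY j n) (QX t n)) a) f)"
    for f unfolding Q_mix_def by (rule expect_mixture(1)[OF *]) (assumption, rule fin, assumption)
  have finQ: "finite (set_pmf (Q_mix k r \<tau> QY QX n))"
    unfolding Q_mix_def by (rule expect_mixture(2)[OF *]) (assumption, rule fin, assumption)
  have "prob_H0 (compressed \<phi> (Q_mix k r \<tau> QY QX n)) \<psi> =
     (\<Sum>a\<in>?A. (\<lambda>(j, t). \<tau> j t) a * expect ((\<lambda>(j, t). pair_pmf (QY j n) (QX t n)) a) (\<lambda>z. pmf (\<psi> (fst z, \<phi> (snd z))) H0))"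
    unfolding prob_H0_eq[OF finQ] mix ..
  also have "\<dots> = (\<Sum>(j, t)\<in>?A. \<tau> j t * prob_H0 (compressed \<phi> (pair_pmf (QY j n) (QX t n))) \<psi>)"
    using finite_QY finite_QX by (intro sum.cong refl) (auto simp: prob_H0_eq)
  finally show ?thesis by (simp add: sum.cartesian_product)
qed

lemma upper_bound:
  assumes pos: "\<And>j. j \<in> {1..m} \<Longrightarrow> \<tau> (first_arg_min k (cY j)) (first_arg_min r (cX (PX PYX j))) > 0"
    and i: "i \<in> {1..m}" and mono: "\<And>j. j \<in> {1..i} \<Longrightarrow> Xi j \<le> Xi i"
    and \<epsilon>: "\<epsilon> < (\<Sum>j=1..i. \<nu> j)"
    and ach: "achievable (P_mix m \<nu> PYX) (Q_mix k r \<tau> QY QX) \<epsilon> R E"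
  shows "E \<le> Xi i"
proof (rule ccontr)
  assume "\<not> E \<le> Xi i"
  \<comment> \<open>One third is lost in the strong converse, one in passing to the strict liminf
    bound; the last one outweighs the constant \<open>ln \<tau>0\<close>.\<close>
  define \<eta> where "\<eta> = (E - Xi i) / 3"
  have \<eta>: "\<eta> > 0" using \<open>\<not> E \<le> Xi i\<close> by (simp add: \<eta>_def)
  define v where "v = (\<Sum>j=1..i. \<nu> j)"
  \<comment> \<open>If all components up to \<open>i\<close> were accepted with probability at most
    \<open>\<delta>\<close>, the total acceptance would be at most
    \<open>1 - v + \<delta> = 1 - \<epsilon> - \<delta>\<close>, against the error bound.\<close>
  define \<delta> where "\<delta> = (v - \<epsilon>) / 2"
  have \<delta>: "\<delta> > 0" using \<epsilon> by (simp add: \<delta>_def v_def)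
  have im: "{1..i} \<subseteq> {1..m}" using i by auto
  obtain M \<phi> \<psi> where enc: "\<And>n. encoder n (M n) (\<phi> n)"
    and \<alpha>: "limsup (\<lambda>n. ereal (1 - prob_H0 (compressed (\<phi> n) (P_mix m \<nu> PYX n)) (\<psi> n))) \<le> ereal \<epsilon>"
    and \<beta>: "liminf (\<lambda>n. ereal (1 / real n) * log_inv (prob_H0 (compressed (\<phi> n) (Q_mix k r \<tau> QY QX n)) (\<psi> n))) \<ge> ereal E"
    and rate: "limsup (\<lambda>n. ereal (1 / real n * ln (real (card (M n))))) \<le> ereal R"
    using ach unfolding achievable_def by blast
  let ?acc = "\<lambda>n j. prob_H0 (compressed (\<phi> n) (iid_pair n (PYX j))) (\<psi> n)"
  let ?js = "\<lambda>j. first_arg_min k (cY j)" and ?ts = "\<lambda>j. first_arg_min r (cX (PX PYX j))"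
  let ?false = "\<lambda>n j. prob_H0 (compressed (\<phi> n) (pair_pmf (QY (?js j) n) (QX (?ts j) n))) (\<psi> n)"
  have js: "?js j \<in> {1..k}" "?ts j \<in> {1..r}" for j
    using first_arg_min(1)[OF k] first_arg_min(1)[OF r] by auto
  have sc: "eventually (\<lambda>n. \<delta> \<le> ?acc n j \<longrightarrow> exp (- (real n * (Xi j + \<eta>))) \<le> ?false n j) sequentially"
    if j: "j \<in> {1..i}" for j
  proof -
    have jm: "j \<in> {1..m}" using j im by auto
    note lrY = standing_lr(1)[OF standing jm js(1)[of j]]
    note lrX = standing_lr(2)[OF standing PX_in_X_laws[OF jm] js(2)[of j]]
    have 1: "lr_upper (bind_pmf (PX PYX j) (V j)) (QY (?js j)) (ereal (dy j))"
      using lrY dy(1)[OF jm] by (simp add: PY_eq)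
    have 2: "lr_upper (PX PYX j) (QX (?ts j)) (ereal (dx (PX PYX j)))"
      using lrX dx(1)[OF PX_in_X_laws[OF jm]] by simp
    obtain \<eta>1 where \<eta>1: "\<eta>1 > 0" and ev: "eventually (\<lambda>n. \<forall>M \<phi> \<psi>. encoder n M \<phi> \<longrightarrow> real (card M) \<le> exp (real n * (R + \<eta>1)) \<longrightarrow>
       \<delta> \<le> prob_H0 (compressed \<phi> (iid_pair n (joint (PX PYX j) (V j)))) \<psi> \<longrightarrow>
       exp (- (real n * (max_I_YU (joint (PX PYX j) (V j)) R + (dy j + dx (PX PYX j)) + \<eta>))) \<le>
         prob_H0 (compressed \<phi> (pair_pmf (QY (?js j) n) (QX (?ts j) n))) \<psi>) sequentially"
      by (rule strong_converse[OF finite_QY[OF js(1)] finite_QX[OF js(2)] 1 2 R \<delta> \<eta>], rule that)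
    have "limsup (\<lambda>n. ereal (1 / real n * ln (real (card (M n))))) < ereal (R + \<eta>1)"
      by (rule le_less_trans[OF rate]) (use \<eta>1 in simp)
    from Limsup_lessD[OF this] ev eventually_gt_at_top[of 0] show ?thesis
    proof eventually_elim
      case (elim n)
      have "\<phi> n (replicate n undefined) \<in> M n" "finite (M n)" using enc[of n] by (auto simp: encoder_def)
      then have c: "card (M n) > 0" by (auto simp: card_gt_0_iff)
      have "ln (real (card (M n))) < real n * (R + \<eta>1)" using elim(1,3) by (simp add: field_simps)
      then have "exp (ln (real (card (M n)))) \<le> exp (real n * (R + \<eta>1))" by simp
      then have "real (card (M n)) \<le> exp (real n * (R + \<eta>1))" using c by simp
      with elim(2) enc[of n] show ?case
        unfolding \<xi>_def by (subst (1 2) PYX_joint) (simp add: PYX_joint[symmetric])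
    qed
  qed
  have "limsup (\<lambda>n. ereal (1 - prob_H0 (compressed (\<phi> n) (P_mix m \<nu> PYX n)) (\<psi> n))) < ereal (\<epsilon> + \<delta>)"
    by (rule le_less_trans[OF \<alpha>]) (use \<delta> in simp)
  note evA = Limsup_lessD[OF this]
  have "ereal (Xi i + 2 * \<eta>) < liminf (\<lambda>n. ereal (1 / real n) * log_inv (prob_H0 (compressed (\<phi> n) (Q_mix k r \<tau> QY QX n)) (\<psi> n)))"
    by (rule less_le_trans[OF _ \<beta>]) (use \<eta> in \<open>simp add: \<eta>_def field_simps\<close>)
  note evB = less_LiminfD[OF this]
  define \<tau>0 where "\<tau>0 = Min ((\<lambda>j. \<tau> (?js j) (?ts j)) ` {1..i})"
  have "\<tau>0 \<in> (\<lambda>j. \<tau> (?js j) (?ts j)) ` {1..i}" unfolding \<tau>0_def using i by (intro Min_in) auto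
  then have \<tau>0: "\<tau>0 > 0" using pos im by auto
  have \<tau>0_le: "\<tau>0 \<le> \<tau> (?js j) (?ts j)" if "j \<in> {1..i}" for j unfolding \<tau>0_def using that by (intro Min_le) auto
  \<comment> \<open>The accepted component may change with n, so the bounds are needed for all of
    them from a common n on.\<close>
  have evS: "eventually (\<lambda>n. \<forall>j\<in>{1..i}. \<delta> \<le> ?acc n j \<longrightarrow> exp (- (real n * (Xi j + \<eta>))) \<le> ?false n j) sequentially"
    using sc by (intro eventually_ball_finite) auto
  have "eventually (\<lambda>n. False) sequentially"
    using evA evB evS eventually_le_linear[OF \<eta>, of "- ln \<tau>0"] eventually_gt_at_top[of 0]
  proof eventually_elim
    case (elim n)
    let ?b = "prob_H0 (compressed (\<phi> n) (Q_mix k r \<tau> QY QX n)) (\<psi> n)"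
    have "\<exists>j\<in>{1..i}. \<delta> \<le> ?acc n j"
    proof (rule ccontr)
      assume "\<not> ?thesis"
      then have small: "?acc n j \<le> \<delta>" if "j \<in> {1..i}" for j using that by (auto simp: not_le less_imp_le)
      have split: "{1..m} = {1..i} \<union> {i<..m}" using i by auto
      have total: "v + (\<Sum>j\<in>{i<..m}. \<nu> j) = 1"
        using \<nu>(2) unfolding v_def split by (subst (asm) sum.union_disjoint) auto
      have "1 - (\<epsilon> + \<delta>) < (\<Sum>j=1..m. \<nu> j * ?acc n j)"
        using elim(1) by (simp add: prob_H0_P_mix)
      also have "\<dots> = (\<Sum>j=1..i. \<nu> j * ?acc n j) + (\<Sum>j\<in>{i<..m}. \<nu> j * ?acc n j)"
        unfolding split by (subst sum.union_disjoint) auto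
      also have "\<dots> \<le> (\<Sum>j=1..i. \<nu> j * \<delta>) + (\<Sum>j\<in>{i<..m}. \<nu> j * 1)"
        using small \<nu>(1) im by (intro add_mono sum_mono mult_left_mono prob_H0_le_1) (auto simp: less_imp_le)
      also have "\<dots> = v * \<delta> + (1 - v)" using total by (simp add: v_def flip: sum_distrib_right)
      also have "v * \<delta> \<le> \<delta>"
      proof -
        have "(\<Sum>j\<in>{i<..m}. \<nu> j) \<ge> 0" using \<nu>(1) i by (intro sum_nonneg) (auto intro!: less_imp_le)
        then show ?thesis using total \<delta> by (simp add: mult_left_le_one_le mult_le_cancel_right1)
      qed
      finally show False by (simp add: \<delta>_def field_simps)
    qed
    then obtain j where j: "j \<in> {1..i}" "\<delta> \<le> ?acc n j" by blast
    have "exp (ln \<tau>0) * exp (- (real n * (Xi i + \<eta>))) \<le> \<tau> (?js j) (?ts j) * ?false n j"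
    proof (rule mult_mono)
      show "exp (ln \<tau>0) \<le> \<tau> (?js j) (?ts j)" using \<tau>0 \<tau>0_le[OF j(1)] by simp
      have "exp (- (real n * (Xi i + \<eta>))) \<le> exp (- (real n * (Xi j + \<eta>)))"
        using mono[OF j(1)] by (simp add: mult_left_mono)
      also have "\<dots> \<le> ?false n j" using elim(3) j by blast
      finally show "exp (- (real n * (Xi i + \<eta>))) \<le> ?false n j" .
    qed (use \<tau>(1)[OF js(1) js(2)] in auto)
    also have "\<dots> \<le> (\<Sum>t=1..r. \<tau> (?js j) t * prob_H0 (compressed (\<phi> n) (pair_pmf (QY (?js j) n) (QX t n))) (\<psi> n))"
      using js[of j] \<tau>(1) by (intro member_le_sum[where f = "\<lambda>t. \<tau> (?js j) t * prob_H0 (compressed (\<phi> n) (pair_pmf (QY (?js j) n) (QX t n))) (\<psi> n)"])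
        (auto simp: prob_H0_nonneg)
    also have "\<dots> \<le> ?b"
      unfolding prob_H0_Q_mix using js(1)[of j] \<tau>(1)
      by (intro member_le_sum[where f = "\<lambda>j. \<Sum>t=1..r. \<tau> j t * prob_H0 (compressed (\<phi> n) (pair_pmf (QY j n) (QX t n))) (\<psi> n)"])
        (auto simp: prob_H0_nonneg intro!: sum_nonneg)
    finally have lower: "exp (ln \<tau>0 - real n * (Xi i + \<eta>)) \<le> ?b" by (simp flip: exp_add)
    then have b: "?b > 0" by (rule less_le_trans[rotated]) simp
    have "Xi i + 2 * \<eta> < 1 / real n * ln (1 / ?b)" using elim(2) b by (simp add: log_inv_def)
    then have "real n * (Xi i + 2 * \<eta>) < ln (1 / ?b)" using elim(5) by (simp add: field_simps)
    also have "\<dots> = - ln ?b" using b by (simp add: ln_div)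
    also have "\<dots> \<le> - (ln \<tau>0 - real n * (Xi i + \<eta>))"
      using ln_ge_iff[OF b] lower by (simp only: neg_le_iff_le)
    finally have "real n * \<eta> < - ln \<tau>0" by (simp add: algebra_simps)
    then show False using elim(4) by simp
  qed
  then show False by simp
qed

lemma lower_bound:
  assumes sep: "separable_at m PYX k cY R"
    and i: "i \<in> {1..m}" and mono: "\<And>j. j \<in> {i..m} \<Longrightarrow> Xi i \<le> Xi j"
    and \<epsilon>: "(\<Sum>j=1..<i. \<nu> j) \<le> \<epsilon>" and E: "E < Xi i"
  shows "achievable (P_mix m \<nu> PYX) (Q_mix k r \<tau> QY QX) \<epsilon> R E"
proof -
  \<comment> \<open>Five shares: one for the erasure, two in the decoding sets, one for the change
    of measure of X, and one to stay strictly above \<open>E\<close>.\<close>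
  define \<eta> where "\<eta> = (Xi i - E) / 5"
  have \<eta>: "\<eta> > 0" using E by (simp add: \<eta>_def)
  define e where "e = Xi i - \<eta>"
  define Ss where "Ss = PX PYX ` {i..m}"
  have Ss: "finite Ss" "card Ss \<le> m" "Ss \<subseteq> X_laws m PYX"
  proof -
    show "finite Ss" by (simp add: Ss_def)
    have "card Ss \<le> card {i..m}" unfolding Ss_def by (rule card_image_le) simp
    then show "card Ss \<le> m" using i by auto
    show "Ss \<subseteq> X_laws m PYX" using i by (auto simp: Ss_def X_laws_def)
  qed
  define J where "J S = {j \<in> F_class m PYX S. i \<le> j}" for S
  have J: "finite (J S)" "card (J S) \<le> m" for S
  proof -
    have sub: "J S \<subseteq> {1..m}" by (auto simp: J_def F_class_def)
    then show "finite (J S)" by (rule finite_subset) simp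
    show "card (J S) \<le> m" using card_mono[OF _ sub] by simp
  qed
  have PJ: "PYX j = joint S (V j)" if "j \<in> J S" for j S
    using that PYX_joint[of j] by (simp add: J_def F_class_def)
  have "\<exists>K. K \<in> kernels \<and> (I_XU S K < R \<or> K = (\<lambda>_. return_pmf 0)) \<and> (\<forall>j\<in>J S. e - dx S \<le> I_YU (joint S (V j)) K + dy j)"
    if S: "S \<in> Ss" for S
  proof -
    have SX: "S \<in> X_laws m PYX" using S Ss by auto
    obtain j0 where "j0 \<in> {i..m}" "S = PX PYX j0" using S by (auto simp: Ss_def)
    then have ex: "\<exists>j\<in>F_class m PYX S. i \<le> j" using i by (intro bexI[of _ j0]) (auto simp: F_class_def)
    obtain K where K: "K \<in> kernels" "I_XU S K \<le> R"
      "\<And>j. j \<in> F_class m PYX S \<Longrightarrow> i \<le> j \<Longrightarrow> Xi i \<le> I_YU (PYX j) K + (dy j + dx S)"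
      by (rule best_common_kernel[OF R sep SX ex, where e = "Xi i" and r = r and cX = cX]) (use mono that in auto)
    obtain K' where K': "K' \<in> kernels" "I_XU S K' < R \<or> K' = (\<lambda>_. return_pmf 0)"
      "\<And>j. j \<in> J S \<Longrightarrow> I_YU (PYX j) K - \<eta> \<le> I_YU (PYX j) K'"
      using strictly_cheaper_kernel[where PYX = PYX and W = V, OF R K(1,2) J(1)[of S] \<eta> PJ] by metis
    have "e - dx S \<le> I_YU (joint S (V j)) K' + dy j" if "j \<in> J S" for j
      using K(3)[of j] K'(3)[OF that] that by (simp add: e_def J_def flip: PJ[OF that])
    with K' show ?thesis by blast
  qed
  then obtain K where K: "\<And>S. S \<in> Ss \<Longrightarrow> K S \<in> kernels"
    "\<And>S. S \<in> Ss \<Longrightarrow> I_XU S (K S) < R \<or> K S = (\<lambda>_. return_pmf 0)"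
    "\<And>S j. S \<in> Ss \<Longrightarrow> j \<in> J S \<Longrightarrow> e - dx S \<le> I_YU (joint S (V j)) (K S) + dy j" by metis
  obtain T :: "'x pmf \<Rightarrow> nat \<Rightarrow> 'x list \<Rightarrow> bool" where T: "\<And>S. whp (\<lambda>n. replicate_pmf n S) (T S)"
    and disj: "\<And>S S' n xs. S \<in> Ss \<Longrightarrow> S' \<in> Ss \<Longrightarrow> T S n xs \<Longrightarrow> T S' n xs \<Longrightarrow> S = S'"
    using whp_separated[OF Ss(1)] by metis
  \<comment> \<open>The set of X-words of a class does two jobs: it identifies the class, and its
    reference probability decays with exponent \<open>dx S\<close>. That is why the codes of the
    class only need the exponent \<open>e - dx S\<close>.\<close>
  define G where "G S n xs \<longleftrightarrow> T S n xs \<and>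
      (\<forall>t\<in>{1..r}. pmf (QX t n) xs \<le> exp (- (real n * (dx S - \<eta>))) * pmf (replicate_pmf n S) xs)" for S n xs
  have G: "whp (\<lambda>n. replicate_pmf n S) (G S)" if "S \<in> Ss" for S
    unfolding G_def
  proof (intro whp_conj T whp_ball)
    fix t assume t: "t \<in> {1..r}"
    have SX: "S \<in> X_laws m PYX" using that Ss by auto
    have "ereal (dx S - \<eta>) < ereal (dx S)" using \<eta> by simp
    also have "\<dots> \<le> cX S t" by (rule dx(2)[OF SX t])
    finally show "whp (\<lambda>n. replicate_pmf n S)
        (\<lambda>n xs. pmf (QX t n) xs \<le> exp (- (real n * (dx S - \<eta>))) * pmf (replicate_pmf n S) xs)"
      using standing_lr(2)[OF standing SX t] by (simp add: lr_lower_def)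
  qed simp
  \<comment> \<open>Dominates both \<open>m + 1\<close>, from the size of the joined code, and
    \<open>m\<close> squared, from the union over components and over classes in false
    acceptance.\<close>
  define C where "C = 3 * (real m)\<^sup>2 + 3"
  show ?thesis
  proof (rule achievableI[where C = C and E' = "e - 3 * \<eta>"])
    show "C \<ge> 1" by (simp add: C_def)
    show "R \<ge> 0" by (rule R)
    show "E < e - 3 * \<eta>" using \<eta> by (simp add: e_def \<eta>_def field_simps)
    fix \<zeta> :: real assume \<zeta>: "\<zeta> > 0"
    define good where "good n S us f B \<longleftrightarrow> real (length us) \<le> real n * exp (real n * R) + 1 \<and>
       (\<forall>x u. f x = Some u \<longrightarrow> u \<in> set us \<and> G S n x) \<and>
       (\<forall>u\<in>set us. \<forall>j'\<in>{1..k}. measure_pmf.prob (QY j' n) (B u) \<le> real (card (J S)) * exp (- (real n * (e - dx S - 2 * \<eta>)))) \<and>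
       (\<forall>j\<in>J S. 1 - \<zeta> \<le> expect (replicate_pmf n S)
          (\<lambda>x. case f x of None \<Rightarrow> 0 | Some u \<Rightarrow> measure_pmf.prob (kpow (V j) x) (B u)))"
      for n S and us :: "nat list list" and f B
    have "eventually (\<lambda>n. \<forall>S\<in>Ss. \<exists>us f B. good n S us f B) sequentially"
    proof (intro eventually_ball_finite Ss(1) ballI)
      fix S assume S: "S \<in> Ss"
      show "eventually (\<lambda>n. \<exists>us f B. good n S us f B) sequentially"
        unfolding good_def
      proof (rule class_scheme[OF K(1)[OF S] R K(2)[OF S] J(1) G[OF S] \<eta> \<zeta>, where c = cY and d = dy])
        show "finite (set_pmf (QY j' n))" if "j' \<in> {1..k}" for j' n using finite_QY[OF that] .
        show "lr_lower (bind_pmf S (V j)) (QY j') (cY j j') \<and> ereal (dy j) \<le> cY j j'"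
          if "j \<in> J S" "j' \<in> {1..k}" for j j'
        proof -
          have jm: "j \<in> {1..m}" "PX PYX j = S" using that by (auto simp: J_def F_class_def)
          show ?thesis using standing_lr(1)[OF standing jm(1) that(2)] dy(2)[OF jm(1) that(2)] jm(2)
            by (simp add: PY_eq)
        qed
        show "e - dx S \<le> I_YU (joint S (V j)) (K S) + dy j" if "j \<in> J S" for j
          by (rule K(3)[OF S that])
      qed
    qed
    then show "eventually (\<lambda>n. \<exists>M \<phi> \<psi>. encoder n M \<phi> \<and>
        real (card M) \<le> C * (real n + 1) * exp (real n * R) \<and>
        prob_H0 (compressed \<phi> (Q_mix k r \<tau> QY QX n)) \<psi> \<le> C * exp (- (real n * (e - 3 * \<eta>))) \<and>
        1 - prob_H0 (compressed \<phi> (P_mix m \<nu> PYX n)) \<psi> \<le> \<epsilon> + \<zeta>) sequentially"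
    proof eventually_elim
      case (elim n)
      then obtain us where "\<forall>S\<in>Ss. \<exists>f B. good n S (us S) f B"
        using bchoice[of Ss "\<lambda>S us. \<exists>f B. good n S us f B"] by blast
      then obtain f where "\<forall>S\<in>Ss. \<exists>B. good n S (us S) (f S) B"
        using bchoice[of Ss "\<lambda>S f. \<exists>B. good n S (us S) f B"] by blast
      then obtain B where good: "\<forall>S\<in>Ss. good n S (us S) (f S) (B S)"
        using bchoice[of Ss "\<lambda>S B. good n S (us S) (f S) B"] by blast
      have len: "real (length (us S)) \<le> real n * exp (real n * R) + 1" if "S \<in> Ss" for S
        using good that by (simp add: good_def)
      have f: "u \<in> set (us S) \<and> G S n x" if "S \<in> Ss" "f S x = Some u" for S x u
        using good that unfolding good_def by blast
      have B: "measure_pmf.prob (QY j' n) (B S u) \<le> real (card (J S)) * exp (- (real n * (e - dx S - 2 * \<eta>)))"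
        if "S \<in> Ss" "u \<in> set (us S)" "j' \<in> {1..k}" for S u j'
        using good that unfolding good_def by blast
      have acc: "1 - \<zeta> \<le> expect (replicate_pmf n S)
          (\<lambda>x. case f S x of None \<Rightarrow> 0 | Some u \<Rightarrow> measure_pmf.prob (kpow (V j) x) (B S u))"
        if "S \<in> Ss" "j \<in> J S" for S j
        using good that unfolding good_def by blast
      obtain M \<phi> \<psi> where enc: "encoder n M \<phi>" and card: "card M \<le> (\<Sum>S\<in>Ss. length (us S)) + 1"
        and accM: "\<And>S j. S \<in> Ss \<Longrightarrow> expect (replicate_pmf n S)
            (\<lambda>x. case f S x of None \<Rightarrow> 0 | Some u \<Rightarrow> measure_pmf.prob (kpow (V j) x) (B S u))
          \<le> prob_H0 (compressed \<phi> (iid_pair n (joint S (V j)))) \<psi>"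
        and falseM: "\<And>qY qX c. finite (set_pmf qY) \<Longrightarrow> finite (set_pmf qX) \<Longrightarrow>
          (\<And>S u. S \<in> Ss \<Longrightarrow> u \<in> set (us S) \<Longrightarrow> measure_pmf.prob qX {x. G S n x} * measure_pmf.prob qY (B S u) \<le> c) \<Longrightarrow> c \<ge> 0 \<Longrightarrow>
          prob_H0 (compressed \<phi> (pair_pmf qY qX)) \<psi> \<le> real (card Ss) * c"
        by (rule combine_step[of Ss "\<lambda>S. G S n" f us n V B, OF Ss(1) _ f]) (use disj in \<open>auto simp: G_def\<close>)
      have X: "exp (real n * R) \<ge> 1" using R by simp
      have "real (card M) \<le> (\<Sum>S\<in>Ss. real (length (us S))) + 1" using card by (simp flip: of_nat_sum of_nat_Suc)
      also have "\<dots> \<le> (\<Sum>S\<in>Ss. real n * exp (real n * R) + 1) + 1" using len by (intro add_right_mono sum_mono)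
      also have "\<dots> = real (card Ss) * (real n * exp (real n * R) + 1) + 1" by simp
      also have "\<dots> \<le> real m * (real n * exp (real n * R) + exp (real n * R)) + exp (real n * R)"
        using Ss(2) X by (intro add_mono mult_mono) auto
      also have "\<dots> = (real m * (real n + 1) + 1) * exp (real n * R)" by (simp add: algebra_simps)
      also have "\<dots> \<le> (C * (real n + 1)) * exp (real n * R)"
      proof (rule mult_right_mono)
        have "real m \<le> (real m)\<^sup>2" by (cases m) (auto simp: power2_eq_square)
        then have "real m + 1 \<le> C" unfolding C_def using zero_le_power2[of "real m"] by linarith
        then have "(real m + 1) * (real n + 1) \<le> C * (real n + 1)" by (rule mult_right_mono) simp
        then show "real m * (real n + 1) + 1 \<le> C * (real n + 1)" by (simp add: algebra_simps)
      qed simp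
      finally have cardM: "real (card M) \<le> C * (real n + 1) * exp (real n * R)" .
      define c where "c = real m * exp (- (real n * (e - 3 * \<eta>)))"
      have "prob_H0 (compressed \<phi> (Q_mix k r \<tau> QY QX n)) \<psi> \<le> (\<Sum>j=1..k. \<Sum>t=1..r. \<tau> j t * (real m * c))"
        unfolding prob_H0_Q_mix
      proof (intro sum_mono mult_left_mono)
        fix j t assume jt: "j \<in> {1..k}" "t \<in> {1..r}"
        have "prob_H0 (compressed \<phi> (pair_pmf (QY j n) (QX t n))) \<psi> \<le> real (card Ss) * c"
        proof (rule falseM[OF finite_QY[OF jt(1)] finite_QX[OF jt(2)]])
          show "c \<ge> 0" by (simp add: c_def)
          fix S u assume Su: "S \<in> Ss" "u \<in> set (us S)"
          have "measure_pmf.prob (QX t n) {x. G S n x} \<le> exp (- (real n * (dx S - \<eta>))) * measure_pmf.prob (replicate_pmf n S) {x. G S n x}"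
            using jt(2) by (intro prob_le_cmult finite_QX[OF jt(2)]) (auto simp: G_def)
          also have "\<dots> \<le> exp (- (real n * (dx S - \<eta>)))" by (simp add: mult_left_le)
          finally have 1: "measure_pmf.prob (QX t n) {x. G S n x} \<le> exp (- (real n * (dx S - \<eta>)))" .
          have 2: "measure_pmf.prob (QY j n) (B S u) \<le> real m * exp (- (real n * (e - dx S - 2 * \<eta>)))"
            by (rule order_trans[OF B[OF Su jt(1)]]) (simp add: J(2))
          have "measure_pmf.prob (QX t n) {x. G S n x} * measure_pmf.prob (QY j n) (B S u) \<le>
              exp (- (real n * (dx S - \<eta>))) * (real m * exp (- (real n * (e - dx S - 2 * \<eta>))))"
            by (rule mult_mono[OF 1 2]) auto
          also have "\<dots> = real m * exp (- (real n * (dx S - \<eta>)) - real n * (e - dx S - 2 * \<eta>))"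
            by (simp only: mult.left_commute[of _ "real m"] exp_add[symmetric] diff_conv_add_uminus)
          also have "- (real n * (dx S - \<eta>)) - real n * (e - dx S - 2 * \<eta>) = - (real n * (e - 3 * \<eta>))"
            by (simp add: algebra_simps)
          finally show "measure_pmf.prob (QX t n) {x. G S n x} * measure_pmf.prob (QY j n) (B S u) \<le> c"
            by (simp add: c_def)
        qed
        also have "\<dots> \<le> real m * c" using Ss(2) by (intro mult_right_mono) (auto simp: c_def)
        finally show "prob_H0 (compressed \<phi> (pair_pmf (QY j n) (QX t n))) \<psi> \<le> real m * c" .
      qed (use \<tau>(1) in auto)
      also have "\<dots> = real m * c" using \<tau>(2) by (simp flip: sum_distrib_right)
      also have "\<dots> = (real m)\<^sup>2 * exp (- (real n * (e - 3 * \<eta>)))" by (simp add: c_def power2_eq_square)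
      also have "\<dots> \<le> C * exp (- (real n * (e - 3 * \<eta>)))" by (intro mult_right_mono) (auto simp: C_def)
      finally have \<beta>: "prob_H0 (compressed \<phi> (Q_mix k r \<tau> QY QX n)) \<psi> \<le> C * exp (- (real n * (e - 3 * \<eta>)))" .
      have split: "{1..m} = {1..<i} \<union> {i..m}" using i by auto
      have total: "(\<Sum>j=1..<i. \<nu> j) + (\<Sum>j=i..m. \<nu> j) = 1"
        using \<nu>(2) unfolding split by (subst (asm) sum.union_disjoint) auto
      have "(\<Sum>j=i..m. \<nu> j) - \<zeta> \<le> (\<Sum>j=i..m. \<nu> j) - (\<Sum>j=i..m. \<nu> j) * \<zeta>"
      proof -
        have "(\<Sum>j=1..<i. \<nu> j) \<ge> 0" using \<nu>(1) i by (intro sum_nonneg) (auto intro!: less_imp_le)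
        then show ?thesis using total \<zeta> by (simp add: mult_le_cancel_right1)
      qed
      also have "\<dots> = (\<Sum>j=i..m. \<nu> j * (1 - \<zeta>))" by (simp add: algebra_simps sum_subtractf sum_distrib_left)
      also have "\<dots> \<le> (\<Sum>j=i..m. \<nu> j * prob_H0 (compressed \<phi> (iid_pair n (PYX j))) \<psi>)"
      proof (intro sum_mono mult_left_mono)
        fix j assume j: "j \<in> {i..m}"
        have jm: "j \<in> {1..m}" using i j by auto
        have S: "PX PYX j \<in> Ss" and jJ: "j \<in> J (PX PYX j)" using j jm by (auto simp: Ss_def J_def F_class_def)
        show "1 - \<zeta> \<le> prob_H0 (compressed \<phi> (iid_pair n (PYX j))) \<psi>"
          using order_trans[OF acc[OF S jJ] accM[OF S, of j]] PYX_joint[of j] by simp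
        show "0 \<le> \<nu> j" using \<nu>(1)[OF jm] by simp
      qed
      also have "\<dots> \<le> (\<Sum>j=1..m. \<nu> j * prob_H0 (compressed \<phi> (iid_pair n (PYX j))) \<psi>)"
        using \<nu>(1) i by (intro sum_mono2) (auto simp: prob_H0_nonneg less_imp_le)
      also have "\<dots> = prob_H0 (compressed \<phi> (P_mix m \<nu> PYX n)) \<psi>" by (simp add: prob_H0_P_mix)
      finally have \<alpha>: "1 - prob_H0 (compressed \<phi> (P_mix m \<nu> PYX n)) \<psi> \<le> \<epsilon> + \<zeta>"
        using total \<epsilon> by simp
      show ?case using enc cardM \<beta> \<alpha> by blast
    qed
  qed
qed

end

theorem theorem4:
  fixes PYX :: "nat \<Rightarrow> ('y::finite \<times> 'x::finite) pmf"
    and QY :: "nat \<Rightarrow> nat \<Rightarrow> 'y list pmf" and QX :: "nat \<Rightarrow> nat \<Rightarrow> 'x list pmf"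
    and cY :: "nat \<Rightarrow> nat \<Rightarrow> ereal" and cX :: "'x pmf \<Rightarrow> nat \<Rightarrow> ereal"
    and \<nu> :: "nat \<Rightarrow> real" and \<tau> :: "nat \<Rightarrow> nat \<Rightarrow> real"
    and m k r :: nat and R \<epsilon> :: real
  assumes "standing_A m k r PYX QY QX cY cX \<or> standing_B m k r PYX QY QX cY cX"
    and "\<And>i. i \<in> {1..m} \<Longrightarrow> \<nu> i > 0" and "(\<Sum>i=1..m. \<nu> i) = 1"
    and "\<And>j t. j \<in> {1..k} \<Longrightarrow> t \<in> {1..r} \<Longrightarrow> \<tau> j t \<ge> 0"
    and "(\<Sum>j=1..k. \<Sum>t=1..r. \<tau> j t) = 1"
    and "\<And>S i. S \<in> X_laws m PYX \<Longrightarrow> i \<in> F_class m PYX S \<Longrightarrow>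
           \<tau> (first_arg_min k (cY i)) (first_arg_min r (cX S)) > 0"
    and "R \<ge> 0"
    and "separable_at m PYX k cY R"
    and "\<And>i i'. 1 \<le> i \<Longrightarrow> i \<le> i' \<Longrightarrow> i' \<le> m \<Longrightarrow> \<xi> PYX k r cY cX R i \<le> \<xi> PYX k r cY cX R i'"
    and "0 \<le> \<epsilon>" and "\<epsilon> < 1"
  shows "E_star (P_mix m \<nu> PYX) (Q_mix k r \<tau> QY QX) \<epsilon> R =
    ereal (\<Sum>i=1..m. \<xi> PYX k r cY cX R i *
                      indicator {(\<Sum>j=1..<i. \<nu> j)..<(\<Sum>j=1..i. \<nu> j)} \<epsilon>)"
proof -
  interpret mixture_test PYX QY QX cY cX \<nu> \<tau> m k r R
    using assms by unfold_locales auto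
  let ?V = "\<lambda>i. \<Sum>j=1..i. \<nu> j"
  \<comment> \<open>The intervals between successive partial sums partition \<open>[0, 1)\<close>;
    this is the index of the one containing \<open>\<epsilon>\<close>, so the sum collapses to one
    term.\<close>
  define i where "i = (LEAST i. \<epsilon> < ?V i)"
  have "\<epsilon> < ?V m" using assms by simp
  then have lt: "\<epsilon> < ?V i" and le: "i \<le> m" unfolding i_def by (rule LeastI, rule Least_le)
  have "i \<noteq> 0" using lt assms(10) by (cases i) auto
  then have i: "i \<in> {1..m}" using le by auto
  have ge: "(\<Sum>j=1..<i. \<nu> j) \<le> \<epsilon>"
  proof -
    have "\<not> \<epsilon> < ?V (i - 1)" unfolding i_def using \<open>i \<noteq> 0\<close> by (intro not_less_Least) (simp add: i_def)
    moreover have "{1..i - 1} = {1..<i}" using \<open>i \<noteq> 0\<close> by auto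
    ultimately show ?thesis by simp
  qed
  have mono_sum: "sum \<nu> A \<le> sum \<nu> B" if "A \<subseteq> B" "B \<subseteq> {1..m}" for A B
  proof (rule sum_mono2)
    show "finite B" using that(2) by (rule finite_subset) simp
    show "0 \<le> \<nu> b" if "b \<in> B - A" for b
      using assms(2)[of b] \<open>B \<subseteq> {1..m}\<close> that by (auto intro: less_imp_le)
  qed (rule that)
  have ind: "indicator {(\<Sum>j=1..<l. \<nu> j)..<?V l} \<epsilon> = (if l = i then 1 else 0 :: real)" if l: "l \<in> {1..m}" for l
  proof (cases l i rule: linorder_cases)
    case less
    have "?V l \<le> (\<Sum>j=1..<i. \<nu> j)" using less i by (intro mono_sum) auto
    then show ?thesis using less ge by simp
  next
    case greater
    have "?V i \<le> (\<Sum>j=1..<l. \<nu> j)" using greater l by (intro mono_sum) auto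
    then show ?thesis using greater lt by simp
  qed (use lt ge in auto)
  have rhs: "(\<Sum>l=1..m. Xi l * indicator {(\<Sum>j=1..<l. \<nu> j)..<?V l} \<epsilon>) = Xi i"
  proof -
    have "(\<Sum>l=1..m. Xi l * indicator {(\<Sum>j=1..<l. \<nu> j)..<?V l} \<epsilon>) = (\<Sum>l=1..m. if l = i then Xi l else 0)"
      by (rule sum.cong[OF refl]) (simp only: ind, simp)
    also have "\<dots> = Xi i" using i by simp
    finally show ?thesis .
  qed
  have pos: "\<tau> (first_arg_min k (cY j)) (first_arg_min r (cX (PX PYX j))) > 0" if "j \<in> {1..m}" for j
    by (rule assms(6)[OF PX_in_X_laws[OF that]]) (use that in \<open>simp add: F_class_def\<close>)
  have below: "Xi j \<le> Xi i" if "j \<in> {1..i}" for j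
    by (rule assms(9)) (use that i in auto)
  have above: "Xi i \<le> Xi j" if "j \<in> {i..m}" for j
    by (rule assms(9)) (use that i in auto)
  have "E_star (P_mix m \<nu> PYX) (Q_mix k r \<tau> QY QX) \<epsilon> R = ereal (Xi i)"
    unfolding E_star_def
  proof (rule antisym)
    show "Sup {ereal E |E. achievable (P_mix m \<nu> PYX) (Q_mix k r \<tau> QY QX) \<epsilon> R E} \<le> ereal (Xi i)"
    proof (rule Sup_least, safe)
      fix E assume ach: "achievable (P_mix m \<nu> PYX) (Q_mix k r \<tau> QY QX) \<epsilon> R E"
      have "E \<le> Xi i" by (rule upper_bound[OF _ i _ lt ach]) (erule pos below)+
      then show "ereal E \<le> ereal (Xi i)" by simp
    qed
    \<comment> \<open>Achievability is known only strictly below the value; the supremum closes the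
      gap.\<close>
    show "ereal (Xi i) \<le> Sup {ereal E |E. achievable (P_mix m \<nu> PYX) (Q_mix k r \<tau> QY QX) \<epsilon> R E}"
    proof (rule ereal_le_epsilon2)
      fix e :: real assume "e > 0"
      then have "Xi i - e < Xi i" by simp
      from lower_bound[OF assms(8) i _ ge this] above
      have "achievable (P_mix m \<nu> PYX) (Q_mix k r \<tau> QY QX) \<epsilon> R (Xi i - e)" by blast
      then have "ereal (Xi i - e) \<le> Sup {ereal E |E. achievable (P_mix m \<nu> PYX) (Q_mix k r \<tau> QY QX) \<epsilon> R E}"
        by (intro Sup_upper) auto
      then have "ereal (Xi i - e) + ereal e \<le> Sup {ereal E |E. achievable (P_mix m \<nu> PYX) (Q_mix k r \<tau> QY QX) \<epsilon> R E} + ereal e"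
        by (rule add_right_mono)
      then show "ereal (Xi i) \<le> Sup {ereal E |E. achievable (P_mix m \<nu> PYX) (Q_mix k r \<tau> QY QX) \<epsilon> R E} + ereal e"
        by simp
    qed
  qed
  then show ?thesis unfolding rhs .
qed

end
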